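(* Let $\mathcal{M}$ be a von Neumann algebra and let $M\subseteq\mathcal{M}_{sa}$ be a nonempty set with a lower bound $u\in\mathcal{M}_{sa}$ in $(\mathcal{M}_{sa},\preceq)$. Let $\mathcal{F}=\{F\subseteq M : F \text{ finite and nonempty}\}$. If $\delta\in\mathbb{R}$ is such that $u+\delta\mathbf{1}$ is a positive invertible element, then $$\inf_{x\in M}x=-\delta\mathbf{1}+\operatorname{s-lim}_{F\in\mathcal{F}}\ \operatorname{s-lim}_{n\in\mathbb{N}}\left(\sum_{x\in F}(x+\delta\mathbf{1})^{-n}\right)^{-\frac1n},$$ where the infimum is taken in $(\mathcal{M}_{sa},\preceq)$.
   Context: A von Neumann algebra $\mathcal{M}$ is a strongly operator closed C*-subalgebra of $\mathcal{B}(\mathcal{H})$, $\mathcal{H}$ a complex Hilbert space; $\mathbf{1}$ is its unit and $\mathcal{M}_{sa}$ its self-adjoint part. For $x\in\mathcal{M}_{sa}$, $(E^x_\lambda)_{\lambda\in\mathbb{R}}$ denotes its (right-continuous) spectral family: $E^x_\lambda$ is the spectral projection of $x$ for $(-\infty,\lambda]$. The spectral order $\preceq$ on $\mathcal{M}_{sa}$ is defined by: $x\preceq y$ iff $E^y_\lambda\le E^x_\lambda$ for every $\lambda\in\mathbb{R}$. In $(\mathcal{M}_{sa},\preceq)$ every nonempty set bounded below has an infimum. $\operatorname{s-lim}$ is the limit in the strong operator topology; $\mathcal{F}$ is directed by inclusion. *)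

theory Defs
  imports "HOL-Analysis.Analysis" "HOL-Algebra.Lattice"
begin

section \<open>Complex Hilbert spaces\<close>

text \<open>The underlying real inner product of the library is the real part of the complex one, so norm
  and topology are those of \<^class>\<open>real_inner\<close>. The complex inner product is linear in its first
  argument.\<close>

class complex_hilbert = real_inner + complete_space +
  fixes scaleC :: "complex \<Rightarrow> 'a \<Rightarrow> 'a" (infixr "*\<^sub>C" 75)
    and cinner :: "'a \<Rightarrow> 'a \<Rightarrow> complex"
  assumes scaleC_add_right: "a *\<^sub>C (x + y) = a *\<^sub>C x + a *\<^sub>C y"
    and scaleC_add_left: "(a + b) *\<^sub>C x = a *\<^sub>C x + b *\<^sub>C x"
    and scaleC_scaleC: "a *\<^sub>C (b *\<^sub>C x) = (a * b) *\<^sub>C x"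
    and scaleC_of_real: "complex_of_real r *\<^sub>C x = r *\<^sub>R x"
    and cinner_add_left: "cinner (x + y) z = cinner x z + cinner y z"
    and cinner_scaleC_left: "cinner (a *\<^sub>C x) y = a * cinner x y"
    and cinner_commute: "cinner x y = cnj (cinner y x)"
    and inner_eq_Re_cinner: "inner x y = Re (cinner x y)"

lemma norm_scaleC: "norm (c *\<^sub>C x) = cmod c * norm x"
  for x :: "'h::complex_hilbert"
proof -
  have "cinner (c *\<^sub>C x) (c *\<^sub>C x) = c * cnj (c * cinner x x)"
    by (metis cinner_scaleC_left cinner_commute)
  also have "\<dots> = complex_of_real ((cmod c)\<^sup>2) * cinner x x"
    by (metis cinner_commute complex_cnj_mult complex_norm_square mult.assoc)
  finally have "inner (c *\<^sub>C x) (c *\<^sub>C x) = (cmod c)\<^sup>2 * inner x x"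
    by (simp add: inner_eq_Re_cinner)
  then show ?thesis
    by (simp add: norm_eq_sqrt_inner real_sqrt_mult)
qed

section \<open>Bounded operators and von Neumann algebras\<close>

text \<open>The type of \<^typ>\<open>'a \<Rightarrow>\<^sub>L 'b\<close> consists of the bounded real-linear maps; the algebra of bounded
  operators on the complex Hilbert space is the subset of complex-linear ones.\<close>

definition bounded_ops :: "('h::complex_hilbert \<Rightarrow>\<^sub>L 'h) set" where
  "bounded_ops = {T. \<forall>c v. blinfun_apply T (c *\<^sub>C v) = c *\<^sub>C blinfun_apply T v}"

lift_definition scaleC_op :: "complex \<Rightarrow> ('h::complex_hilbert \<Rightarrow>\<^sub>L 'h) \<Rightarrow> ('h \<Rightarrow>\<^sub>L 'h)"
  is "\<lambda>c T v. c *\<^sub>C T v"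
proof -
  fix c and T :: "'h \<Rightarrow> 'h"
  assume "bounded_linear T"
  then interpret bounded_linear T .
  show "bounded_linear (\<lambda>v. c *\<^sub>C T v)"
  proof (rule bounded_linear_intro)
    fix x y and r :: real
    show "c *\<^sub>C T (x + y) = c *\<^sub>C T x + c *\<^sub>C T y"
      by (simp add: add scaleC_add_right)
    show "c *\<^sub>C T (r *\<^sub>R x) = r *\<^sub>R (c *\<^sub>C T x)"
      by (metis scaleR scaleC_of_real scaleC_scaleC mult.commute)
    show "norm (c *\<^sub>C T x) \<le> norm x * (cmod c * onorm T)"
      using mult_left_mono[OF onorm[OF bounded_linear_axioms, of x] norm_ge_zero[of c]]
      by (simp add: norm_scaleC ac_simps)
  qed
qed

definition is_adjoint :: "('h::complex_hilbert \<Rightarrow>\<^sub>L 'h) \<Rightarrow> ('h \<Rightarrow>\<^sub>L 'h) \<Rightarrow> bool" where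
  "is_adjoint T S \<longleftrightarrow> (\<forall>v w. cinner (T v) w = cinner v (S w))"

definition positive_op :: "('h::complex_hilbert \<Rightarrow>\<^sub>L 'h) \<Rightarrow> bool" where
  "positive_op T \<longleftrightarrow> is_adjoint T T \<and> (\<forall>v. 0 \<le> Re (cinner (T v) v))"

definition op_le :: "('h::complex_hilbert \<Rightarrow>\<^sub>L 'h) \<Rightarrow> ('h \<Rightarrow>\<^sub>L 'h) \<Rightarrow> bool" where
  "op_le S T \<longleftrightarrow> positive_op (T - S)"

definition projection :: "('h::complex_hilbert \<Rightarrow>\<^sub>L 'h) \<Rightarrow> bool" where
  "projection P \<longleftrightarrow> P \<in> bounded_ops \<and> is_adjoint P P \<and> P o\<^sub>L P = P"

definition cstar_subalgebra :: "('h::complex_hilbert \<Rightarrow>\<^sub>L 'h) set \<Rightarrow> bool" where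
  "cstar_subalgebra N \<longleftrightarrow> N \<subseteq> bounded_ops \<and> 0 \<in> N
     \<and> (\<forall>S\<in>N. \<forall>T\<in>N. S + T \<in> N)
     \<and> (\<forall>c. \<forall>T\<in>N. scaleC_op c T \<in> N)
     \<and> (\<forall>S\<in>N. \<forall>T\<in>N. S o\<^sub>L T \<in> N)
     \<and> (\<forall>T\<in>N. \<exists>S\<in>N. is_adjoint T S)
     \<and> closed N"

definition von_neumann_algebra :: "('h::complex_hilbert \<Rightarrow>\<^sub>L 'h) set \<Rightarrow> bool" where
  "von_neumann_algebra N \<longleftrightarrow> cstar_subalgebra N \<and> closedin strong_operator_topology N"

text \<open>The unit of a von Neumann algebra is not required to be the identity operator. Spectral
  projections, inverses and functions of elements are therefore taken relative to the unit \<open>e\<close>.\<close>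

definition is_unit_of :: "('h::complex_hilbert \<Rightarrow>\<^sub>L 'h) \<Rightarrow> ('h \<Rightarrow>\<^sub>L 'h) set \<Rightarrow> bool" where
  "is_unit_of e N \<longleftrightarrow> e \<in> N \<and> (\<forall>T\<in>N. e o\<^sub>L T = T \<and> T o\<^sub>L e = T)"

definition sa_part :: "('h::complex_hilbert \<Rightarrow>\<^sub>L 'h) set \<Rightarrow> ('h \<Rightarrow>\<^sub>L 'h) set" where
  "sa_part N = {T \<in> N. is_adjoint T T}"

definition invertible_in ::
  "('h::complex_hilbert \<Rightarrow>\<^sub>L 'h) set \<Rightarrow> ('h \<Rightarrow>\<^sub>L 'h) \<Rightarrow> ('h \<Rightarrow>\<^sub>L 'h) \<Rightarrow> bool" where
  "invertible_in N e T \<longleftrightarrow> T \<in> N \<and> (\<exists>S\<in>N. S o\<^sub>L T = e \<and> T o\<^sub>L S = e)"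

definition inverse_in ::
  "('h::complex_hilbert \<Rightarrow>\<^sub>L 'h) set \<Rightarrow> ('h \<Rightarrow>\<^sub>L 'h) \<Rightarrow> ('h \<Rightarrow>\<^sub>L 'h) \<Rightarrow> ('h \<Rightarrow>\<^sub>L 'h)" where
  "inverse_in N e T = (THE S. S \<in> N \<and> S o\<^sub>L T = e \<and> T o\<^sub>L S = e)"

definition op_power ::
  "('h::complex_hilbert \<Rightarrow>\<^sub>L 'h) \<Rightarrow> ('h \<Rightarrow>\<^sub>L 'h) \<Rightarrow> nat \<Rightarrow> ('h \<Rightarrow>\<^sub>L 'h)" where
  "op_power e T n = (((o\<^sub>L) T) ^^ n) e"

section \<open>Spectral families, functional calculus and the spectral order\<close>

definition resolution_of_identity ::
  "('h::complex_hilbert \<Rightarrow>\<^sub>L 'h) \<Rightarrow> (real \<Rightarrow> ('h \<Rightarrow>\<^sub>L 'h)) \<Rightarrow> bool" where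
  "resolution_of_identity e E \<longleftrightarrow>
     (\<forall>t. projection (E t))
     \<and> (\<forall>s t. s \<le> t \<longrightarrow> op_le (E s) (E t))
     \<and> (\<forall>t. limitin strong_operator_topology E (E t) (at_right t))
     \<and> (\<exists>a b. (\<forall>t<a. E t = 0) \<and> (\<forall>t\<ge>b. E t = e))"

text \<open>The operator \<open>T\<close> is the Riemann--Stieltjes integral \<open>\<integral> f(t) dE(t)\<close>, in operator norm. A
  partition \<open>t 0 \<le> \<dots> \<le> t n\<close> is admissible if it carries all of the mass of \<open>E\<close>, that is,
  \<open>E (t 0) = 0\<close> and \<open>E (t n) = e\<close>. Since \<open>E\<close> is right-continuous, the increment over a cell is the
  spectral projection of the half-open interval from \<open>t i\<close> (excluded) to \<open>t (Suc i)\<close> (included).\<close>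

definition has_spectral_integral ::
  "('h::complex_hilbert \<Rightarrow>\<^sub>L 'h) \<Rightarrow> (real \<Rightarrow> ('h \<Rightarrow>\<^sub>L 'h)) \<Rightarrow> (real \<Rightarrow> real) \<Rightarrow> ('h \<Rightarrow>\<^sub>L 'h) \<Rightarrow> bool" where
  "has_spectral_integral e E f T \<longleftrightarrow>
     (\<forall>\<epsilon>>0. \<exists>d>0. \<forall>(n::nat) (t::nat \<Rightarrow> real) (s::nat \<Rightarrow> real).
        E (t 0) = 0 \<and> E (t n) = e \<and>
        (\<forall>i<n. t i \<le> t (Suc i) \<and> t (Suc i) - t i < d \<and> s i \<in> {t i..t (Suc i)}) \<longrightarrow>
        norm (T - (\<Sum>i<n. f (s i) *\<^sub>R (E (t (Suc i)) - E (t i)))) < \<epsilon>)"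

definition spectral_family ::
  "('h::complex_hilbert \<Rightarrow>\<^sub>L 'h) \<Rightarrow> ('h \<Rightarrow>\<^sub>L 'h) \<Rightarrow> real \<Rightarrow> ('h \<Rightarrow>\<^sub>L 'h)" where
  "spectral_family e x =
     (THE E. resolution_of_identity e E \<and> has_spectral_integral e E (\<lambda>t. t) x)"

text \<open>The functional calculus \<open>f(x)\<close> for a self-adjoint \<open>x\<close>; it is meaningful when \<open>f\<close> is continuous
  on a neighbourhood of the spectrum of \<open>x\<close>.\<close>

definition fun_calc ::
  "('h::complex_hilbert \<Rightarrow>\<^sub>L 'h) \<Rightarrow> (real \<Rightarrow> real) \<Rightarrow> ('h \<Rightarrow>\<^sub>L 'h) \<Rightarrow> ('h \<Rightarrow>\<^sub>L 'h)" where
  "fun_calc e f x = (THE T. has_spectral_integral e (spectral_family e x) f T)"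

definition spectral_le ::
  "('h::complex_hilbert \<Rightarrow>\<^sub>L 'h) \<Rightarrow> ('h \<Rightarrow>\<^sub>L 'h) \<Rightarrow> ('h \<Rightarrow>\<^sub>L 'h) \<Rightarrow> bool" where
  "spectral_le e x y \<longleftrightarrow> (\<forall>t. op_le (spectral_family e y t) (spectral_family e x t))"

definition spectral_poset ::
  "('h::complex_hilbert \<Rightarrow>\<^sub>L 'h) set \<Rightarrow> ('h \<Rightarrow>\<^sub>L 'h) \<Rightarrow> ('h \<Rightarrow>\<^sub>L 'h) gorder" where
  "spectral_poset N e = \<lparr>carrier = sa_part N, eq = (=), le = spectral_le e\<rparr>"

end

theory Submission
  imports Defs
begin

text \<open>Write \<open>E(x)\<close> for the spectral family of \<open>x\<close> and \<open>c(x) = x + \<delta>1\<close>. The spectral order compares ranges of spectral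
projections, so the infimum of a set \<open>X\<close> is dictated: its spectral projection \<open>G(t)\<close> is the
right-continuous regularisation of the join of the \<open>E(x)(t)\<close> over \<open>x\<close> in \<open>X\<close>, and the infimum is
\<open>\<integral> t dG(t)\<close>. A lower bound of \<open>X\<close> keeps the family \<open>G\<close> away from minus infinity, and the gap in the
spectrum of \<open>u + \<delta>1\<close> at \<open>0\<close> is inherited by every \<open>c(x)\<close> and by the infimum
(\<open>positive_invertible_gap\<close>, \<open>infimum_exists\<close>, \<open>is_infimum_greatest\<close>).

For finite \<open>F\<close> let \<open>B(n)\<close> be the sum of the powers \<open>c(x)\<^sup>-\<^sup>n\<close> and \<open>D(n) = B(n)\<^sup>-\<^sup>1\<^sup>/\<^sup>n\<close>. The spectral
projection of \<open>D(n)\<close> below \<open>p\<close> is that of \<open>B(n)\<close> above \<open>p\<^sup>-\<^sup>n\<close>. Two estimates of Markov type locate it.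
A vector \<open>v\<close> orthogonal to the range of \<open>G(s)\<close> satisfies \<open>\<parallel>B(n)v\<parallel> \<le> |F| (s + \<delta>)\<^sup>-\<^sup>n \<parallel>v\<parallel>\<close>, so its component
where \<open>B(n) > (p + \<delta>)\<^sup>-\<^sup>n\<close> is at most of the order \<open>((p + \<delta>)/(s + \<delta>))\<^sup>n\<close> and vanishes in the limit for \<open>p < s\<close>
(\<open>power_sum_complement_tendsto\<close>). If \<open>v\<close> lies in the range of some \<open>E(x)(\<mu>)\<close>, then \<open>v = c(x)\<^sup>-\<^sup>n c(x)\<^sup>n v\<close> and
the Cauchy-Schwarz inequality for the positive form of \<open>c(x)\<^sup>-\<^sup>n\<close> bounds the component of \<open>v\<close> where
\<open>B(n) \<le> (q + \<delta>)\<^sup>-\<^sup>n\<close> by a power of \<open>(\<mu> + \<delta>)/(q + \<delta>)\<close>; vectors with vanishing component form a closed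
subspace, so the same holds on the join (\<open>power_sum_tendsto_zero\<close>). Thus on the range of
\<open>G(t) - G(s)\<close> the operators \<open>D(n)\<close> are asymptotically within \<open>2(t - s)\<close> of the scalar \<open>s + \<delta>\<close>.

Such local control is enough for strong convergence (\<open>strong_convergence_criterion\<close>): with \<open>n\<close> cells of
length \<open>h\<close> the total error on \<open>v\<close> is of order \<open>h\<close> times the sum of the norms of the \<open>n\<close> orthogonal components
of \<open>v\<close>, hence at most of order \<open>h n\<^sup>1\<^sup>/\<^sup>2\<close>, which tends to \<open>0\<close>. The criterion serves both limits, since the spectral
projections of the infima of finite subsets exhaust those of the infimum of \<open>M\<close>, up to an arbitrarily small
shift of the parameter
(\<open>infima_tendsto_infimum\<close>).

The spectral calculus itself is built from the definition of the spectral integral by Riemann sums.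
Uniqueness of the spectral family holds because the range of \<open>E(t)\<close> can be read off from the growth of
the powers of \<open>x - p\<close> (\<open>spectral_range_iff\<close>). For existence (\<open>spectral_theorem\<close>), the projection
\<open>E(t)\<close> is the projection onto the kernel of the positive part of \<open>x - t\<close>, which lies in the von Neumann
algebra as a strong limit of powers of a contraction. As the unit \<open>e\<close> of the algebra may differ from the
identity operator, everything is relative to the range of \<open>e\<close>.\<close>

section \<open>Operators and projections on a Hilbert space\<close>

instance complex_hilbert \<subseteq> banach ..

text \<open>The strong operator topology is pulled back from the product topology on functions, whose limits
  are pointwise.\<close>

lemma limitin_strong_operator_topology:
  "limitin strong_operator_topology f l F \<longleftrightarrow>
     (\<forall>v. ((\<lambda>i. blinfun_apply (f i) v) \<longlongrightarrow> blinfun_apply l v) F)"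
proof
  assume l: "limitin strong_operator_topology f l F"
  show "\<forall>v. ((\<lambda>i. blinfun_apply (f i) v) \<longlongrightarrow> blinfun_apply l v) F"
  proof
    fix v
    show "((\<lambda>i. blinfun_apply (f i) v) \<longlongrightarrow> blinfun_apply l v) F"
      using continuous_map_limit[OF strong_operator_topology_continuous_evaluation[of v] l]
      by (simp add: o_def)
  qed
next
  assume p: "\<forall>v. ((\<lambda>i. blinfun_apply (f i) v) \<longlongrightarrow> blinfun_apply l v) F"
  have "limitin (product_topology (\<lambda>_. euclidean) UNIV) (\<lambda>i. blinfun_apply (f i)) (blinfun_apply l) F"
    using p by (simp add: limitin_componentwise)
  then have t: "((\<lambda>i. blinfun_apply (f i)) \<longlongrightarrow> blinfun_apply l) F"
    by (simp add: euclidean_product_topology)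
  show "limitin strong_operator_topology f l F"
    unfolding limitin_def
  proof (intro conjI allI impI)
    show "l \<in> topspace strong_operator_topology"
      by (simp add: strong_operator_topology_topspace)
    fix U assume U: "openin strong_operator_topology U \<and> l \<in> U"
    then obtain V where V: "open V" "U = blinfun_apply -` V"
      unfolding strong_operator_topology_def openin_pullback_topology by auto
    then show "\<forall>\<^sub>F x in F. f x \<in> U"
      using topological_tendstoD[OF t V(1)] U by auto
  qed
qed

text \<open>Symmetry for the underlying real inner product. A complex-linear operator is self-adjoint exactly
  when it is symmetric in this sense, so all estimates below can be made with real inner products.\<close>

definition sym_op :: "('h::real_inner \<Rightarrow>\<^sub>L 'h) \<Rightarrow> bool" where
  "sym_op T \<longleftrightarrow> (\<forall>v w. T v \<bullet> w = v \<bullet> T w)"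

lemma sym_opD: "sym_op T \<Longrightarrow> T v \<bullet> w = v \<bullet> T w"
  by (simp add: sym_op_def)

text \<open>The imaginary part of the complex inner product is recovered from the real one through
  multiplication by the imaginary unit.\<close>

lemma cinner_conv_inner: "cinner x y = Complex (x \<bullet> y) (- ((\<i> *\<^sub>C x) \<bullet> y))"
  by (simp add: inner_eq_Re_cinner cinner_scaleC_left complex_eq_iff)

lemma inner_scaleC_left: "(c *\<^sub>C x) \<bullet> y = x \<bullet> (cnj c *\<^sub>C y)"
proof -
  have "cinner x (cnj c *\<^sub>C y) = c * cinner x y"
    by (metis cinner_commute cinner_scaleC_left complex_cnj_cnj complex_cnj_mult)
  then show ?thesis
    by (simp add: inner_eq_Re_cinner cinner_scaleC_left)
qed

lemma is_adjoint_imp_sym_op: "is_adjoint T T \<Longrightarrow> sym_op T"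
  by (simp add: is_adjoint_def sym_op_def inner_eq_Re_cinner)

lemma bounded_opsD: "T \<in> bounded_ops \<Longrightarrow> T (c *\<^sub>C v) = c *\<^sub>C T v"
  by (simp add: bounded_ops_def)

lemma scaleC_diff_right: "c *\<^sub>C (x - y) = c *\<^sub>C x - c *\<^sub>C y"
  using scaleC_add_right[of c "x - y" y] by simp

lemma scaleC_zero_right: "c *\<^sub>C (0 :: 'h::complex_hilbert) = 0"
  using scaleC_diff_right[of c "0 :: 'h" 0] by simp

lemma bounded_ops_diff: "S \<in> bounded_ops \<Longrightarrow> T \<in> bounded_ops \<Longrightarrow> S - T \<in> bounded_ops"
  by (simp add: bounded_ops_def blinfun.diff_left scaleC_diff_right)

lemma is_adjoint_self_iff:
  assumes "T \<in> bounded_ops"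
  shows "is_adjoint T T \<longleftrightarrow> sym_op T"
proof
  assume "sym_op T"
  moreover have "\<i> *\<^sub>C T v = T (\<i> *\<^sub>C v)" for v
    using assms by (simp add: bounded_opsD)
  ultimately show "is_adjoint T T"
    by (simp add: is_adjoint_def cinner_conv_inner sym_op_def)
qed (rule is_adjoint_imp_sym_op)

lemma positive_op_inner: "positive_op T \<Longrightarrow> 0 \<le> T v \<bullet> v"
  by (simp add: positive_op_def inner_eq_Re_cinner)

lemma projection_iff:
  "projection P \<longleftrightarrow> P \<in> bounded_ops \<and> sym_op P \<and> (\<forall>v. P (P v) = P v)"
  unfolding projection_def using is_adjoint_self_iff[of P]
  by (metis blinfun_apply_blinfun_compose blinfun_eqI)

lemma projection_idem: "projection P \<Longrightarrow> P (P v) = P v"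
  by (simp add: projection_iff)

lemma projection_inner: "projection P \<Longrightarrow> P v \<bullet> w = P v \<bullet> P w"
  by (metis projection_iff sym_op_def)

lemma projection_inner': "projection P \<Longrightarrow> P v \<bullet> w = v \<bullet> P w"
  by (metis projection_iff sym_op_def)

lemma projection_pythagoras:
  assumes "projection P"
  shows "(norm (v - P v))\<^sup>2 = (norm v)\<^sup>2 - (norm (P v))\<^sup>2"
  using projection_inner[OF assms, of v v]
  by (simp add: power2_norm_eq_inner inner_diff_left inner_diff_right inner_commute)

lemma projection_norm_le: "projection P \<Longrightarrow> norm (P v) \<le> norm v"
  by (metis diff_ge_0_iff_ge norm_ge_zero power2_le_imp_le projection_pythagoras zero_le_power2)

lemma projection_norm_eq_imp: "projection P \<Longrightarrow> norm v \<le> norm (P v) \<Longrightarrow> P v = v"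
  using projection_pythagoras[of P v] projection_norm_le[of P v] by simp

lemma projection_le_commute:
  assumes P: "projection P" and Q: "projection Q" and QP: "\<And>v. Q (P v) = P v"
  shows "P (Q v) = P v"
proof -
  have "P (Q v) \<bullet> w = P v \<bullet> w" for w
    using projection_inner'[OF P] projection_inner'[OF Q] QP by metis
  then show ?thesis
    by (metis inner_commute vector_eq_rdot)
qed

lemma op_le_projection:
  assumes P: "projection P" and Q: "projection Q"
  shows "op_le P Q \<longleftrightarrow> (\<forall>v. Q (P v) = P v)"
proof
  assume le: "op_le P Q"
  show "\<forall>v. Q (P v) = P v"
  proof
    fix v
    have "0 \<le> (Q - P) (P v) \<bullet> P v"
      using le positive_op_inner unfolding op_le_def by blast
    then have "(norm (P v))\<^sup>2 \<le> (norm (Q (P v)))\<^sup>2"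
      using projection_inner[OF Q, of "P v" "P v"]
      by (simp add: blinfun.diff_left inner_diff_left projection_idem[OF P] power2_norm_eq_inner)
    then show "Q (P v) = P v"
      using projection_norm_eq_imp[OF Q] power2_le_imp_le[OF _ norm_ge_zero] by blast
  qed
next
  assume QP: "\<forall>v. Q (P v) = P v"
  have PQ: "P (Q v) = P v" for v
    by (rule projection_le_commute[OF P Q]) (use QP in blast)
  have "Q - P \<in> bounded_ops"
    using P Q by (simp add: projection_iff bounded_ops_diff)
  moreover have "sym_op (Q - P)"
    using P Q unfolding projection_iff sym_op_def
    by (simp add: blinfun.diff_left inner_diff_left inner_diff_right)
  moreover have "0 \<le> (Q - P) v \<bullet> v" for v
  proof -
    have "(Q - P) v \<bullet> v = (Q v - P v) \<bullet> (Q v - P v)"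
      using projection_inner[OF Q, of v v] projection_inner[OF P, of v v]
        projection_inner'[OF P, of v "Q v"] PQ[of v] QP
        projection_inner[OF P, of v "Q v"]
      by (simp add: blinfun.diff_left inner_diff_left inner_diff_right inner_commute)
    then show ?thesis by simp
  qed
  ultimately show "op_le P Q"
    by (simp add: op_le_def positive_op_def is_adjoint_self_iff inner_eq_Re_cinner)
qed

text \<open>The quadratic form of \<open>A\<close> is nonnegative on \<open>v + r w\<close> for every real
  \<open>r\<close>, so its discriminant is not positive.\<close>

lemma positive_cauchy_schwarz:
  assumes A: "sym_op A" and pos: "\<And>v. 0 \<le> A v \<bullet> v"
  shows "(A v \<bullet> w)\<^sup>2 \<le> (A v \<bullet> v) * (A w \<bullet> w)"
proof -
  have q: "0 \<le> A v \<bullet> v + 2 * r * (A v \<bullet> w) + r\<^sup>2 * (A w \<bullet> w)" for r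
  proof -
    have "A (v + r *\<^sub>R w) \<bullet> (v + r *\<^sub>R w) = A v \<bullet> v + 2 * r * (A v \<bullet> w) + r\<^sup>2 * (A w \<bullet> w)"
      using sym_opD[OF A, of w v]
      by (simp add: blinfun.bilinear_simps inner_add_left inner_add_right algebra_simps
          power2_eq_square inner_commute)
    then show ?thesis using pos by metis
  qed
  show ?thesis
  proof (cases "A w \<bullet> w = 0")
    case True
    have "A v \<bullet> w = 0"
    proof (rule ccontr)
      assume n: "A v \<bullet> w \<noteq> 0"
      show False
        using q[of "- (A v \<bullet> v + 1) / (2 * (A v \<bullet> w))"] True n by (simp add: field_simps)
    qed
    then show ?thesis using True by simp
  next
    case False
    then have c: "A w \<bullet> w > 0" using pos[of w] by simp
    have "0 \<le> A v \<bullet> v - (A v \<bullet> w)\<^sup>2 / (A w \<bullet> w)"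
      using q[of "- (A v \<bullet> w) / (A w \<bullet> w)"] c
      by (simp add: power2_eq_square field_simps)
    then show ?thesis using c by (simp add: field_simps)
  qed
qed

lemma positive_form_zero:
  assumes "sym_op A" "\<And>v. 0 \<le> A v \<bullet> v" "A v \<bullet> v \<le> 0"
  shows "A v = 0"
proof -
  have "A v \<bullet> v = 0" using assms(2)[of v] assms(3) by simp
  then show ?thesis
    using positive_cauchy_schwarz[OF assms(1,2), of v "A v"] by simp
qed

lemma convergent_square_distI:
  fixes X :: "nat \<Rightarrow> 'h::{real_normed_vector,complete_space}"
  assumes "\<And>\<epsilon>. \<epsilon> > 0 \<Longrightarrow> \<exists>K. \<forall>m\<ge>K. \<forall>n\<ge>K. (norm (X m - X n))\<^sup>2 < \<epsilon>"
  obtains l where "X \<longlonglongrightarrow> l"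
proof -
  have "Cauchy X"
  proof (rule metric_CauchyI)
    fix \<epsilon> :: real assume \<epsilon>: "\<epsilon> > 0"
    then obtain K where "\<forall>m\<ge>K. \<forall>n\<ge>K. (norm (X m - X n))\<^sup>2 < \<epsilon>\<^sup>2"
      using assms[of "\<epsilon>\<^sup>2"] by auto
    then have "\<forall>m\<ge>K. \<forall>n\<ge>K. dist (X m) (X n) < \<epsilon>"
      unfolding dist_norm using \<epsilon> power_less_imp_less_base less_imp_le by blast
    then show "\<exists>K. \<forall>m\<ge>K. \<forall>n\<ge>K. dist (X m) (X n) < \<epsilon>" by blast
  qed
  then show ?thesis using that Cauchy_convergent convergent_def by blast
qed

text \<open>A minimising sequence for the distance from \<open>v\<close> to \<open>W\<close> is a Cauchy
  sequence by the parallelogram law; minimality of the limit along every line in \<open>W\<close> gives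
  orthogonality.\<close>

lemma closed_subspace_nearest_point:
  fixes W :: "'h::{real_inner,complete_space} set"
  assumes W: "subspace W" "closed W"
  shows "\<exists>u\<in>W. \<forall>w\<in>W. (v - u) \<bullet> w = 0"
proof -
  define d where "d = (INF u\<in>W. (norm (v - u))\<^sup>2)"
  have ne: "W \<noteq> {}" using subspace_0[OF W(1)] by auto
  have bdd: "bdd_below ((\<lambda>u. (norm (v - u))\<^sup>2) ` W)"
    by (rule bdd_belowI[of _ 0]) auto
  have d: "d \<le> (norm (v - u))\<^sup>2" if "u \<in> W" for u
    unfolding d_def using bdd that by (rule cINF_lower)
  have "\<exists>u\<in>W. (norm (v - u))\<^sup>2 < d + inverse (real (Suc n))" for n
    using cINF_less_iff[OF ne bdd, of "d + inverse (real (Suc n))"] unfolding d_def by simp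
  then obtain u where u: "\<And>n. u n \<in> W" "\<And>n. (norm (v - u n))\<^sup>2 < d + inverse (real (Suc n))"
    by metis
  have par: "(norm (u n - u m))\<^sup>2 \<le> 2 * inverse (real (Suc n)) + 2 * inverse (real (Suc m))" for n m
  proof -
    have "(1/2) *\<^sub>R (u n + u m) \<in> W"
      using u W(1) by (simp add: subspace_add subspace_scale)
    then have "d \<le> (norm (v - (1/2) *\<^sub>R (u n + u m)))\<^sup>2" by (rule d)
    moreover have "(norm (u n - u m))\<^sup>2 = 2 * (norm (v - u n))\<^sup>2 + 2 * (norm (v - u m))\<^sup>2
        - 4 * (norm (v - (1/2) *\<^sub>R (u n + u m)))\<^sup>2"
      by (simp add: power2_norm_eq_inner inner_diff_left inner_diff_right inner_add_left
          inner_add_right inner_commute algebra_simps)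
    ultimately show ?thesis using u(2)[of n] u(2)[of m] by linarith
  qed
  obtain l where l: "u \<longlonglongrightarrow> l"
  proof (rule convergent_square_distI)
    fix \<epsilon> :: real assume "\<epsilon> > 0"
    then obtain K where K: "inverse (real (Suc K)) < \<epsilon> / 4"
      using reals_Archimedean[of "\<epsilon> / 4"] by auto
    have "(norm (u m - u n))\<^sup>2 < \<epsilon>" if "m \<ge> K" "n \<ge> K" for m n
    proof -
      have "inverse (real (Suc m)) \<le> inverse (real (Suc K))"
        "inverse (real (Suc n)) \<le> inverse (real (Suc K))"
        using that by (auto intro!: le_imp_inverse_le)
      then show ?thesis using par[of m n] K by linarith
    qed
    then show "\<exists>K. \<forall>m\<ge>K. \<forall>n\<ge>K. (norm (u m - u n))\<^sup>2 < \<epsilon>" by blast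
  qed
  have lW: "l \<in> W"
    using W(2) u(1) l closed_sequentially by blast
  have "(norm (v - l))\<^sup>2 \<le> d + 0"
  proof (rule LIMSEQ_le)
    show "(\<lambda>n. (norm (v - u n))\<^sup>2) \<longlonglongrightarrow> (norm (v - l))\<^sup>2"
      using l by (intro tendsto_intros)
    show "(\<lambda>n. d + inverse (real (Suc n))) \<longlonglongrightarrow> d + 0"
      by (intro tendsto_add tendsto_const LIMSEQ_inverse_real_of_nat)
    show "\<exists>N. \<forall>n\<ge>N. (norm (v - u n))\<^sup>2 \<le> d + inverse (real (Suc n))"
      using u(2) less_imp_le by blast
  qed
  then have min: "(norm (v - l))\<^sup>2 \<le> (norm (v - w))\<^sup>2" if "w \<in> W" for w
    using d[OF that] by linarith
  have "(v - l) \<bullet> w = 0" if w: "w \<in> W" for w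
  proof (cases "w = 0")
    case False
    then have c: "w \<bullet> w > 0" by simp
    define r where "r = ((v - l) \<bullet> w) / (w \<bullet> w)"
    have "l + r *\<^sub>R w \<in> W"
      using lW w W(1) by (simp add: subspace_add subspace_scale)
    then have "(norm (v - l))\<^sup>2 \<le> (norm ((v - l) - r *\<^sub>R w))\<^sup>2"
      using min by (simp add: diff_diff_eq)
    then have "2 * r * ((v - l) \<bullet> w) \<le> r\<^sup>2 * (w \<bullet> w)"
      unfolding power2_norm_eq_inner
      by (simp add: inner_diff_left[of "v - l"] inner_diff_right[of _ "v - l"] inner_commute
          power2_eq_square algebra_simps)
    moreover have "r\<^sup>2 * (w \<bullet> w) = r * ((v - l) \<bullet> w)"
      using c by (simp add: r_def power2_eq_square)
    moreover have "r * ((v - l) \<bullet> w) = ((v - l) \<bullet> w)\<^sup>2 / (w \<bullet> w)"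
      by (simp add: r_def power2_eq_square)
    ultimately have "((v - l) \<bullet> w)\<^sup>2 / (w \<bullet> w) \<le> 0" by simp
    then show ?thesis using c by (simp add: divide_le_0_iff)
  qed simp
  then show ?thesis using lW by blast
qed

text \<open>Uniqueness of the orthogonal decomposition makes the nearest point depend linearly on
  \<open>v\<close>; it is complex-linear because \<open>W\<close> is invariant under complex scalars.\<close>

lemma ex_projection_onto:
  fixes W :: "'h::complex_hilbert set"
  assumes "subspace W" "closed W" and cW: "\<And>c v. v \<in> W \<Longrightarrow> c *\<^sub>C v \<in> W"
  shows "\<exists>P. projection P \<and> (\<forall>v. P v = v \<longleftrightarrow> v \<in> W)"
proof -
  note W = assms(1,2)
  obtain p where p: "\<And>v. p v \<in> W" "\<And>v w. w \<in> W \<Longrightarrow> (v - p v) \<bullet> w = 0"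
    using closed_subspace_nearest_point[OF W] by metis
  have unique: "p v = u" if "u \<in> W" "\<And>w. w \<in> W \<Longrightarrow> (v - u) \<bullet> w = 0" for u v
  proof -
    have m: "u - p v \<in> W" using that(1) p(1) W(1) by (simp add: subspace_diff)
    have "(u - p v) \<bullet> (u - p v) = (v - p v) \<bullet> (u - p v) - (v - u) \<bullet> (u - p v)"
      by (simp add: inner_diff_left)
    also have "\<dots> = 0" using that(2)[OF m] p(2)[OF m] by simp
    finally show ?thesis by simp
  qed
  have add: "p (v + w) = p v + p w" for v w
  proof (rule unique)
    show "p v + p w \<in> W" using p(1) W(1) by (simp add: subspace_add)
    show "(v + w - (p v + p w)) \<bullet> z = 0" if "z \<in> W" for z
      using p(2)[OF that, of v] p(2)[OF that, of w] by (simp add: inner_diff_left inner_add_left)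
  qed
  have sc: "p (c *\<^sub>C v) = c *\<^sub>C p v" for c v
  proof (rule unique)
    show "c *\<^sub>C p v \<in> W" using p(1) cW by simp
    fix z assume "z \<in> W"
    then have "(v - p v) \<bullet> (cnj c *\<^sub>C z) = 0" using cW p(2) by simp
    then show "(c *\<^sub>C v - c *\<^sub>C p v) \<bullet> z = 0"
      by (simp add: inner_diff_left inner_scaleC_left)
  qed
  have orth: "p v \<bullet> w = p v \<bullet> p w" for v w
    using p(2)[OF p(1), of w v] by (simp add: inner_diff_left inner_diff_right inner_commute)
  have bl: "bounded_linear p"
  proof (rule bounded_linear_intro)
    show "p (r *\<^sub>R v) = r *\<^sub>R p v" for r v
      using sc[of "complex_of_real r" v] by (simp add: scaleC_of_real)
    show "norm (p v) \<le> norm v * 1" for v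
    proof -
      have "norm (p v) * norm (p v) \<le> norm (p v) * norm v"
        using orth[of v v] norm_cauchy_schwarz[of "p v" v]
        by (simp add: power2_norm_eq_inner[symmetric] power2_eq_square)
      then show ?thesis by (cases "norm (p v) = 0") auto
    qed
  qed (rule add)
  define P where "P = Blinfun p"
  have P: "P v = p v" for v
    unfolding P_def by (simp add: bounded_linear_Blinfun_apply[OF bl])
  have idem: "p w = w" if "w \<in> W" for w
    by (rule unique) (use that in auto)
  have "projection P"
    unfolding projection_iff sym_op_def bounded_ops_def
    using sc orth idem p(1) by (simp add: P) (metis inner_commute)
  moreover have "P v = v \<longleftrightarrow> v \<in> W" for v
    using idem p(1) P by metis
  ultimately show ?thesis by blast
qed

section \<open>Resolutions of the identity\<close>

locale resolution =
  fixes e :: "'h::complex_hilbert \<Rightarrow>\<^sub>L 'h" and E :: "real \<Rightarrow> ('h \<Rightarrow>\<^sub>L 'h)"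
  assumes resolution: "resolution_of_identity e E"
begin

lemma proj: "projection (E t)"
  using resolution by (simp add: resolution_of_identity_def)

lemma idem [simp]: "E t (E t v) = E t v"
  by (rule projection_idem[OF proj])

lemma up: "s \<le> t \<Longrightarrow> E t (E s v) = E s v"
  using resolution op_le_projection[OF proj proj] by (simp add: resolution_of_identity_def)

lemma down: "s \<le> t \<Longrightarrow> E s (E t v) = E s v"
  by (rule projection_le_commute[OF proj proj up])

lemma commute: "E s (E t v) = E t (E s v)"
  by (cases "s \<le> t") (simp_all add: up down)

lemma bounds: obtains a b where "\<And>t. t < a \<Longrightarrow> E t = 0" "\<And>t. t \<ge> b \<Longrightarrow> E t = e" "a < b"
proof -
  obtain a b where ab: "\<forall>t<a. E t = 0" "\<forall>t\<ge>b. E t = e"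
    using resolution by (auto simp: resolution_of_identity_def)
  show ?thesis
    by (rule that[of "min a (b - 1)" b]) (use ab in auto)
qed

lemma proj_e: "projection e"
  using bounds proj by (metis order_refl)

lemma e_E [simp]: "e (E t v) = E t v"
  by (metis bounds linorder_le_cases order_refl up order_trans)

lemma E_e [simp]: "E t (e v) = E t v"
  by (rule projection_le_commute[OF proj proj_e]) simp

lemma E_0: "E p = 0 \<Longrightarrow> s \<le> p \<Longrightarrow> E s = 0"
  by (rule blinfun_eqI) (metis down blinfun.zero_left blinfun.zero_right up)

lemma E_top: "E q = e \<Longrightarrow> q \<le> t \<Longrightarrow> E t = e"
  by (rule blinfun_eqI) (metis E_e e_E up)

lemma right_tendsto: "((\<lambda>s. E s v) \<longlongrightarrow> E t v) (at_right t)"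
  using resolution by (simp add: resolution_of_identity_def limitin_strong_operator_topology)

lemma fixed_right: 
  assumes "\<And>s. s > t \<Longrightarrow> E s v = v"
  shows "E t v = v"
proof -
  have "((\<lambda>s. E s v) \<longlongrightarrow> v) (at_right t)"
    by (rule tendsto_eventually) (use assms in \<open>auto simp: eventually_at_filter\<close>)
  then show ?thesis
    using right_tendsto tendsto_unique trivial_limit_at_right_real by metis
qed

lemma sym: "E t v \<bullet> w = v \<bullet> E t w"
  by (rule projection_inner'[OF proj])

lemma norm_le: "norm (E t v) \<le> norm v"
  by (rule projection_norm_le[OF proj])

lemma increment_norm:
  assumes "s \<le> t"
  shows "(norm (E t v - E s v))\<^sup>2 = (norm (E t v))\<^sup>2 - (norm (E s v))\<^sup>2"
  using projection_pythagoras[OF proj, of "E t v" s] down[OF assms] by simp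

end

text \<open>Strong right continuity follows from the condition on ranges alone. For an increasing family of
  projections the squared norm of \<open>E s v\<close> is monotone in \<open>s\<close>, and differences of
  these numbers are squared distances; so \<open>E s v\<close> converges as \<open>s\<close> decreases to
  \<open>t\<close>, and the limit is fixed by every \<open>E s\<close> with \<open>s > t\<close>, hence by
  \<open>E t\<close>.\<close>

lemma resolution_of_identityI:
  assumes P: "\<And>t. projection (E t)"
    and up: "\<And>s t v. s \<le> t \<Longrightarrow> E t (E s v) = E s v"
    and right: "\<And>t v. (\<And>s. s > t \<Longrightarrow> E s v = v) \<Longrightarrow> E t v = v"
    and bot: "\<And>t. t < a \<Longrightarrow> E t = 0" and top: "\<And>t. t \<ge> b \<Longrightarrow> E t = e"
  shows "resolution_of_identity e E"
proof -
  have down: "E s (E t v) = E s v" if "s \<le> t" for s t v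
    by (rule projection_le_commute[OF P P up[OF that]])
  have incr: "(norm (E t v - E s v))\<^sup>2 = (norm (E t v))\<^sup>2 - (norm (E s v))\<^sup>2" if "s \<le> t" for s t v
    using projection_pythagoras[OF P, of "E t v" s] down[OF that] by simp
  have mono: "norm (E s v) \<le> norm (E t v)" if "s \<le> t" for s t v
    using projection_norm_le[OF P, of s "E t v"] down[OF that] by simp
  have lim: "((\<lambda>s. E s v) \<longlongrightarrow> E t v) (at_right t)" for t v
  proof -
    define q where "q n = t + inverse (real (Suc n))" for n
    define f where "f n = (norm (E (q n) v))\<^sup>2" for n
    have qmono: "q n \<le> q m" if "m \<le> n" for m n
      using that by (auto simp: q_def intro!: le_imp_inverse_le)
    have "decseq f"
      unfolding decseq_def f_def using mono qmono by (simp add: power_mono)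
    then obtain l where "f \<longlonglongrightarrow> l"
      by (rule decseq_convergent[where B = 0]) (auto simp: f_def)
    then have "convergent f" by (rule convergentI)
    then have Cf: "Cauchy f" by (rule convergent_Cauchy)
    have dist: "(norm (E (q m) v - E (q n) v))\<^sup>2 = \<bar>f m - f n\<bar>" for m n
    proof (cases "m \<le> n")
      case True
      then show ?thesis using incr[OF qmono[OF True], of v] mono[OF qmono[OF True], of v]
        by (simp add: f_def)
    next
      case False
      then have "n \<le> m" by simp
      then show ?thesis using incr[OF qmono[of n m], of v] mono[OF qmono[of n m], of v]
        by (simp add: f_def norm_minus_commute abs_minus_commute)
    qed
    obtain u where u: "(\<lambda>n. E (q n) v) \<longlonglongrightarrow> u"
    proof (rule convergent_square_distI)
      show "\<exists>K. \<forall>m\<ge>K. \<forall>n\<ge>K. (norm (E (q m) v - E (q n) v))\<^sup>2 < \<epsilon>" if "\<epsilon> > 0" for \<epsilon>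
        using metric_CauchyD[OF Cf that] by (simp add: dist dist_real_def)
    qed
    have q0: "q \<longlonglongrightarrow> t"
      using tendsto_add[OF tendsto_const[of t] LIMSEQ_inverse_real_of_nat] by (simp add: q_def[abs_def])
    have "E s u = u" if s: "s > t" for s
    proof -
      have "(\<lambda>n. E s (E (q n) v)) \<longlonglongrightarrow> E s u"
        using u by (rule blinfun.tendsto[OF tendsto_const])
      moreover have "eventually (\<lambda>n. E s (E (q n) v) = E (q n) v) sequentially"
        using order_tendstoD(2)[OF q0 s] by eventually_elim (simp add: up)
      ultimately have "(\<lambda>n. E (q n) v) \<longlonglongrightarrow> E s u"
        by (rule Lim_transform_eventually)
      then show ?thesis using u LIMSEQ_unique by blast
    qed
    then have "E t u = u" by (rule right)
    moreover have "E t (E (q n) v) = E t v" for n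
      by (rule down) (simp add: q_def)
    then have "(\<lambda>n. E t v) \<longlonglongrightarrow> E t u"
      using blinfun.tendsto[OF tendsto_const u, of "E t"] by simp
    then have "E t u = E t v"
      by (simp add: LIMSEQ_const_iff)
    ultimately have u': "u = E t v" by simp
    show ?thesis
    proof (rule tendstoI)
      fix \<epsilon> :: real assume "\<epsilon> > 0"
      then obtain n where n: "norm (E (q n) v - E t v) < \<epsilon>"
        using u u' by (metis (no_types, lifting) LIMSEQ_iff order_refl)
      have "dist (E s v) (E t v) < \<epsilon>" if s: "t < s" "s < q n" for s
      proof -
        have "(norm (E s v - E t v))\<^sup>2 \<le> (norm (E (q n) v - E t v))\<^sup>2"
          using incr[of t s v] incr[of t "q n" v] mono[of s "q n" v] s
          by (simp add: power_mono)
        then show ?thesis using n by (simp add: dist_norm)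
      qed
      moreover have "t < q n" by (simp add: q_def)
      ultimately show "\<forall>\<^sub>F s in at_right t. dist (E s v) (E t v) < \<epsilon>"
        unfolding eventually_at_right_field by blast
    qed
  qed
  show ?thesis
    unfolding resolution_of_identity_def limitin_strong_operator_topology
    using P up lim bot top by (auto simp: op_le_projection[OF P P])
qed

section \<open>Riemann sums and spectral integrals\<close>

context resolution
begin

text \<open>A partition carries all of the mass of \<open>E\<close>, as in the definition of the spectral
  integral.\<close>

definition admissible :: "nat \<Rightarrow> (nat \<Rightarrow> real) \<Rightarrow> bool" where
  "admissible n t \<longleftrightarrow> E (t 0) = 0 \<and> E (t n) = e \<and> (\<forall>i<n. t i \<le> t (Suc i))"

definition cell :: "(nat \<Rightarrow> real) \<Rightarrow> nat \<Rightarrow> ('h \<Rightarrow>\<^sub>L 'h)" where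
  "cell t i = E (t (Suc i)) - E (t i)"

definition riemann :: "nat \<Rightarrow> (nat \<Rightarrow> real) \<Rightarrow> (nat \<Rightarrow> real) \<Rightarrow> (real \<Rightarrow> real) \<Rightarrow> ('h \<Rightarrow>\<^sub>L 'h)" where
  "riemann n t s f = (\<Sum>i<n. f (s i) *\<^sub>R cell t i)"

lemma cell_apply: "cell t i v = E (t (Suc i)) v - E (t i) v"
  by (simp add: cell_def blinfun.diff_left)

lemma riemann_apply: "riemann n t s f v = (\<Sum>i<n. f (s i) *\<^sub>R cell t i v)"
  by (simp add: riemann_def blinfun.sum_left blinfun.scaleR_left)

lemma E_cell: "E r (cell t i v) = cell t i (E r v)"
  by (simp add: cell_apply blinfun.diff_right commute)

lemma admissible_mono:
  assumes "admissible n t" "i \<le> j" "j \<le> n"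
  shows "t i \<le> t j"
  using assms(2,3)
proof (induction j rule: dec_induct)
  case (step m)
  then have "t i \<le> t m" "t m \<le> t (Suc m)" using assms(1) by (auto simp: admissible_def)
  then show ?case by simp
qed simp

lemma sum_cell: "admissible n t \<Longrightarrow> (\<Sum>i<n. cell t i v) = e v"
  using sum_lessThan_telescope[of "\<lambda>i. E (t i) v" n] by (simp add: cell_apply admissible_def)

text \<open>The components of \<open>v\<close> in the cells are orthogonal: by \<open>increment_norm\<close>
  their squared norms telescope.\<close>

lemma sum_norm_cell: 
  assumes "admissible n t"
  shows "(\<Sum>i<n. (norm (cell t i v))\<^sup>2) = (norm (e v))\<^sup>2"
proof -
  have "(\<Sum>i<n. (norm (cell t i v))\<^sup>2) = (\<Sum>i<n. (norm (E (t (Suc i)) v))\<^sup>2 - (norm (E (t i) v))\<^sup>2)"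
    using assms by (intro sum.cong) (auto simp: cell_apply increment_norm admissible_def)
  also have "\<dots> = (norm (e v))\<^sup>2"
    using sum_lessThan_telescope[of "\<lambda>i. (norm (E (t i) v))\<^sup>2" n] assms
    by (simp add: admissible_def)
  finally show ?thesis .
qed

lemma E_cell_upper: "t i \<le> t (Suc i) \<Longrightarrow> t (Suc i) \<le> r \<Longrightarrow> E r (cell t i v) = cell t i v"
  by (simp add: cell_apply blinfun.diff_right up)

lemma E_cell_lower: "t i \<le> t (Suc i) \<Longrightarrow> r \<le> t i \<Longrightarrow> E r (cell t i v) = 0"
  by (simp add: cell_apply blinfun.diff_right down)

lemma cell_cell:
  assumes adm: "admissible n t" and ij: "i < n" "j < n"
  shows "cell t j (cell t i v) = (if i = j then cell t i v else 0)"
proof -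
  have le: "t i \<le> t (Suc i)" using adm ij by (simp add: admissible_def)
  consider "i = j" | "i < j" | "j < i" by linarith
  then show ?thesis
  proof cases
    case 1
    then show ?thesis
      using le cell_apply[of t j "cell t i v"] by (simp add: E_cell_upper E_cell_lower)
  next
    case 2
    then have "t (Suc i) \<le> t j" "t (Suc i) \<le> t (Suc j)"
      using admissible_mono[OF adm] ij by auto
    then show ?thesis
      using 2 le cell_apply[of t j "cell t i v"] by (simp add: E_cell_upper)
  next
    case 3
    then have "t j \<le> t i" "t (Suc j) \<le> t i"
      using admissible_mono[OF adm] ij by auto
    then show ?thesis
      using 3 le cell_apply[of t j "cell t i v"] by (simp add: E_cell_lower)
  qed
qed

text \<open>An operator that commutes with \<open>E\<close> is block diagonal with respect to the cells of a
  partition, so a bound on each block is a bound on the whole. This turns every norm estimate for spectral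
  integrals into an estimate on a single cell.\<close>

lemma block_bound:
  fixes A :: "'h \<Rightarrow>\<^sub>L 'h"
  assumes adm: "admissible n t"
    and A: "\<And>r v. A (E r v) = E r (A v)" and "\<omega> \<ge> 0"
    and le: "\<And>i. i < n \<Longrightarrow> norm (A (cell t i v)) \<le> \<omega> * norm (cell t i v)"
  shows "norm (A (e v)) \<le> \<omega> * norm (e v)"
proof -
  have Ae: "A (e v) = e (A v)"
    using A[of "t n"] adm by (simp add: admissible_def)
  have Ac: "cell t i (A v) = A (cell t i v)" for i
    by (simp add: cell_apply blinfun.diff_right A)
  have "(norm (A (e v)))\<^sup>2 = (\<Sum>i<n. (norm (A (cell t i v)))\<^sup>2)"
    using sum_norm_cell[OF adm, of "A v"] by (simp add: Ae Ac)
  also have "\<dots> \<le> (\<Sum>i<n. (\<omega> * norm (cell t i v))\<^sup>2)"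
    using le by (intro sum_mono power_mono) auto
  also have "\<dots> = (\<omega> * norm (e v))\<^sup>2"
    using sum_norm_cell[OF adm, of v] by (simp add: power_mult_distrib flip: sum_distrib_left)
  finally show ?thesis
    by (rule power2_le_imp_le) (use \<open>\<omega> \<ge> 0\<close> in simp)
qed

lemma riemann_cell:
  assumes "admissible n t" "i < n"
  shows "riemann n t s f (cell t i v) = f (s i) *\<^sub>R cell t i v"
proof -
  have "riemann n t s f (cell t i v) = (\<Sum>j<n. if i = j then f (s i) *\<^sub>R cell t i v else 0)"
    unfolding riemann_apply using assms by (intro sum.cong) (auto simp: cell_cell)
  then show ?thesis using assms by simp
qed

lemma riemann_commute: "riemann n t s f (E r v) = E r (riemann n t s f v)"
  by (simp add: riemann_apply blinfun.sum_right blinfun.scaleR_right E_cell)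

lemma riemann_e: "riemann n t s f (e v) = riemann n t s f v"
  by (simp add: riemann_apply cell_apply)

text \<open>Only the cells that meet the interval from \<open>p\<close> to \<open>q\<close> contribute to the
  action on \<open>w\<close>, and on each of them the Riemann sum is a scalar close to
  \<open>k\<close>.\<close>

lemma riemann_bound:
  assumes adm: "admissible n t" and w: "E q w = w" "E p w = 0" and "\<omega> \<ge> 0"
    and f: "\<And>j. j < n \<Longrightarrow> t j < q \<Longrightarrow> p < t (Suc j) \<Longrightarrow> \<bar>f (s j) - k\<bar> \<le> \<omega>"
  shows "norm (riemann n t s f w - k *\<^sub>R w) \<le> \<omega> * norm w"
proof -
  define A where "A = riemann n t s f - k *\<^sub>R id_blinfun"
  have A: "A v = riemann n t s f v - k *\<^sub>R v" for v
    by (simp add: A_def blinfun.diff_left blinfun.scaleR_left)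
  have e: "e w = w" using w(1) by (metis e_E)
  have "norm (A (e w)) \<le> \<omega> * norm (e w)"
  proof (rule block_bound[OF adm _ \<open>\<omega> \<ge> 0\<close>])
    show "A (E r v) = E r (A v)" for r v
      by (simp add: A riemann_commute blinfun.diff_right blinfun.scaleR_right)
    fix j assume j: "j < n"
    then have le: "t j \<le> t (Suc j)" using adm by (simp add: admissible_def)
    have "cell t j w = 0" if "q \<le> t j"
      using le that up w(1) by (metis cell_apply cancel_comm_monoid_add_class.diff_cancel order_trans)
    moreover have "cell t j w = 0" if "t (Suc j) \<le> p"
    proof -
      have "E r w = 0" if "r \<le> p" for r
        using w(2) down[OF that, of w] by simp
      then show ?thesis using le that by (simp add: cell_apply)
    qed
    ultimately have z: "cell t j w = 0" if "\<not> (t j < q \<and> p < t (Suc j))"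
      using that by force
    show "norm (A (cell t j w)) \<le> \<omega> * norm (cell t j w)"
    proof (cases "t j < q \<and> p < t (Suc j)")
      case True
      then have "\<bar>f (s j) - k\<bar> \<le> \<omega>" using f j by blast
      moreover have "A (cell t j w) = (f (s j) - k) *\<^sub>R cell t j w"
        using riemann_cell[OF adm j] by (simp add: A scaleR_diff_left)
      ultimately show ?thesis by (simp add: mult_right_mono)
    qed (simp add: z)
  qed
  then show ?thesis by (simp add: e A)
qed

definition uniform_part :: "real \<Rightarrow> real \<Rightarrow> nat \<Rightarrow> nat \<Rightarrow> real" where
  "uniform_part a b N i = a + real i * (b - a) / real N"

lemma uniform_part_step: "uniform_part a b N (Suc i) - uniform_part a b N i = (b - a) / real N"
  by (simp add: uniform_part_def distrib_right add_divide_distrib)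

lemma uniform_part_mono: "a \<le> b \<Longrightarrow> uniform_part a b N i \<le> uniform_part a b N (Suc i)"
  using uniform_part_step[of a b N i] by (smt (verit) divide_nonneg_nonneg of_nat_0_le_iff)

lemma admissible_uniform_part:
  "E a = 0 \<Longrightarrow> E b = e \<Longrightarrow> a \<le> b \<Longrightarrow> N > 0 \<Longrightarrow> admissible N (uniform_part a b N)"
  using uniform_part_mono[of a b N] by (auto simp: admissible_def uniform_part_def)

lemma obtain_zero_top: obtains a b where "E a = 0" "E b = e" "a < b" "a < c" "d < b"
proof -
  obtain a b where ab: "\<And>t. t < a \<Longrightarrow> E t = 0" "\<And>t. t \<ge> b \<Longrightarrow> E t = e" "a < b"
    by (rule bounds) blast
  show thesis
    by (rule that[of "min (a - 1) (c - 1)" "max b (d + 1)"]) (use ab in auto)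
qed

text \<open>The partitions of mesh less than \<open>d\<close> over which the definition of the spectral
  integral quantifies.\<close>

definition fine_tagged :: "real \<Rightarrow> nat \<Rightarrow> (nat \<Rightarrow> real) \<Rightarrow> (nat \<Rightarrow> real) \<Rightarrow> bool" where
  "fine_tagged d n t s \<longleftrightarrow> admissible n t \<and> (\<forall>i<n. t (Suc i) - t i < d \<and> s i \<in> {t i..t (Suc i)})"

lemma has_spectral_integral_iff:
  "has_spectral_integral e E f T \<longleftrightarrow>
     (\<forall>\<epsilon>>0. \<exists>d>0. \<forall>n t s. fine_tagged d n t s \<longrightarrow> norm (T - riemann n t s f) < \<epsilon>)"
proof -
  have eq: "(E (t 0) = 0 \<and> E (t n) = e \<and>
        (\<forall>i<n. t i \<le> t (Suc i) \<and> t (Suc i) - t i < d \<and> s i \<in> {t i..t (Suc i)})) \<longleftrightarrow>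
      fine_tagged d n t s" for n t d s
    by (auto simp: fine_tagged_def admissible_def)
  show ?thesis
    unfolding has_spectral_integral_def riemann_def cell_def eq ..
qed

lemma fine_tagged_uniform:
  assumes ab: "E a = 0" "E b = e" "a < b" and d: "d > 0"
  shows "\<exists>K. \<forall>k\<ge>K. \<forall>s. (\<forall>i. s i \<in> {uniform_part a b (Suc k) i..uniform_part a b (Suc k) (Suc i)})
    \<longrightarrow> fine_tagged d (Suc k) (uniform_part a b (Suc k)) s"
proof -
  obtain K where K: "real K > (b - a) / d" using reals_Archimedean2 by blast
  have "uniform_part a b (Suc k) (Suc i) - uniform_part a b (Suc k) i < d" if "k \<ge> K" for k i
  proof -
    have "(b - a) / d < real (Suc k)" using K that by linarith
    then show ?thesis using d unfolding uniform_part_step by (simp add: field_simps)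
  qed
  then show ?thesis
    using admissible_uniform_part[OF ab(1,2)] ab(3) by (auto simp: fine_tagged_def)
qed

text \<open>The tags are free in the spectral integral. The tag of each cell is chosen as close to
  \<open>p\<close> as the cell permits: then every cell that meets an interval starting at \<open>p\<close>
  has its tag inside that interval, and only the values of \<open>f\<close> there matter.\<close>

lemma riemann_approximation:
  assumes "has_spectral_integral e E f T" "\<epsilon> > 0"
  obtains n t s where "admissible n t" "norm (T - riemann n t s f) < \<epsilon>"
    "\<And>i. i < n \<Longrightarrow> s i = max (t i) (min p (t (Suc i)))"
proof -
  obtain d where d: "d > 0" and i: "\<And>n t s. fine_tagged d n t s \<Longrightarrow> norm (T - riemann n t s f) < \<epsilon>"
    using assms unfolding has_spectral_integral_iff by blast
  obtain a b where ab: "E a = 0" "E b = e" "a < b" by (rule obtain_zero_top)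
  obtain k where k: "\<And>s. (\<And>i. s i \<in> {uniform_part a b (Suc k) i..uniform_part a b (Suc k) (Suc i)})
      \<Longrightarrow> fine_tagged d (Suc k) (uniform_part a b (Suc k)) s"
    using fine_tagged_uniform[OF ab d] by blast
  define t where "t = uniform_part a b (Suc k)"
  define s where "s i = max (t i) (min p (t (Suc i)))" for i
  have "fine_tagged d (Suc k) t s"
    unfolding t_def by (rule k) (use uniform_part_mono[of a b "Suc k"] ab in \<open>auto simp: s_def t_def\<close>)
  then show thesis using that[of "Suc k" t s] i by (auto simp: s_def fine_tagged_def)
qed

lemma spectral_integral_unique:
  assumes "has_spectral_integral e E f S" "has_spectral_integral e E f T"
  shows "S = T"
proof (rule ccontr)
  assume "S \<noteq> T"
  define \<epsilon> where "\<epsilon> = norm (S - T) / 2"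
  have \<epsilon>: "\<epsilon> > 0" using \<open>S \<noteq> T\<close> by (simp add: \<epsilon>_def)
  obtain a b where ab: "E a = 0" "E b = e" "a < b" by (rule obtain_zero_top)
  obtain d1 where d1: "d1 > 0" "\<And>n t s. fine_tagged d1 n t s \<Longrightarrow> norm (S - riemann n t s f) < \<epsilon>"
    using assms(1) \<epsilon> unfolding has_spectral_integral_iff by blast
  obtain d2 where d2: "d2 > 0" "\<And>n t s. fine_tagged d2 n t s \<Longrightarrow> norm (T - riemann n t s f) < \<epsilon>"
    using assms(2) \<epsilon> unfolding has_spectral_integral_iff by blast
  have "min d1 d2 > 0" using d1 d2 by simp
  from fine_tagged_uniform[OF ab this]
  obtain n t where "fine_tagged (min d1 d2) n t t"
    using uniform_part_mono[of a b] ab(3) by (meson atLeastAtMost_iff less_imp_le order_refl)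
  then have "norm (S - riemann n t t f) < \<epsilon>" "norm (T - riemann n t t f) < \<epsilon>"
    by (auto simp: fine_tagged_def intro!: d1(2) d2(2))
  then have "norm (S - T) < 2 * \<epsilon>"
    using norm_triangle_ineq4[of "S - riemann n t t f" "T - riemann n t t f"] by simp
  then show False by (simp add: \<epsilon>_def)
qed

text \<open>Closed conditions pass from Riemann sums to the integral; commutation, symmetry and membership in
  the algebra are obtained in this way.\<close>

lemma spectral_integral_closed:
  assumes "has_spectral_integral e E f T" "closed C"
    and "\<And>n t s. admissible n t \<Longrightarrow> riemann n t s f \<in> C"
  shows "T \<in> C"
proof -
  have "\<exists>S\<in>C. dist S T < \<epsilon>" if "\<epsilon> > 0" for \<epsilon>
    using riemann_approximation[OF assms(1) that] assms(3)
    by (metis dist_commute dist_norm)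
  then show ?thesis
    using \<open>closed C\<close> closed_approachable by blast
qed

lemma spectral_integral_commute:
  assumes "has_spectral_integral e E f T"
  shows "T (E r v) = E r (T v)"
proof -
  have "T \<in> {A :: 'h \<Rightarrow>\<^sub>L 'h. A (E r v) = E r (A v)}"
    by (rule spectral_integral_closed[OF assms])
      (auto intro!: closed_Collect_eq continuous_intros simp: riemann_commute)
  then show ?thesis by simp
qed

lemma spectral_integral_e:
  assumes "has_spectral_integral e E f T"
  shows "T (e v) = T v" 
proof -
  have "T \<in> {A :: 'h \<Rightarrow>\<^sub>L 'h. A (e v) = A v}"
    by (rule spectral_integral_closed[OF assms])
      (auto intro!: closed_Collect_eq continuous_intros simp: riemann_e)
  then show ?thesis by simp
qed

lemma spectral_integral_sym:
  assumes "has_spectral_integral e E f T"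
  shows "sym_op T"
  unfolding sym_op_def
proof (intro allI)
  fix v w
  have "riemann n t s f v \<bullet> w = v \<bullet> riemann n t s f w" for n t s
    by (simp add: riemann_apply inner_sum_left inner_sum_right cell_apply inner_diff_left
        inner_diff_right sym)
  then have "T \<in> {A :: 'h \<Rightarrow>\<^sub>L 'h. A v \<bullet> w = v \<bullet> A w}"
    by (intro spectral_integral_closed[OF assms])
      (auto intro!: closed_Collect_eq continuous_intros)
  then show "T v \<bullet> w = v \<bullet> T w" by simp
qed

text \<open>The working estimate for spectral integrals: on the range of \<open>E q - E p\<close> the operator
  \<open>\<integral> f dE\<close> differs from the scalar \<open>k\<close> by no more than \<open>f\<close>
  does on the interval from \<open>p\<close> to \<open>q\<close>.\<close>

lemma spectral_integral_bound:
  assumes T: "has_spectral_integral e E f T" and w: "E q w = w" "E p w = 0" and pq: "p \<le> q"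
    and f: "\<And>r. p \<le> r \<Longrightarrow> r \<le> q \<Longrightarrow> \<bar>f r - k\<bar> \<le> \<omega>"
  shows "norm (T w - k *\<^sub>R w) \<le> \<omega> * norm w"
proof -
  have \<omega>: "\<omega> \<ge> 0" using f[of p] pq by simp
  have le: "norm (T w - k *\<^sub>R w) \<le> \<omega> * norm w + \<epsilon> * norm w" if \<epsilon>: "\<epsilon> > 0" for \<epsilon>
  proof -
    obtain n t s where adm: "admissible n t" and S: "norm (T - riemann n t s f) < \<epsilon>"
      and s: "\<And>i. i < n \<Longrightarrow> s i = max (t i) (min p (t (Suc i)))"
      using riemann_approximation[OF T \<epsilon>, of p] by metis
    have "norm (riemann n t s f w - k *\<^sub>R w) \<le> \<omega> * norm w"
    proof (rule riemann_bound[OF adm w \<omega>])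
      show "\<bar>f (s j) - k\<bar> \<le> \<omega>" if "j < n" "t j < q" "p < t (Suc j)" for j
        by (rule f) (use that s[of j] pq in auto)
    qed
    moreover have "norm (T w - riemann n t s f w) \<le> \<epsilon> * norm w"
      using norm_blinfun[of "T - riemann n t s f" w] S
      by (simp add: blinfun.diff_left) (meson less_imp_le mult_right_mono norm_ge_zero order_trans)
    ultimately show ?thesis
      using norm_triangle_ineq[of "T w - riemann n t s f w" "riemann n t s f w - k *\<^sub>R w"] by simp
  qed
  show ?thesis
  proof (cases "w = 0")
    case False
    show ?thesis
    proof (rule field_le_epsilon)
      fix \<epsilon> :: real assume "\<epsilon> > 0"
      then show "norm (T w - k *\<^sub>R w) \<le> \<omega> * norm w + \<epsilon>"
        using le[of "\<epsilon> / norm w"] False by simp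
    qed
  qed (simp add: blinfun.zero_right)
qed

text \<open>Two fine Riemann sums are compared on one cell of the first partition at a time: there the first
  sum is the scalar \<open>f (s i)\<close>, and the second is close to it because only the cells that overlap
  the given one contribute. The cells outside of the support from \<open>a0\<close> to \<open>b0\<close>
  vanish, which is why \<open>f\<close> needs to be controlled only on the slightly larger interval from
  \<open>a\<close> to \<open>b\<close>.\<close>

lemma riemann_close:
  assumes tagged: "fine_tagged d n t s" "fine_tagged d m t' s'"
    and ends: "E a0 = 0" "E b0 = e" "d \<le> a0 - a" "d \<le> b - b0" and \<omega>: "\<omega> \<ge> 0"
    and f: "\<And>r r'. r \<in> {a..b} \<Longrightarrow> r' \<in> {a..b} \<Longrightarrow> \<bar>r - r'\<bar> < 2 * d \<Longrightarrow> \<bar>f r - f r'\<bar> \<le> \<omega>"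
  shows "norm (riemann n t s f - riemann m t' s' f) \<le> \<omega>"
proof (rule norm_blinfun_bound[OF \<omega>])
  have adm: "admissible n t" "admissible m t'"
    and mesh: "\<And>i. i < n \<Longrightarrow> t (Suc i) - t i < d" "\<And>i. i < m \<Longrightarrow> t' (Suc i) - t' i < d"
    and tags: "\<And>i. i < n \<Longrightarrow> s i \<in> {t i..t (Suc i)}" "\<And>i. i < m \<Longrightarrow> s' i \<in> {t' i..t' (Suc i)}"
    using tagged by (auto simp: fine_tagged_def)
  fix v
  define A where "A = riemann n t s f - riemann m t' s' f"
  have A: "A v = riemann n t s f v - riemann m t' s' f v" for v
    by (simp add: A_def blinfun.diff_left)
  have "norm (A (e v)) \<le> \<omega> * norm (e v)"
  proof (rule block_bound[OF adm(1) _ \<omega>])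
    show "A (E r v) = E r (A v)" for r v
      by (simp add: A riemann_commute blinfun.diff_right)
    fix i assume i: "i < n"
    define w where "w = cell t i v"
    have le: "t i \<le> t (Suc i)" using adm(1) i by (simp add: admissible_def)
    show "norm (A (cell t i v)) \<le> \<omega> * norm (cell t i v)"
    proof (cases "w = 0")
      case False
      have w1: "E q w = w" if "t (Suc i) \<le> q" for q
        unfolding w_def using le that by (rule E_cell_upper)
      have w2: "E p w = 0" if "p \<le> t i" for p
        unfolding w_def using le that by (rule E_cell_lower)
      have ew: "e w = w" using w1[of "t (Suc i)"] by (metis e_E order_refl)
      have "a0 < t (Suc i)" 
        using w1[of a0] ends(1) False by (force simp: not_le)
      moreover have "t i < b0"
        using w2[of b0] ends(2) ew False by (force simp: not_le)
      ultimately have si: "s i \<in> {a..b}"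
        using tags(1)[OF i] mesh(1)[OF i] ends(3,4) by auto
      define p where "p = max (t i) a0"
      define q where "q = min (t (Suc i)) b0"
      have Eq: "E q w = w" using w1[of q] ends(2) ew by (auto simp: q_def min_def)
      have Ep: "E p w = 0" using w2[of p] ends(1) by (auto simp: p_def max_def)
      have "norm (riemann m t' s' f w - f (s i) *\<^sub>R w) \<le> \<omega> * norm w"
      proof (rule riemann_bound[OF adm(2) Eq Ep \<omega>])
        fix j assume j: "j < m" "t' j < q" "p < t' (Suc j)"
        show "\<bar>f (s' j) - f (s i)\<bar> \<le> \<omega>"
        proof (rule f[OF _ si])
          show "s' j \<in> {a..b}"
            using tags(2)[OF j(1)] mesh(2)[OF j(1)] j ends(3,4) by (auto simp: p_def q_def)
          show "\<bar>s' j - s i\<bar> < 2 * d"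
            using tags(1)[OF i] mesh(1)[OF i] tags(2)[OF j(1)] mesh(2)[OF j(1)] j
            by (auto simp: p_def q_def)
        qed
      qed
      moreover have "riemann n t s f w = f (s i) *\<^sub>R w"
        unfolding w_def by (rule riemann_cell[OF adm(1) i])
      ultimately show ?thesis
        unfolding w_def[symmetric] by (simp add: A norm_minus_commute)
    qed (simp add: w_def blinfun.zero_right)
  qed
  also have "\<dots> \<le> \<omega> * norm v"
    using \<omega> projection_norm_le[OF proj_e] by (simp add: mult_left_mono)
  finally show "norm ((riemann n t s f - riemann m t' s' f) v) \<le> \<omega> * norm v"
    by (simp add: A riemann_e blinfun.diff_left)
qed

text \<open>Uniform continuity on the compact interval and \<open>riemann_close\<close> make the Riemann sums
  over uniform partitions a Cauchy sequence.\<close>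

lemma spectral_integral_exists:
  assumes f: "continuous_on {a..b} f" and ends: "E a0 = 0" "E b0 = e" "a < a0" "b0 < b"
  shows "\<exists>T. has_spectral_integral e E f T"
proof -
  obtain a1 b1 where ab1: "E a1 = 0" "E b1 = e" "a1 < b1" by (rule obtain_zero_top)
  have small: "\<exists>d>0. d \<le> a0 - a \<and> d \<le> b - b0 \<and> (\<forall>r\<in>{a..b}. \<forall>r'\<in>{a..b}. \<bar>r - r'\<bar> < 2 * d \<longrightarrow> \<bar>f r - f r'\<bar> \<le> \<omega>)"
    if \<omega>: "\<omega> > 0" for \<omega>
  proof -
    have "uniformly_continuous_on {a..b} f"
      by (rule compact_uniformly_continuous[OF f]) simp
    then obtain d where d: "d > 0" "\<And>r r'. r \<in> {a..b} \<Longrightarrow> r' \<in> {a..b} \<Longrightarrow> dist r' r < d \<Longrightarrow> dist (f r') (f r) < \<omega>"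
      unfolding uniformly_continuous_on_def using \<omega> by metis
    define d' where "d' = min (d / 2) (min (a0 - a) (b - b0))"
    have "d' > 0" using d(1) ends(3,4) by (simp add: d'_def)
    moreover have le: "d' \<le> d / 2" "d' \<le> a0 - a" "d' \<le> b - b0"
      unfolding d'_def by (meson min.cobounded1 min.cobounded2 order_trans)+
    moreover have "\<bar>f r - f r'\<bar> \<le> \<omega>" if "r \<in> {a..b}" "r' \<in> {a..b}" "\<bar>r - r'\<bar> < 2 * d'" for r r'
      using d(2)[OF that(2,1)] that(3) le(1) by (simp add: dist_real_def)
    ultimately show ?thesis by blast
  qed
  define P where "P k = uniform_part a1 b1 (Suc k)" for k
  define S where "S k = riemann (Suc k) (P k) (P k) f" for k
  have mesh: "\<exists>K. \<forall>k\<ge>K. fine_tagged d (Suc k) (P k) (P k)" if "d > 0" for d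
    using fine_tagged_uniform[OF ab1 that] uniform_part_mono[of a1 b1] ab1(3)
    unfolding P_def by (meson atLeastAtMost_iff less_imp_le order_refl)
  have close: "\<exists>d>0. \<exists>K. \<forall>k\<ge>K. \<forall>n t s. fine_tagged d n t s \<longrightarrow> norm (S k - riemann n t s f) \<le> \<omega>"
    if \<omega>: "\<omega> > 0" for \<omega>
  proof -
    obtain d where d: "d > 0" "d \<le> a0 - a" "d \<le> b - b0"
      "\<And>r r'. r \<in> {a..b} \<Longrightarrow> r' \<in> {a..b} \<Longrightarrow> \<bar>r - r'\<bar> < 2 * d \<Longrightarrow> \<bar>f r - f r'\<bar> \<le> \<omega>"
      using small[OF \<omega>] by blast
    obtain K where K: "\<And>k. k \<ge> K \<Longrightarrow> fine_tagged d (Suc k) (P k) (P k)" using mesh[OF d(1)] by blast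
    have "norm (S k - riemann n t s f) \<le> \<omega>" if "k \<ge> K" "fine_tagged d n t s" for k n t s
      unfolding S_def
      by (rule riemann_close[OF K[OF that(1)] that(2) ends(1,2) d(2,3)]) (use d(4) \<omega> in auto)
    then show ?thesis using d(1) by blast
  qed
  have "Cauchy S"
  proof (rule metric_CauchyI)
    fix \<epsilon> :: real assume \<epsilon>: "\<epsilon> > 0"
    obtain d K where d: "d > 0"
      and K: "\<And>k n t s. k \<ge> K \<Longrightarrow> fine_tagged d n t s \<Longrightarrow> norm (S k - riemann n t s f) \<le> \<epsilon> / 2"
      using close[of "\<epsilon> / 2"] half_gt_zero[OF \<epsilon>] by blast
    obtain L where L: "\<And>k. k \<ge> L \<Longrightarrow> fine_tagged d (Suc k) (P k) (P k)" using mesh[OF d] by blast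
    have "dist (S k) (S l) < \<epsilon>" if "k \<ge> max K L" "l \<ge> max K L" for k l
    proof -
      have "norm (S k - S l) \<le> \<epsilon> / 2"
        unfolding S_def[of l] by (rule K) (use that L in auto)
      then show ?thesis using \<epsilon> by (simp add: dist_norm)
    qed
    then show "\<exists>M. \<forall>m\<ge>M. \<forall>n\<ge>M. dist (S m) (S n) < \<epsilon>" by blast
  qed
  then obtain T where T: "S \<longlonglongrightarrow> T"
    using Cauchy_convergent convergent_def by blast
  have "has_spectral_integral e E f T"
    unfolding has_spectral_integral_iff
  proof (intro allI impI)
    fix \<epsilon> :: real assume \<epsilon>: "\<epsilon> > 0"
    obtain d K where d: "d > 0"
      and K: "\<And>k n t s. k \<ge> K \<Longrightarrow> fine_tagged d n t s \<Longrightarrow> norm (S k - riemann n t s f) \<le> \<epsilon> / 2"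
      using close[of "\<epsilon> / 2"] half_gt_zero[OF \<epsilon>] by blast
    have "norm (T - riemann n t s f) < \<epsilon>"
      if "fine_tagged d n t s" for n t s
    proof -
      have "norm (T - riemann n t s f) \<le> \<epsilon> / 2"
      proof (rule LIMSEQ_le_const2)
        show "(\<lambda>k. norm (S k - riemann n t s f)) \<longlonglongrightarrow> norm (T - riemann n t s f)"
          using T by (intro tendsto_intros)
        show "\<exists>N. \<forall>k\<ge>N. norm (S k - riemann n t s f) \<le> \<epsilon> / 2"
          using K[OF _ that] by blast
      qed
      then show ?thesis using \<epsilon> by simp
    qed
    then show "\<exists>d>0. \<forall>n t s. fine_tagged d n t s \<longrightarrow> norm (T - riemann n t s f) < \<epsilon>"
      using d by blast
  qed
  then show ?thesis by blast
qed

section \<open>Uniqueness of the spectral family\<close>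

text \<open>On the range of \<open>E t\<close> the positive operator \<open>x - p\<close> is bounded by
  \<open>t - p\<close>, and on the complement of the range of \<open>E s\<close> it is bounded below by
  \<open>s - p\<close>. If the powers of \<open>x - p\<close> on \<open>v\<close> grow at most like \<open>(t
  - p)\<^sup>n\<close>, then the component of \<open>v\<close> in the complement is \<open>0\<close> for every
  \<open>s > t\<close>, and right continuity puts \<open>v\<close> into the range of \<open>E t\<close>. Since
  the condition on the right involves only \<open>x\<close>, the unit and \<open>p\<close>, the operator
  determines its spectral family.\<close>

lemma spectral_range_iff:
  assumes x: "has_spectral_integral e E (\<lambda>t. t) x" and p: "E p = 0" "p \<le> t"
  shows "E t v = v \<longleftrightarrow> e v = v \<and> (\<forall>n. norm (((\<lambda>w. x w - p *\<^sub>R w) ^^ n) v) \<le> (t - p) ^ n * norm v)"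
proof -
  define Y where "Y w = x w - p *\<^sub>R w" for w
  have YE: "Y (E r w) = E r (Y w)" for r w
    using spectral_integral_commute[OF x] by (simp add: Y_def blinfun.diff_right blinfun.scaleR_right)
  have YEn: "(Y ^^ n) (E r w) = E r ((Y ^^ n) w)" for n r w
    by (induction n) (simp_all add: YE)
  have Ydiffn: "(Y ^^ n) (v - w) = (Y ^^ n) v - (Y ^^ n) w" for n v w
    by (induction n) (simp_all add: Y_def blinfun.diff_right scaleR_diff_right)
  have upper: "norm (Y w) \<le> (r - p) * norm w" if "E r w = w" "p \<le> r" for r w
    unfolding Y_def by (rule spectral_integral_bound[OF x that(1) _ that(2)]) (use p in auto)
  have lower: "(s - p) * norm w \<le> norm (Y w)" if "E s w = 0" "e w = w" for s w
  proof -
    obtain a b where b: "E b = e" "s < b" by (rule obtain_zero_top)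
    have "norm (x w - b *\<^sub>R w) \<le> (b - s) * norm w"
      by (rule spectral_integral_bound[OF x _ that(1)]) (use b that in auto)
    moreover have "norm ((b - p) *\<^sub>R w) \<le> norm (Y w) + norm (x w - b *\<^sub>R w)"
      using norm_triangle_ineq4[of "Y w" "x w - b *\<^sub>R w"] by (simp add: Y_def algebra_simps)
    moreover have "(b - p) * norm w \<le> norm ((b - p) *\<^sub>R w)"
      by (simp add: mult_right_mono)
    ultimately show ?thesis by (simp add: algebra_simps)
  qed
  have "norm ((Y ^^ n) v) \<le> (t - p) ^ n * norm v" if v: "E t v = v" for n
  proof (induction n)
    case (Suc n)
    have "E t ((Y ^^ n) v) = (Y ^^ n) v" using YEn[of n t v] v by simp
    then have "norm (Y ((Y ^^ n) v)) \<le> (t - p) * norm ((Y ^^ n) v)"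
      using p by (intro upper)
    also have "\<dots> \<le> (t - p) * ((t - p) ^ n * norm v)"
      using Suc p by (intro mult_left_mono) auto
    finally show ?case by simp
  qed simp
  moreover have "E t v = v" if ev: "e v = v" and le: "\<And>n. norm ((Y ^^ n) v) \<le> (t - p) ^ n * norm v"
  proof (rule fixed_right)
    fix s assume s: "s > t"
    define w where "w = v - E s v"
    have w: "E s w = 0" "e w = w" using ev by (simp_all add: w_def blinfun.diff_right)
    have low: "(s - p) ^ n * norm w \<le> norm ((Y ^^ n) w)" for n
    proof (induction n)
      case (Suc n)
      obtain a b where b: "E b = e" by (rule obtain_zero_top)
      have "(Y ^^ n) 0 = 0" using Ydiffn[of n 0 0] by simp
      then have "E s ((Y ^^ n) w) = 0" "e ((Y ^^ n) w) = (Y ^^ n) w"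
        using YEn[of n s w] YEn[of n b w] w b by simp_all
      then have "(s - p) * norm ((Y ^^ n) w) \<le> norm (Y ((Y ^^ n) w))" by (rule lower)
      moreover have "(s - p) * ((s - p) ^ n * norm w) \<le> (s - p) * norm ((Y ^^ n) w)"
        using Suc p s by (intro mult_left_mono) auto
      ultimately show ?case by simp
    qed simp
    have "norm w \<le> ((t - p) / (s - p)) ^ n * norm v" for n
    proof -
      have "(Y ^^ n) w = (Y ^^ n) v - E s ((Y ^^ n) v)"
        by (simp add: w_def Ydiffn YEn)
      then have "(norm ((Y ^^ n) w))\<^sup>2 \<le> (norm ((Y ^^ n) v))\<^sup>2"
        using projection_pythagoras[OF proj, of "(Y ^^ n) v" s] by simp
      then have "norm ((Y ^^ n) w) \<le> norm ((Y ^^ n) v)"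
        by (rule power2_le_imp_le) simp
      then have "(s - p) ^ n * norm w \<le> (t - p) ^ n * norm v"
        using low[of n] le[of n] by linarith
      then show ?thesis using p s by (simp add: power_divide field_simps)
    qed
    moreover have "(\<lambda>n. ((t - p) / (s - p)) ^ n * norm v) \<longlonglongrightarrow> 0 * norm v"
      using p s by (intro tendsto_mult tendsto_const LIMSEQ_power_zero) auto
    ultimately have "norm w \<le> 0 * norm v"
      by (intro LIMSEQ_le_const[of _ "0 * norm v"]) auto
    then show "E s v = v" by (simp add: w_def)
  qed
  moreover have "e v = v" if "E t v = v" using that by (metis e_E)
  ultimately show ?thesis unfolding Y_def[symmetric] by (auto simp flip: Y_def[abs_def])
qed

end

lemma projection_eqI:
  assumes "projection P" "projection Q" "\<And>v. P v = v \<longleftrightarrow> Q v = v"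
  shows "P = Q"
proof (rule blinfun_eqI)
  fix v
  have "Q (P v) = P v" "P (Q v) = Q v" for v
    using assms projection_idem by metis+
  then show "P v = Q v"
    using projection_le_commute[OF assms(1,2)] by metis
qed

text \<open>A common zero \<open>p\<close> of both families may be taken below \<open>t\<close>, and then the ranges at \<open>t\<close> are described
  by \<open>spectral_range_iff\<close> in terms of \<open>x\<close> only.\<close>

lemma spectral_resolution_unique:
  assumes E: "resolution_of_identity e E" "has_spectral_integral e E (\<lambda>t. t) x"
    and F: "resolution_of_identity e F" "has_spectral_integral e F (\<lambda>t. t) x"
  shows "E = F"
proof
  fix t
  interpret E: resolution e E by unfold_locales (rule E)
  interpret F: resolution e F by unfold_locales (rule F)
  obtain a b where a: "E a = 0" by (rule E.obtain_zero_top)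
  obtain a' b' where a': "F a' = 0" by (rule F.obtain_zero_top)
  define p where "p = min t (min a a')"
  have p: "E p = 0" "F p = 0" "p \<le> t"
    using E.E_0[OF a, of p] F.E_0[OF a', of p] by (auto simp: p_def)
  show "E t = F t"
    by (rule projection_eqI[OF E.proj F.proj])
      (simp add: E.spectral_range_iff[OF E(2) p(1,3)] F.spectral_range_iff[OF F(2) p(2,3)])
qed

lemma spectral_family_eqI:
  assumes "resolution_of_identity e E" "has_spectral_integral e E (\<lambda>t. t) x"
  shows "spectral_family e x = E"
  unfolding spectral_family_def
  by (rule the_equality) (use assms spectral_resolution_unique in auto)

lemma fun_calc_eqI:
  assumes "resolution_of_identity e E" "has_spectral_integral e E (\<lambda>t. t) x"
    and "has_spectral_integral e E f T"
  shows "fun_calc e f x = T"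
proof -
  interpret resolution e E by unfold_locales (rule assms)
  show ?thesis
    unfolding fun_calc_def spectral_family_eqI[OF assms(1,2)]
    by (rule the_equality) (use assms spectral_integral_unique in auto)
qed

section \<open>Absolute values and the spectral theorem in a von Neumann algebra\<close>

locale vn_algebra =
  fixes N :: "('h::complex_hilbert \<Rightarrow>\<^sub>L 'h) set" and e :: "'h \<Rightarrow>\<^sub>L 'h"
  assumes vn: "von_neumann_algebra N" and unit: "is_unit_of e N"
begin

lemma N_bounded_ops: "T \<in> N \<Longrightarrow> T \<in> bounded_ops"
  using vn by (auto simp: von_neumann_algebra_def cstar_subalgebra_def)

lemma N_0: "0 \<in> N" and N_add: "S \<in> N \<Longrightarrow> T \<in> N \<Longrightarrow> S + T \<in> N"
  and N_compose: "S \<in> N \<Longrightarrow> T \<in> N \<Longrightarrow> S o\<^sub>L T \<in> N" and N_closed: "closed N"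
  using vn by (auto simp: von_neumann_algebra_def cstar_subalgebra_def)

lemma N_scaleR: 
  assumes "T \<in> N" 
  shows "r *\<^sub>R T \<in> N"
proof -
  have "scaleC_op (complex_of_real r) T = r *\<^sub>R T"
    by (rule blinfun_eqI) (simp add: scaleC_op.rep_eq scaleC_of_real blinfun.scaleR_left)
  then show ?thesis
    using vn assms unfolding von_neumann_algebra_def cstar_subalgebra_def by metis
qed

lemma N_diff: "S \<in> N \<Longrightarrow> T \<in> N \<Longrightarrow> S - T \<in> N"
  using N_add[of S "(-1) *\<^sub>R T"] N_scaleR[of T "-1"] by simp

lemma N_sum: "(\<And>i. i \<in> I \<Longrightarrow> f i \<in> N) \<Longrightarrow> sum f I \<in> N"
  by (induction I rule: infinite_finite_induct) (auto intro: N_0 N_add)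

lemma N_strong_limit:
  assumes "\<And>v. ((\<lambda>i. blinfun_apply (f i) v) \<longlongrightarrow> blinfun_apply T v) F"
    and "eventually (\<lambda>i. f i \<in> N) F" "F \<noteq> bot"
  shows "T \<in> N"
  by (rule limitin_closedin[of strong_operator_topology f T F])
    (use assms vn in \<open>auto simp: limitin_strong_operator_topology von_neumann_algebra_def\<close>)

lemma e_in_N: "e \<in> N"
  using unit by (simp add: is_unit_of_def)

lemma e_left [simp]: "T \<in> N \<Longrightarrow> e (T v) = T v"
  and e_right [simp]: "T \<in> N \<Longrightarrow> T (e v) = T v"
  using unit unfolding is_unit_of_def by (metis blinfun_apply_blinfun_compose)+

text \<open>The unit is self-adjoint because its adjoint lies in the algebra and is therefore absorbed by
  \<open>e\<close>.\<close>

lemma projection_e: "projection e"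
proof -
  obtain S where S: "S \<in> N" "is_adjoint e S"
    using vn e_in_N by (auto simp: von_neumann_algebra_def cstar_subalgebra_def)
  have ee: "e v \<bullet> e w = e v \<bullet> w" for v w
    using S(2) e_right[OF S(1), of w] by (simp add: is_adjoint_def inner_eq_Re_cinner)
  have "sym_op e"
    unfolding sym_op_def by (metis ee inner_commute)
  then show ?thesis
    using N_bounded_ops e_in_N by (simp add: projection_iff)
qed

lemma e_inner: "e v \<bullet> w = v \<bullet> e w"
  by (rule projection_inner'[OF projection_e])

lemma e_inner_e: "e v \<bullet> e w = e v \<bullet> w"
  using projection_inner[OF projection_e, of v w] by simp

lemma op_power_0: "op_power e T 0 = e"
  and op_power_Suc: "op_power e T (Suc n) v = T (op_power e T n v)"
  by (simp_all add: op_power_def)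

lemma op_power_in_N: "T \<in> N \<Longrightarrow> op_power e T n \<in> N"
  by (induction n) (auto simp: op_power_def intro: e_in_N N_compose)

lemma op_power_commute:
  assumes "A \<in> N" "T \<in> N" "\<And>v. A (T v) = T (A v)"
  shows "A (op_power e T n v) = op_power e T n (A v)"
  by (induction n) (use assms in \<open>simp_all add: op_power_0 op_power_Suc\<close>)

lemma op_power_add: "T \<in> N \<Longrightarrow> op_power e T (m + n) v = op_power e T m (op_power e T n v)"
  by (induction m) (simp_all add: op_power_0 op_power_Suc op_power_in_N)

lemma op_power_sym:
  assumes T: "T \<in> N" "sym_op T"
  shows "sym_op (op_power e T n)"
proof (induction n)
  case 0
  then show ?case by (simp add: op_power_0 sym_op_def e_inner)
next
  case (Suc n)
  then show ?case
    unfolding sym_op_def op_power_Suc 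
    using op_power_commute[OF T(1,1)] sym_opD[OF T(2)] by metis
qed

text \<open>The absolute value of a self-adjoint contraction \<open>s\<close>. With \<open>b = 1 -
  s\<^sup>2\<close>, the equation \<open>y = (b + y\<^sup>2)/2\<close> means \<open>(1 - y)\<^sup>2 =
  s\<^sup>2\<close>. The iteration for \<open>y\<close> from \<open>0\<close> is dominated by the scalar
  iteration \<open>r \<mapsto> (1 + r\<^sup>2)/2\<close>, which increases and is bounded by \<open>1\<close>;
  so it converges in norm to some \<open>y\<close> with norm at most \<open>1\<close>, and \<open>1 -
  y\<close> is positive. The iterates are polynomials in \<open>s\<close>, hence commute with everything that
  commutes with \<open>s\<close>.\<close>

lemma sqrt_of_square_contraction:
  assumes s: "s \<in> N" "sym_op s" and n: "norm s \<le> 1"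
  shows "\<exists>a\<in>N. sym_op a \<and> (\<forall>v. 0 \<le> a v \<bullet> v) \<and> (\<forall>v. a (a v) = s (s v)) \<and>
    (\<forall>T\<in>N. (\<forall>v. T (s v) = s (T v)) \<longrightarrow> (\<forall>v. T (a v) = a (T v)))"
proof -
  define b where "b = e - (s o\<^sub>L s)"
  have bv: "b v = e v - s (s v)" for v by (simp add: b_def blinfun.diff_left)
  have bN: "b \<in> N" unfolding b_def by (intro N_diff N_compose s e_in_N)
  have snorm: "norm (s v) \<le> norm v" for v
    using norm_blinfun[of s v] n mult_right_mono[of "norm s" 1 "norm v"] by simp
  have bnorm: "norm b \<le> 1"
  proof (rule norm_blinfun_bound)
    fix v
    have "(norm (b v))\<^sup>2 = (norm (e v))\<^sup>2 - 2 * (e v \<bullet> s (s v)) + (norm (s (s v)))\<^sup>2"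
      by (simp add: bv power2_norm_eq_inner inner_diff_left inner_diff_right inner_commute)
    also have "e v \<bullet> s (s v) = v \<bullet> s (s v)"
      using e_inner[of v "s (s v)"] s(1) by simp
    also have "v \<bullet> s (s v) = (norm (s v))\<^sup>2"
      unfolding power2_norm_eq_inner by (rule sym_opD[OF s(2), symmetric])
    also have "(norm (s (s v)))\<^sup>2 \<le> (norm (s v))\<^sup>2" using snorm by (simp add: power_mono)
    also have "(norm (e v))\<^sup>2 \<le> (norm v)\<^sup>2"
      using projection_norm_le[OF projection_e] by (simp add: power_mono)
    finally have "(norm (b v))\<^sup>2 \<le> (norm v)\<^sup>2" by (smt (verit) zero_le_power2)
    then show "norm (b v) \<le> 1 * norm v" using power2_le_imp_le by fastforce
  qed simp
  define Y where "Y = rec_nat 0 (\<lambda>_ y. (1/2) *\<^sub>R (b + (y o\<^sub>L y)))"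
  have Y0: "Y 0 = 0" and YS: "Y (Suc n) = (1/2) *\<^sub>R (b + (Y n o\<^sub>L Y n))" for n
    by (simp_all add: Y_def)
  have YSv: "Y (Suc n) v = (1/2) *\<^sub>R (b v + Y n (Y n v))" for n v
    by (simp add: YS blinfun.add_left blinfun.scaleR_left)
  define r where "r = rec_nat (0::real) (\<lambda>_ y. (1 + y\<^sup>2) / 2)"
  have r0: "r 0 = 0" and rS: "r (Suc n) = (1 + (r n)\<^sup>2) / 2" for n
    by (simp_all add: r_def)
  have YN: "Y n \<in> N" for n
    by (induction n) (auto simp: Y0 YS intro!: N_0 N_scaleR N_add N_compose bN)
  have comm: "T (Y n v) = Y n (T v)" if "\<And>v. T (b v) = b (T v)" for T :: "'h \<Rightarrow>\<^sub>L 'h" and n v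
    by (induction n arbitrary: v)
      (simp_all add: Y0 YSv that blinfun.add_right blinfun.scaleR_right blinfun.zero_right)
  have Yb: "Y n (b v) = b (Y n v)" for n v
    by (rule sym[OF comm]) simp
  have YY: "Y m (Y n v) = Y n (Y m v)" for m n v
    by (rule comm) (rule Yb)
  have r01: "0 \<le> r n \<and> r n \<le> 1" for n
    by (induction n) (auto simp: r0 rS power_le_one)
  have Yr: "norm (Y n) \<le> r n" for n
  proof (induction n)
    case (Suc n)
    have "norm (Y n o\<^sub>L Y n) \<le> (r n)\<^sup>2"
      using norm_blinfun_compose[of "Y n" "Y n"] mult_mono[OF Suc Suc] r01[of n]
      by (simp add: power2_eq_square)
    then have "norm (b + (Y n o\<^sub>L Y n)) \<le> 1 + (r n)\<^sup>2"
      using norm_triangle_ineq[of b "Y n o\<^sub>L Y n"] bnorm by linarith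
    then show ?case by (simp add: YS rS)
  qed (simp add: Y0 r0)
  \<comment> \<open>The iterates commute, so a difference of squares factors exactly as for scalars.\<close>
  have step: "norm (Y (Suc n) - Y n) \<le> r (Suc n) - r n" for n
  proof (induction n)
    case 0
    then show ?case using Yr[of "Suc 0"] by (simp add: Y0 r0)
  next
    case (Suc n)
    let ?D = "Y (Suc n) - Y n" and ?S = "Y (Suc n) + Y n"
    have "Y (Suc (Suc n)) - Y (Suc n) = (1/2) *\<^sub>R (?D o\<^sub>L ?S)"
    proof (rule blinfun_eqI)
      fix v
      have "(?D o\<^sub>L ?S) v = Y (Suc n) (Y (Suc n) v) - Y n (Y n v)"
        by (simp only: blinfun_apply_blinfun_compose blinfun.diff_left blinfun.add_left
            blinfun.add_right YY[of n "Suc n"]) simp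
      then show "(Y (Suc (Suc n)) - Y (Suc n)) v = ((1/2) *\<^sub>R (?D o\<^sub>L ?S)) v"
        by (simp only: blinfun.diff_left blinfun.scaleR_left YSv[of "Suc n"] YSv[of n v])
          (simp add: algebra_simps)
    qed
    then have "norm (Y (Suc (Suc n)) - Y (Suc n)) \<le> (norm ?D * norm ?S) / 2"
      using norm_blinfun_compose[of ?D ?S] by simp
    also have "\<dots> \<le> ((r (Suc n) - r n) * (r (Suc n) + r n)) / 2"
      using Suc norm_triangle_ineq[of "Y (Suc n)" "Y n"] Yr[of n] Yr[of "Suc n"]
        order_trans[OF norm_ge_zero Suc]
      by (intro divide_right_mono mult_mono) (auto intro: order_trans[OF norm_ge_zero])
    also have "\<dots> = r (Suc (Suc n)) - r (Suc n)"
      by (simp add: rS[of "Suc n"] rS[of n]) (simp add: power2_eq_square algebra_simps rS)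
    finally show ?case .
  qed
  have rmono: "r n \<le> r (Suc n)" for n
    using step[of n] norm_ge_zero[of "Y (Suc n) - Y n"] by linarith
  have dist: "norm (Y (n + k) - Y n) \<le> r (n + k) - r n" for n k
  proof (induction k)
    case (Suc k)
    then show ?case
      using step[of "n + k"] norm_triangle_ineq[of "Y (Suc (n + k)) - Y (n + k)" "Y (n + k) - Y n"]
      by simp
  qed simp
  have dist': "norm (Y m - Y n) \<le> \<bar>r m - r n\<bar>" for m n
  proof (cases "n \<le> m")
    case True
    then show ?thesis using dist[of n "m - n"] by simp
  next
    case False
    then show ?thesis using dist[of m "n - m"] by (simp add: norm_minus_commute)
  qed
  have "incseq r" by (rule incseq_SucI) (rule rmono)
  then obtain l where "r \<longlonglongrightarrow> l"
    by (rule incseq_convergent[where B = 1]) (use r01 in auto)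
  then have Cr: "Cauchy r" using LIMSEQ_imp_Cauchy by blast
  have "Cauchy Y"
  proof (rule metric_CauchyI)
    fix \<epsilon> :: real assume "\<epsilon> > 0"
    then obtain M where "\<forall>m\<ge>M. \<forall>n\<ge>M. dist (r m) (r n) < \<epsilon>"
      using metric_CauchyD[OF Cr] by blast
    then show "\<exists>M. \<forall>m\<ge>M. \<forall>n\<ge>M. dist (Y m) (Y n) < \<epsilon>"
      using dist' by (metis dist_norm dist_real_def le_less_trans)
  qed
  then obtain y where y: "Y \<longlonglongrightarrow> y"
    using Cauchy_convergent convergent_def by blast
  have yN: "y \<in> N" using N_closed YN y closed_sequentially by blast
  have yv: "(\<lambda>n. Y n v) \<longlonglongrightarrow> y v" for v
    using y by (intro blinfun.tendsto tendsto_const)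
  have fixp: "y v = (1/2) *\<^sub>R (b v + y (y v))" for v
  proof -
    have "(\<lambda>n. Y n (Y n v)) \<longlonglongrightarrow> y (y v)"
      by (rule blinfun.tendsto[OF y yv])
    then have "(\<lambda>n. Y (Suc n) v) \<longlonglongrightarrow> (1/2) *\<^sub>R (b v + y (y v))"
      unfolding YSv by (intro tendsto_scaleR tendsto_add tendsto_const)
    moreover have "(\<lambda>n. Y (Suc n) v) \<longlonglongrightarrow> y v"
      using yv by (rule LIMSEQ_Suc)
    ultimately show ?thesis using LIMSEQ_unique by blast
  qed
  have ynorm: "norm y \<le> 1"
    by (rule LIMSEQ_le_const2[OF tendsto_norm[OF y]]) (use Yr r01 order_trans in blast)
  have Ysym: "Y n v \<bullet> w = v \<bullet> Y n w" for n v w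
    by (induction n arbitrary: v w)
      (simp_all add: Y0 YSv bv inner_add_left inner_add_right inner_diff_left inner_diff_right
        e_inner sym_opD[OF s(2)])
  have ysym: "y v \<bullet> w = v \<bullet> y w" for v w
    using LIMSEQ_unique[OF tendsto_inner[OF yv[of v] tendsto_const[of w]]
        tendsto_inner[OF tendsto_const[of v] yv[of w], folded Ysym]] .
  define a where "a = e - y"
  have av: "a v = e v - y v" for v by (simp add: a_def blinfun.diff_left)
  have "a \<in> N" unfolding a_def by (intro N_diff e_in_N yN)
  moreover have "sym_op a"
    by (simp add: sym_op_def av inner_diff_left inner_diff_right e_inner ysym)
  moreover have "0 \<le> a v \<bullet> v" for v
  proof -
    have "y v \<bullet> v = y (e v) \<bullet> e v"
      using e_inner[of "y v" v] yN by simp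
    also have "\<dots> \<le> norm (y (e v)) * norm (e v)" by (rule norm_cauchy_schwarz)
    also have "\<dots> \<le> norm (e v) * norm (e v)"
      using norm_blinfun[of y "e v"] mult_right_mono[OF ynorm norm_ge_zero[of "e v"]]
      by (intro mult_right_mono) auto
    also have "\<dots> = e v \<bullet> v"
      using e_inner_e[of v v] by (simp add: power2_norm_eq_inner flip: power2_eq_square)
    finally show ?thesis by (simp add: av inner_diff_left)
  qed
  moreover have "a (a v) = s (s v)" for v
  proof -
    have "y (y v) = 2 *\<^sub>R y v - b v" using fixp[of v] by (metis (no_types, lifting) add_diff_cancel_left' div_self scaleR_half_double scaleR_2 scaleR_add_right add.commute)
    then show ?thesis
      using yN e_in_N by (simp add: av blinfun.diff_right bv algebra_simps scaleR_2)
  qed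
  moreover have "T (a v) = a (T v)" if T: "T \<in> N" "\<And>v. T (s v) = s (T v)" for T v
  proof -
    have "T (Y n v) = Y n (T v)" for n
      by (rule comm) (simp add: bv blinfun.diff_right T e_in_N)
    then have "(\<lambda>n. Y n (T v)) \<longlonglongrightarrow> T (y v)"
      using blinfun.tendsto[OF tendsto_const yv[of v], of T] by simp
    then have "T (y v) = y (T v)" using yv LIMSEQ_unique by blast
    then show ?thesis using T(1) by (simp add: av blinfun.diff_right)
  qed
  ultimately show ?thesis by blast
qed

lemma sqrt_of_square:
  assumes s: "s \<in> N" "sym_op s"
  shows "\<exists>a\<in>N. sym_op a \<and> (\<forall>v. 0 \<le> a v \<bullet> v) \<and> (\<forall>v. a (a v) = s (s v)) \<and>
    (\<forall>T\<in>N. (\<forall>v. T (s v) = s (T v)) \<longrightarrow> (\<forall>v. T (a v) = a (T v)))"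
proof -
  define c where "c = norm s + 1"
  have c: "c > 0" "norm s \<le> c" by (auto simp: c_def add_nonneg_pos)
  define s' where "s' = (1 / c) *\<^sub>R s"
  have s'v: "s' v = (1 / c) *\<^sub>R s v" for v by (simp add: s'_def blinfun.scaleR_left)
  have "s' \<in> N" "sym_op s'" "norm s' \<le> 1"
    using s c by (auto simp: s'_def N_scaleR sym_op_def blinfun.scaleR_left)
  from sqrt_of_square_contraction[OF this] obtain a where a: "a \<in> N" "sym_op a"
    "\<And>v. 0 \<le> a v \<bullet> v" "\<And>v. a (a v) = s' (s' v)"
    "\<And>T v. T \<in> N \<Longrightarrow> (\<And>v. T (s' v) = s' (T v)) \<Longrightarrow> T (a v) = a (T v)"
    by blast
  have "c *\<^sub>R a \<in> N" using a by (simp add: N_scaleR)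
  moreover have "sym_op (c *\<^sub>R a)" using a(2) by (simp add: sym_op_def blinfun.scaleR_left)
  moreover have "0 \<le> (c *\<^sub>R a) v \<bullet> v" for v
    using a(3)[of v] c by (simp add: blinfun.scaleR_left)
  moreover have "(c *\<^sub>R a) ((c *\<^sub>R a) v) = s (s v)" for v
    using c by (simp add: blinfun.scaleR_left blinfun.scaleR_right a(4) s'v)
  moreover have "T ((c *\<^sub>R a) v) = (c *\<^sub>R a) (T v)" if T: "T \<in> N" "\<And>v. T (s v) = s (T v)" for T v
    using a(5)[OF T(1), of v] T(2) by (simp add: blinfun.scaleR_left blinfun.scaleR_right s'v)
  ultimately show ?thesis by blast
qed

text \<open>The properties of the positive part \<open>p\<close> of \<open>x - t\<close> from which the
  spectral projection at \<open>t\<close> is constructed. The form of \<open>x\<close> is at most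
  \<open>t\<close> on the kernel of \<open>p\<close> and at least \<open>t\<close> on its orthogonal
  complement; the remaining condition says that \<open>x\<close> exceeds \<open>t\<close> strictly on the
  nonzero vectors in the range of \<open>p\<close>.\<close>

definition is_cut :: "('h \<Rightarrow>\<^sub>L 'h) \<Rightarrow> real \<Rightarrow> ('h \<Rightarrow>\<^sub>L 'h) \<Rightarrow> bool" where
  "is_cut x t p \<longleftrightarrow> p \<in> N \<and> sym_op p \<and>
     (\<forall>T\<in>N. (\<forall>v. T (x v) = x (T v)) \<longrightarrow> (\<forall>v. T (p v) = p (T v))) \<and>
     (\<forall>v. e v = v \<longrightarrow> p v = 0 \<longrightarrow> x v \<bullet> v \<le> t * (v \<bullet> v)) \<and>
     (\<forall>v. x (p v) \<bullet> p v \<le> t * (p v \<bullet> p v) \<longrightarrow> p v = 0) \<and>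
     (\<forall>w. e w = w \<longrightarrow> (\<forall>u. e u = u \<longrightarrow> p u = 0 \<longrightarrow> w \<bullet> u = 0) \<longrightarrow> t * (w \<bullet> w) \<le> x w \<bullet> w)"

text \<open>With \<open>s = x - t\<close> and its absolute value \<open>a\<close>, the positive and negative
  parts \<open>p = (a + s)/2\<close> and \<open>z = (a - s)/2\<close> annihilate each other. So \<open>s =
  -a\<close> on the kernel of \<open>p\<close>, while \<open>s = a\<close> on the range of \<open>p\<close>
  and, as the range of \<open>z\<close> lies in the kernel of \<open>p\<close>, also on the orthogonal
  complement of that kernel.\<close>

lemma spectral_cut:
  assumes x: "x \<in> N" "sym_op x"
  shows "\<exists>p. is_cut x t p"
proof -
  define s where "s = x - t *\<^sub>R e"
  have sv: "s v = x v - t *\<^sub>R e v" for v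
    by (simp add: s_def blinfun.diff_left blinfun.scaleR_left)
  have s: "s \<in> N" "sym_op s"
    using x by (auto simp: s_def N_diff N_scaleR e_in_N)
      (auto simp: sym_op_def blinfun.diff_left blinfun.scaleR_left inner_diff_left inner_diff_right e_inner)
  from sqrt_of_square[OF this] obtain a where a: "a \<in> N" "sym_op a"
    "\<And>v. 0 \<le> a v \<bullet> v" "\<And>v. a (a v) = s (s v)"
    "\<And>T v. T \<in> N \<Longrightarrow> (\<And>v. T (s v) = s (T v)) \<Longrightarrow> T (a v) = a (T v)"
    by blast
  define p where "p = (1/2) *\<^sub>R (a + s)"
  define z where "z = (1/2) *\<^sub>R (a - s)"
  have pv: "p v = (1/2) *\<^sub>R (a v + s v)" and zv: "z v = (1/2) *\<^sub>R (a v - s v)" for v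
    by (simp_all add: p_def z_def blinfun.scaleR_left blinfun.add_left blinfun.diff_left)
  have pN: "p \<in> N" and zN: "z \<in> N"
    unfolding p_def z_def by (intro N_scaleR N_add N_diff a s)+
  have as: "s (a v) = a (s v)" for v
    by (rule a(5)[OF s(1)]) simp
  have pz: "p (z v) = 0" and zp: "z (p v) = 0" for v
    by (simp_all add: pv zv blinfun.scaleR_right blinfun.add_right blinfun.diff_right as a(4)
        algebra_simps)
  have sum: "a v = p v + z v" and dif: "s v = p v - z v" for v
    by (simp_all add: pv zv scaleR_add_right scaleR_diff_right flip: scaleR_add_left)
  have psym: "sym_op p" and zsym: "sym_op z"
    using a(2) s(2) by (simp_all add: sym_op_def pv zv inner_add_left inner_add_right
        inner_diff_left inner_diff_right)
  have form: "s v \<bullet> v = x v \<bullet> v - t * (v \<bullet> v)" if "e v = v" for v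
    using that by (simp add: sv inner_diff_left)
  have "T (p v) = p (T v)" if T: "T \<in> N" "\<forall>v. T (x v) = x (T v)" for T v
  proof -
    have ts: "T (s v) = s (T v)" for v
      using T by (simp add: sv blinfun.diff_right blinfun.scaleR_right e_in_N)
    then show ?thesis
      using a(5)[OF T(1) ts] by (simp add: pv blinfun.scaleR_right blinfun.add_right)
  qed
  moreover have "x v \<bullet> v \<le> t * (v \<bullet> v)" if "e v = v" "p v = 0" for v
  proof -
    have "s v = - a v" using that(2) sum[of v] dif[of v] by simp
    then show ?thesis using form[OF that(1)] a(3)[of v] by simp
  qed
  moreover have "p v = 0" if le: "x (p v) \<bullet> p v \<le> t * (p v \<bullet> p v)" for v
  proof -
    have eq: "a (p v) = p (p v)" "s (p v) = p (p v)"
      using sum[of "p v"] dif[of "p v"] zp by simp_all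
    have "a (p v) \<bullet> p v \<le> 0"
      using form[of "p v"] le pN eq by simp
    then have "a (p v) = 0"
      by (rule positive_form_zero[OF a(2,3)])
    then have "p v \<bullet> p v = 0"
      using eq sym_opD[OF psym, of v "p v"] by simp
    then show ?thesis by simp
  qed
  moreover have "t * (w \<bullet> w) \<le> x w \<bullet> w"
    if w: "e w = w" "\<forall>u. e u = u \<longrightarrow> p u = 0 \<longrightarrow> w \<bullet> u = 0" for w
  proof -
    have "z w \<bullet> z w = w \<bullet> z (z w)"
      by (rule sym_opD[OF zsym])
    also have "\<dots> = 0" using w(2) pz zN by simp
    finally have "z w = 0" by simp
    then have "s w = a w" using sum[of w] dif[of w] by simp
    then show ?thesis using form[OF w(1)] a(3)[of w] by simp
  qed
  ultimately show ?thesis using pN psym unfolding is_cut_def by blast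
qed

text \<open>Outside of the range of the unit every element of the algebra vanishes, so only the part of the
  kernel inside that range is meant.\<close>

definition is_kernel_projection :: "('h \<Rightarrow>\<^sub>L 'h) \<Rightarrow> ('h \<Rightarrow>\<^sub>L 'h) \<Rightarrow> bool" where
  "is_kernel_projection p Q \<longleftrightarrow> Q \<in> N \<and> projection Q \<and> (\<forall>v. Q v = v \<longleftrightarrow> e v = v \<and> p v = 0) \<and>
    (\<forall>T\<in>N. (\<forall>v. T (p v) = p (T v)) \<longrightarrow> (\<forall>v. T (Q v) = Q (T v)))"

text \<open>The orthogonal projection \<open>Q\<close> onto the kernel exists in any case; what has to be
  shown is that it lies in the algebra. For small \<open>r\<close> the symmetric contraction \<open>q = 1 - r
  p\<^sup>2\<close> fixes exactly the kernel of \<open>p\<close>. Its even powers form a Cauchy sequence at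
  every vector, because inner products of even powers are squared norms of intermediate powers and these
  decrease; the limit is \<open>Q\<close>.\<close>

lemma kernel_projection:
  assumes p: "p \<in> N" "sym_op p"
  shows "\<exists>Q. is_kernel_projection p Q"
proof -
  define W where "W = {v. e v = v \<and> p v = 0}"
  have "subspace W"
    by (auto simp: W_def subspace_def blinfun.zero_right blinfun.add_right blinfun.scaleR_right)
  moreover have "closed W"
    unfolding W_def by (intro closed_Collect_conj closed_Collect_eq continuous_intros)
  moreover have "c *\<^sub>C v \<in> W" if "v \<in> W" for c v
    using that scaleC_zero_right[of c] N_bounded_ops e_in_N p(1) by (auto simp: W_def bounded_opsD)
  ultimately obtain Q where Q: "projection Q" "\<And>v. Q v = v \<longleftrightarrow> v \<in> W"
    using ex_projection_onto[of W] by blast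
  have QW: "e (Q v) = Q v" "p (Q v) = 0" for v
    using Q(2)[of "Q v"] projection_idem[OF Q(1)] by (auto simp: W_def)
  have Qe: "Q (e v) = Q v" for v
    by (rule projection_le_commute[OF Q(1) projection_e QW(1)])
  have Qp: "Q (p v) = 0" for v
  proof -
    have "Q (p v) \<bullet> Q (p v) = v \<bullet> p (Q (p v))"
      using projection_inner[OF Q(1), of "p v" "p v"] projection_inner'[OF Q(1), of "p v" "p v"]
        sym_opD[OF p(2), of v "Q (p v)"] by (simp add: inner_commute)
    then show ?thesis using QW(2) by simp
  qed
  define r where "r = 1 / (1 + (norm p)\<^sup>2)"
  have r: "r > 0" "r * (norm p)\<^sup>2 \<le> 1"
    by (auto simp: r_def divide_simps add_pos_nonneg)
  define q where "q = e - r *\<^sub>R (p o\<^sub>L p)"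
  have qv: "q v = e v - r *\<^sub>R p (p v)" for v
    by (simp add: q_def blinfun.diff_left blinfun.scaleR_left)
  have qN: "q \<in> N" unfolding q_def by (intro N_diff e_in_N N_scaleR N_compose p)
  have qsym: "sym_op q"
    by (simp add: sym_op_def qv inner_diff_left inner_diff_right e_inner sym_opD[OF p(2)])
  have contr: "(norm (q v))\<^sup>2 \<le> (norm (e v))\<^sup>2 - r * (norm (p v))\<^sup>2" for v
  proof -
    have "e v \<bullet> p (p v) = (norm (p v))\<^sup>2"
      using e_inner[of v "p (p v)"] sym_opD[OF p(2), of v "p v"] p(1)
      by (simp add: power2_norm_eq_inner)
    then have "(norm (q v))\<^sup>2 = (norm (e v))\<^sup>2 - 2 * r * (norm (p v))\<^sup>2 + r * (r * (norm (p (p v)))\<^sup>2)"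
      by (simp add: qv power2_norm_eq_inner inner_diff_left inner_diff_right inner_commute)
    moreover have "r * (norm (p (p v)))\<^sup>2 \<le> (norm (p v))\<^sup>2"
    proof -
      have "(norm (p (p v)))\<^sup>2 \<le> (norm p)\<^sup>2 * (norm (p v))\<^sup>2"
        using power_mono[OF norm_blinfun[of p "p v"] norm_ge_zero, of 2] by (simp add: power_mult_distrib)
      then have "r * (norm (p (p v)))\<^sup>2 \<le> (r * (norm p)\<^sup>2) * (norm (p v))\<^sup>2"
        using r by (simp add: mult.assoc)
      also have "\<dots> \<le> 1 * (norm (p v))\<^sup>2" using r by (intro mult_right_mono) auto
      finally show ?thesis by simp
    qed
    then have "r * (r * (norm (p (p v)))\<^sup>2) \<le> r * (norm (p v))\<^sup>2" using r by simp
    ultimately show ?thesis by linarith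
  qed
  define P where "P = op_power e q"
  have PN: "P n \<in> N" for n unfolding P_def by (rule op_power_in_N[OF qN])
  have PS: "P (Suc n) v = q (P n v)" for n v by (simp add: P_def op_power_Suc)
  have Padd: "P (m + n) v = P m (P n v)" for m n v
    unfolding P_def by (rule op_power_add[OF qN])
  have Psym: "P n v \<bullet> w = v \<bullet> P n w" for n v w
    using op_power_sym[OF qN qsym] by (simp add: P_def sym_op_def)
  have conv: "(\<lambda>k. P (2 * k) v) \<longlonglongrightarrow> Q v" for v
  proof -
    define g where "g n = (norm (P n v))\<^sup>2" for n
    have gstep: "r * (norm (p (P n v)))\<^sup>2 \<le> g n - g (Suc n)" for n
      using contr[of "P n v"] PN[of n] by (simp add: g_def PS)
    have "g (Suc n) \<le> g n" for n
      using gstep[of n] r by (smt (verit) mult_nonneg_nonneg zero_le_power2)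
    then have "decseq g" by (rule decseq_SucI)
    then obtain l where l: "g \<longlonglongrightarrow> l"
      by (rule decseq_convergent[where B = 0]) (auto simp: g_def)
    have dist: "(norm (P (2 * k) v - P (2 * m) v))\<^sup>2 = g (2 * k) + g (2 * m) - 2 * g (k + m)" for k m
    proof -
      have "P (2 * k) v \<bullet> P (2 * m) v = P (k + m) v \<bullet> P (k + m) v"
      proof -
        have "P (2 * k) v \<bullet> P (2 * m) v = P k (P k v) \<bullet> P m (P m v)"
          by (simp add: mult_2 Padd)
        also have "\<dots> = P k v \<bullet> P k (P m (P m v))" by (rule Psym)
        also have "P k (P m (P m v)) = P m (P k (P m v))"
          using Padd[of k m "P m v"] Padd[of m k "P m v"] by (simp add: add.commute)
        also have "P k v \<bullet> \<dots> = P m (P k v) \<bullet> P k (P m v)" by (rule Psym[symmetric])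
        also have "\<dots> = P (k + m) v \<bullet> P (k + m) v"
          using Padd[of m k v] Padd[of k m v] by (simp add: add.commute)
        finally show ?thesis .
      qed
      then show ?thesis
        by (simp add: g_def power2_norm_eq_inner inner_diff_left inner_diff_right inner_commute)
    qed
    obtain u where u: "(\<lambda>k. P (2 * k) v) \<longlonglongrightarrow> u"
    proof (rule convergent_square_distI)
      fix \<epsilon> :: real assume "\<epsilon> > 0"
      then have "eventually (\<lambda>n. dist (g n) l < \<epsilon> / 4) sequentially"
        by (intro tendstoD[OF l]) auto
      then obtain M where M: "\<And>n. n \<ge> M \<Longrightarrow> \<bar>g n - l\<bar> < \<epsilon> / 4"
        unfolding eventually_sequentially dist_real_def by blast
      have "(norm (P (2 * k) v - P (2 * m) v))\<^sup>2 < \<epsilon>" if "k \<ge> M" "m \<ge> M" for k m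
      proof -
        have "\<bar>g (2 * k) - l\<bar> < \<epsilon> / 4" "\<bar>g (2 * m) - l\<bar> < \<epsilon> / 4" "\<bar>g (k + m) - l\<bar> < \<epsilon> / 4"
          using M that by simp_all
        then show ?thesis unfolding dist by linarith
      qed
      then show "\<exists>M. \<forall>k\<ge>M. \<forall>m\<ge>M. (norm (P (2 * k) v - P (2 * m) v))\<^sup>2 < \<epsilon>" by blast
    qed
    have even: "filterlim (\<lambda>k::nat. 2 * k) sequentially sequentially"
      by (rule filterlim_subseq) (auto simp: strict_mono_def)
    have "p u = 0"
    proof -
      have "(\<lambda>n. g n - g (Suc n)) \<longlonglongrightarrow> l - l"
        using l by (intro tendsto_diff LIMSEQ_Suc)
      then have lim: "(\<lambda>n. g n - g (Suc n)) \<longlonglongrightarrow> 0" by simp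
      have "(\<lambda>n. r * (norm (p (P n v)))\<^sup>2) \<longlonglongrightarrow> 0"
      proof (rule tendsto_sandwich[OF _ _ tendsto_const lim])
        show "\<forall>\<^sub>F n in sequentially. 0 \<le> r * (norm (p (P n v)))\<^sup>2" using r by simp
        show "\<forall>\<^sub>F n in sequentially. r * (norm (p (P n v)))\<^sup>2 \<le> g n - g (Suc n)"
          by (rule always_eventually) (rule allI, rule gstep)
      qed
      then have "(\<lambda>k. r * (norm (p (P (2 * k) v)))\<^sup>2) \<longlonglongrightarrow> 0"
        by (rule filterlim_compose[OF _ even])
      moreover have "(\<lambda>k. r * (norm (p (P (2 * k) v)))\<^sup>2) \<longlonglongrightarrow> r * (norm (p u))\<^sup>2"
        using u by (intro tendsto_intros blinfun.tendsto[OF tendsto_const])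
      ultimately have "r * (norm (p u))\<^sup>2 = 0" using LIMSEQ_unique by blast
      then show ?thesis using r by simp
    qed
    moreover have "e u = u"
    proof -
      have "(\<lambda>k. e (P (2 * k) v)) \<longlonglongrightarrow> e u"
        using u by (intro blinfun.tendsto[OF tendsto_const])
      then show ?thesis using u PN LIMSEQ_unique by simp
    qed
    ultimately have "Q u = u" using Q(2) by (simp add: W_def)
    moreover have "Q u = Q v"
    proof -
      have "Q (P n v) = Q v" for n
        by (induction n)
          (simp_all add: P_def op_power_0 op_power_Suc qv Qe Qp blinfun.diff_right blinfun.scaleR_right)
      moreover have "(\<lambda>k. Q (P (2 * k) v)) \<longlonglongrightarrow> Q u"
        using u by (intro blinfun.tendsto[OF tendsto_const])
      ultimately show ?thesis by (simp add: LIMSEQ_const_iff)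
    qed
    ultimately show ?thesis using u by simp
  qed
  have "Q \<in> N"
    by (rule N_strong_limit[OF conv]) (use PN in auto)
  moreover have "T (Q v) = Q (T v)" if T: "T \<in> N" "\<forall>v. T (p v) = p (T v)" for T v
  proof -
    have "T (q v) = q (T v)" for v
      using T by (simp add: qv blinfun.diff_right blinfun.scaleR_right)
    then have "T (P n v) = P n (T v)" for n
      unfolding P_def using op_power_commute[OF T(1) qN] by simp
    then have "(\<lambda>k. P (2 * k) (T v)) \<longlonglongrightarrow> T (Q v)"
      using blinfun.tendsto[OF tendsto_const conv[of v], of T] by simp
    then show ?thesis using conv LIMSEQ_unique by blast
  qed
  ultimately show ?thesis using Q by (auto simp: W_def is_kernel_projection_def)
qed

end

text \<open>Polarisation, applied to \<open>w\<close> and to the multiple of \<open>A w\<close> that has the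
  norm of \<open>w\<close>. The invariant subspace keeps the latter inside the region where the form is
  controlled.\<close>

lemma norm_le_of_form_le:
  assumes A: "sym_op A" and W: "subspace W" "\<And>w. w \<in> W \<Longrightarrow> A w \<in> W"
    and form: "\<And>w. w \<in> W \<Longrightarrow> \<bar>A w \<bullet> w\<bar> \<le> h * (w \<bullet> w)" and w: "w \<in> W"
  shows "norm (A w) \<le> h * norm w"
proof (cases "A w = 0")
  case True
  have "0 \<le> h" if "w \<noteq> 0"
    using form[OF w] that by (smt (verit) inner_gt_zero_iff mult_neg_pos)
  then show ?thesis using True by (cases "w = 0") auto
next
  case False
  then have w0: "norm w > 0" by (auto simp: blinfun.zero_right)
  define c where "c = norm w / norm (A w)"
  have c: "c > 0" using w0 False by (simp add: c_def)
  define u where "u = c *\<^sub>R A w"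
  have u: "u \<in> W" unfolding u_def using W w by (simp add: subspace_scale)
  have nu: "u \<bullet> u = w \<bullet> w"
    using False by (simp add: u_def c_def power2_norm_eq_inner[symmetric] power2_eq_square)
  have "4 * (A w \<bullet> u) = A (w + u) \<bullet> (w + u) - A (w - u) \<bullet> (w - u)"
    using sym_opD[OF A, of u w]
    by (simp add: blinfun.add_right blinfun.diff_right inner_add_left inner_add_right
        inner_diff_left inner_diff_right inner_commute)
  also have "\<dots> \<le> h * ((w + u) \<bullet> (w + u)) + h * ((w - u) \<bullet> (w - u))"
    using form[of "w + u"] form[of "w - u"] w u W(1) by (simp add: subspace_add subspace_diff)
  also have "\<dots> = 4 * (h * (w \<bullet> w))"
    by (simp add: inner_add_left inner_add_right inner_diff_left inner_diff_right inner_commute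
        nu algebra_simps)
  finally have "c * (norm (A w))\<^sup>2 \<le> h * (norm w)\<^sup>2"
    by (simp add: u_def power2_norm_eq_inner)
  then have "norm w * norm (A w) \<le> norm w * (h * norm w)"
    using False by (simp add: c_def power2_eq_square mult_ac)
  then show ?thesis using w0 by simp
qed

context vn_algebra
begin

text \<open>\<open>E t\<close> is the projection onto the kernel of the positive part \<open>p t\<close> of
  \<open>x - t\<close>. Monotonicity, right continuity and the behaviour at the two ends all come from one
  fact, \<open>strict\<close>: to see that \<open>p t v = 0\<close> it suffices that the form of
  \<open>x\<close> at the vector \<open>p t v\<close> is at most \<open>t\<close>. On a cell, the form of
  \<open>x\<close> lies between the two end points, so \<open>x\<close> is within the mesh of any tag, and
  \<open>block_bound\<close> assembles the cells.\<close>

theorem spectral_theorem: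
  assumes x: "x \<in> N" "sym_op x"
  shows "\<exists>E. resolution_of_identity e E \<and> has_spectral_integral e E (\<lambda>t. t) x \<and> (\<forall>t. E t \<in> N)"
proof -
  obtain p where cut: "\<And>t. is_cut x t (p t)"
    using spectral_cut[OF x] by metis
  have p: "p t \<in> N" "sym_op (p t)" for t
    using cut[of t] by (simp_all add: is_cut_def)
  have pcomm: "T (p t v) = p t (T v)" if "T \<in> N" "\<And>v. T (x v) = x (T v)" for t T v
    using cut[of t] that by (simp add: is_cut_def)
  have upper: "x v \<bullet> v \<le> t * (v \<bullet> v)" if "e v = v" "p t v = 0" for t v
    using cut[of t] that by (simp add: is_cut_def)
  have strict: "p t v = 0" if "x (p t v) \<bullet> p t v \<le> t * (p t v \<bullet> p t v)" for t v
    using cut[of t] that by (simp add: is_cut_def)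
  have lower: "t * (w \<bullet> w) \<le> x w \<bullet> w"
    if "e w = w" "\<And>u. e u = u \<Longrightarrow> p t u = 0 \<Longrightarrow> w \<bullet> u = 0" for t w
    using cut[of t] that by (simp add: is_cut_def)
  obtain E where kernel: "\<And>t. is_kernel_projection (p t) (E t)"
    using kernel_projection[OF p] by metis
  have EN: "E t \<in> N" and proj: "projection (E t)" for t
    using kernel[of t] by (simp_all add: is_kernel_projection_def)
  have fixed: "E t v = v \<longleftrightarrow> e v = v \<and> p t v = 0" for t v
    using kernel[of t] by (simp add: is_kernel_projection_def)
  have Ecomm: "T (E t v) = E t (T v)" if "T \<in> N" "\<And>v. T (p t v) = p t (T v)" for t T v
    using kernel[of t] that by (simp add: is_kernel_projection_def)
  have xp: "x (p t v) = p t (x v)" for t v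
    by (rule pcomm[OF x(1)]) simp
  have xE: "x (E t v) = E t (x v)" for t v
    by (rule Ecomm[OF x(1)]) (rule xp)
  have pp: "p s (p t v) = p t (p s v)" for s t v
    by (rule pcomm[OF p(1)]) (simp add: xp)
  have ranE: "e (E t v) = E t v" "p t (E t v) = 0" for t v
    using fixed[of t "E t v"] projection_idem[OF proj] by auto
  have res: "resolution_of_identity e E"
  proof (rule resolution_of_identityI[OF proj])
    fix s t v assume st: "(s::real) \<le> t"
    let ?u = "E s v" and ?w = "p t (E s v)"
    have "p s ?w = 0" using pp[of s t ?u] ranE(2) by (simp add: blinfun.zero_right)
    then have "x ?w \<bullet> ?w \<le> s * (?w \<bullet> ?w)" using p(1) by (intro upper) auto
    also have "\<dots> \<le> t * (?w \<bullet> ?w)" using st by (simp add: mult_right_mono)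
    finally have "?w = 0" by (rule strict)
    then show "E t (E s v) = E s v" using fixed ranE by simp
  next
    fix t v assume E: "\<And>s. t < s \<Longrightarrow> E s v = v"
    let ?w = "p t v"
    have "x ?w \<bullet> ?w \<le> s * (?w \<bullet> ?w)" if "s > t" for s
    proof (rule upper)
      show "p s ?w = 0" using pp[of s t v] E[OF that] fixed by (simp add: blinfun.zero_right)
    qed (use p(1) in simp)
    then have le: "x ?w \<bullet> ?w \<le> (t + \<epsilon>) * (?w \<bullet> ?w)" if "\<epsilon> > 0" for \<epsilon>
      using that by simp
    have "x ?w \<bullet> ?w \<le> t * (?w \<bullet> ?w)"
    proof (cases "?w = 0")
      case False
      then have ww: "?w \<bullet> ?w > 0" by simp
      show ?thesis
      proof (rule field_le_epsilon)
        fix \<epsilon> :: real assume "\<epsilon> > 0"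
        then show "x ?w \<bullet> ?w \<le> t * (?w \<bullet> ?w) + \<epsilon>"
          using le[of "\<epsilon> / (?w \<bullet> ?w)"] ww by (simp add: distrib_right)
      qed
    qed simp
    then have "?w = 0" by (rule strict)
    then show "E t v = v" using fixed E[of "t + 1"] by simp
  next
    fix t assume t: "t < - norm x"
    show "E t = 0"
    proof (rule blinfun_eqI)
      fix v
      let ?u = "E t v"
      have "x ?u \<bullet> ?u \<le> t * (?u \<bullet> ?u)" by (rule upper) (auto simp: ranE)
      moreover have "\<bar>x ?u \<bullet> ?u\<bar> \<le> norm x * (?u \<bullet> ?u)"
      proof -
        have "\<bar>x ?u \<bullet> ?u\<bar> \<le> norm (x ?u) * norm ?u" by (rule Cauchy_Schwarz_ineq2)
        also have "\<dots> \<le> (norm x * norm ?u) * norm ?u"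
          by (intro mult_right_mono norm_blinfun) auto
        finally show ?thesis by (simp add: power2_norm_eq_inner[symmetric] power2_eq_square mult.assoc)
      qed
      ultimately have "0 \<le> (t + norm x) * (?u \<bullet> ?u)" by (simp add: algebra_simps)
      then have "?u \<bullet> ?u \<le> 0" using t by (simp add: zero_le_mult_iff)
      then have "?u = 0" by (meson inner_gt_zero_iff not_le)
      then show "?u = (0 :: 'h \<Rightarrow>\<^sub>L 'h) v" by simp
    qed
  next
    fix t assume t: "norm x \<le> t"
    show "E t = e"
    proof (rule projection_eqI[OF proj projection_e])
      fix v
      let ?w = "p t v"
      have "x ?w \<bullet> ?w \<le> norm (x ?w) * norm ?w" by (rule norm_cauchy_schwarz)
      also have "\<dots> \<le> (norm x * norm ?w) * norm ?w"
        by (intro mult_right_mono norm_blinfun) auto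
      also have "\<dots> \<le> (t * norm ?w) * norm ?w"
        using t by (intro mult_right_mono) auto
      finally have "?w = 0"
        by (intro strict) (simp add: power2_norm_eq_inner[symmetric] power2_eq_square mult.assoc)
      then show "E t v = v \<longleftrightarrow> e v = v" by (simp add: fixed)
    qed
  qed
  interpret E: resolution e E by unfold_locales (rule res)
  have cell: "norm (x w - r *\<^sub>R w) \<le> (b - a) * norm w"
    if ab: "a \<le> r" "r \<le> b" and w: "E b w = w" "E a w = 0" for a b r w
  proof -
    define W where "W = {w. E b w = w \<and> E a w = 0}"
    define A where "A = x - r *\<^sub>R id_blinfun"
    have A: "A w = x w - r *\<^sub>R w" for w
      by (simp add: A_def blinfun.diff_left blinfun.scaleR_left)
    have "norm (A w) \<le> (b - a) * norm w"
    proof (rule norm_le_of_form_le[where W = W])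
      show "sym_op A"
        using x(2) by (simp add: sym_op_def A inner_diff_left inner_diff_right)
      show "subspace W"
        by (auto simp: W_def subspace_def blinfun.zero_right blinfun.add_right blinfun.scaleR_right)
      show "A w \<in> W" if "w \<in> W" for w
        using that xE[of a w] xE[of b w]
        by (simp add: W_def A blinfun.diff_right blinfun.scaleR_right blinfun.zero_right)
      show "w \<in> W" using w by (simp add: W_def)
      fix w assume "w \<in> W"
      then have w: "E b w = w" "E a w = 0" by (auto simp: W_def)
      then have ew: "e w = w" "p b w = 0" using fixed by auto
      have "x w \<bullet> w \<le> b * (w \<bullet> w)" by (rule upper[OF ew])
      moreover have "a * (w \<bullet> w) \<le> x w \<bullet> w"
      proof (rule lower[OF ew(1)])
        fix u assume "e u = u" "p a u = 0"
        then have "E a u = u" by (simp add: fixed)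
        then show "w \<bullet> u = 0" using E.sym[of a w u] w(2) by simp
      qed
      moreover have "a * (w \<bullet> w) \<le> r * (w \<bullet> w)" "r * (w \<bullet> w) \<le> b * (w \<bullet> w)"
        using ab by (auto intro!: mult_right_mono)
      ultimately show "\<bar>A w \<bullet> w\<bar> \<le> (b - a) * (w \<bullet> w)"
        by (simp add: A inner_diff_left left_diff_distrib)
    qed
    then show ?thesis by (simp add: A)
  qed
  have "has_spectral_integral e E (\<lambda>t. t) x"
    unfolding E.has_spectral_integral_iff
  proof (intro allI impI)
    fix \<epsilon> :: real assume \<epsilon>: "\<epsilon> > 0"
    have "norm (x - E.riemann n t s (\<lambda>t. t)) < \<epsilon>" if tag: "E.fine_tagged (\<epsilon> / 2) n t s" for n t s
    proof -
      let ?A = "x - E.riemann n t s (\<lambda>t. t)"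
      have adm: "E.admissible n t" using tag by (simp add: E.fine_tagged_def)
      have "norm ?A \<le> \<epsilon> / 2"
      proof (rule norm_blinfun_bound)
        fix v
        have "norm (?A (e v)) \<le> \<epsilon> / 2 * norm (e v)"
        proof (rule E.block_bound[OF adm])
          show "?A (E r v) = E r (?A v)" for r v
            by (simp add: blinfun.diff_left blinfun.diff_right xE E.riemann_commute)
          fix i assume i: "i < n"
          then have t: "t i \<le> s i" "s i \<le> t (Suc i)" "t (Suc i) - t i < \<epsilon> / 2"
            using tag by (auto simp: E.fine_tagged_def)
          have "norm (?A (E.cell t i v)) = norm (x (E.cell t i v) - s i *\<^sub>R E.cell t i v)"
            using E.riemann_cell[OF adm i] by (simp add: blinfun.diff_left)
          also have "\<dots> \<le> (t (Suc i) - t i) * norm (E.cell t i v)"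
            by (rule cell[OF t(1,2)]) (use t in \<open>auto intro!: E.E_cell_upper E.E_cell_lower\<close>)
          also have "\<dots> \<le> \<epsilon> / 2 * norm (E.cell t i v)"
            using t by (intro mult_right_mono) auto
          finally show "norm (?A (E.cell t i v)) \<le> \<epsilon> / 2 * norm (E.cell t i v)" .
        qed (use \<epsilon> in simp)
        also have "\<dots> \<le> \<epsilon> / 2 * norm v"
          using \<epsilon> projection_norm_le[OF projection_e] by (intro mult_left_mono) auto
        finally show "norm (?A v) \<le> \<epsilon> / 2 * norm v"
          using x(1) by (simp add: blinfun.diff_left E.riemann_e)
      qed (use \<epsilon> in simp)
      then show ?thesis using \<epsilon> by simp
    qed
    then show "\<exists>d>0. \<forall>n t s. E.fine_tagged d n t s \<longrightarrow> norm (x - E.riemann n t s (\<lambda>t. t)) < \<epsilon>"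
      using \<epsilon> by (intro exI[of _ "\<epsilon> / 2"]) auto
  qed
  then show ?thesis using res EN by blast
qed

lemma sa_part_iff: "x \<in> sa_part N \<longleftrightarrow> x \<in> N \<and> sym_op x"
  using is_adjoint_self_iff N_bounded_ops by (auto simp: sa_part_def)

lemma spectral_family:
  assumes "x \<in> sa_part N"
  shows "resolution_of_identity e (spectral_family e x)"
    and "has_spectral_integral e (spectral_family e x) (\<lambda>t. t) x"
    and "spectral_family e x t \<in> N"
proof -
  obtain E where "resolution_of_identity e E" "has_spectral_integral e E (\<lambda>t. t) x" "\<forall>t. E t \<in> N"
    using spectral_theorem assms unfolding sa_part_iff by blast
  moreover from this have "spectral_family e x = E" by (intro spectral_family_eqI)
  ultimately show "resolution_of_identity e (spectral_family e x)"
    "has_spectral_integral e (spectral_family e x) (\<lambda>t. t) x" "spectral_family e x t \<in> N"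
    by auto
qed

end

section \<open>Form bounds and a criterion for strong convergence\<close>

context resolution
begin

lemma form_upper:
  assumes x: "has_spectral_integral e E (\<lambda>t. t) x" and w: "E t w = w"
  shows "x w \<bullet> w \<le> t * (w \<bullet> w)"
proof -
  obtain p q where p: "E p = 0" "p < t" by (rule obtain_zero_top)
  have "norm (x w - p *\<^sub>R w) \<le> (t - p) * norm w"
    by (rule spectral_integral_bound[OF x w, where p = p]) (use p in auto)
  then have "norm (x w - p *\<^sub>R w) * norm w \<le> (t - p) * norm w * norm w"
    by (rule mult_right_mono) simp
  then have "(x w - p *\<^sub>R w) \<bullet> w \<le> (t - p) * (w \<bullet> w)"
    using norm_cauchy_schwarz[of "x w - p *\<^sub>R w" w]
    by (simp add: power2_norm_eq_inner[symmetric] power2_eq_square mult.assoc)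
  then show ?thesis by (simp add: inner_diff_left left_diff_distrib)
qed

lemma norm_above:
  assumes x: "has_spectral_integral e E (\<lambda>t. t) x" and w: "E t w = 0" "e w = w" 
    and b: "E b = e" "t \<le> b"
  shows "norm (x w - b *\<^sub>R w) \<le> (b - t) * norm w"
  by (rule spectral_integral_bound[OF x _ w(1) b(2)]) (use b w in auto)

lemma form_lower:
  assumes x: "has_spectral_integral e E (\<lambda>t. t) x" and w: "E t w = 0" "e w = w"
  shows "t * (w \<bullet> w) \<le> x w \<bullet> w"
proof -
  obtain a b where b: "E b = e" "t < b" by (rule obtain_zero_top)
  have "norm (b *\<^sub>R w - x w) * norm w \<le> (b - t) * norm w * norm w"
    using norm_above[OF x w, of b] b by (intro mult_right_mono) (auto simp: norm_minus_commute)
  then have "(b *\<^sub>R w - x w) \<bullet> w \<le> (b - t) * (w \<bullet> w)"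
    using norm_cauchy_schwarz[of "b *\<^sub>R w - x w" w]
    by (simp add: power2_norm_eq_inner[symmetric] power2_eq_square mult.assoc)
  then show ?thesis by (simp add: inner_diff_left left_diff_distrib)
qed

lemma norm_lower:
  assumes x: "has_spectral_integral e E (\<lambda>t. t) x" and w: "E t w = 0" "e w = w"
  shows "(t + d) * norm w \<le> norm (x w + d *\<^sub>R w)"
proof -
  obtain a b where b: "E b = e" "max t (-d) < b" by (rule obtain_zero_top)
  have "norm (x w - b *\<^sub>R w) \<le> (b - t) * norm w"
    by (rule norm_above[OF x w]) (use b in auto)
  moreover have "norm ((b + d) *\<^sub>R w) \<le> norm (x w + d *\<^sub>R w) + norm (x w - b *\<^sub>R w)"
    using norm_triangle_ineq4[of "x w + d *\<^sub>R w" "x w - b *\<^sub>R w"] by (simp add: algebra_simps)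
  moreover have "norm ((b + d) *\<^sub>R w) = (b + d) * norm w" using b by simp
  ultimately show ?thesis by (simp add: algebra_simps)
qed

text \<open>Local control on the ranges of \<open>E t - E s\<close> with an error of order \<open>t -
  s\<close> suffices. For \<open>n\<close> cells of length \<open>h = (\<beta> - \<alpha>)/n\<close> the
  errors add up to \<open>3h\<close> times the sum of the norms of the orthogonal components \<open>V
  i\<close> of \<open>v\<close>, which is at most \<open>n\<^sup>1\<^sup>/\<^sup>2
  \<parallel>v\<parallel>\<close> by Cauchy-Schwarz. The product \<open>h n\<^sup>1\<^sup>/\<^sup>2\<close>
  tends to \<open>0\<close>.\<close>

lemma strong_convergence_criterion:
  fixes D :: "'i \<Rightarrow> ('h \<Rightarrow>\<^sub>L 'h)"
  assumes c: "has_spectral_integral e E (\<lambda>t. t) c" and \<alpha>: "E \<alpha> = 0"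
    and De: "eventually (\<lambda>i. \<forall>v. D i (e v) = D i v) F"
    and loc: "\<And>s t v \<eta>. \<alpha> \<le> s \<Longrightarrow> s < t \<Longrightarrow> E t v = v \<Longrightarrow> E s v = 0 \<Longrightarrow> \<eta> > 0 \<Longrightarrow>
       eventually (\<lambda>i. norm (D i v - s *\<^sub>R v) \<le> 2 * (t - s) * norm v + \<eta>) F"
  shows "((\<lambda>i. D i v) \<longlongrightarrow> c v) F"
proof (rule tendstoI)
  fix \<epsilon> :: real assume \<epsilon>: "\<epsilon> > 0"
  obtain a \<beta> where \<beta>: "E \<beta> = e" "\<alpha> < \<beta>" by (rule obtain_zero_top)
  \<comment> \<open>This choice makes \<open>3 (\<beta> - \<alpha>) \<parallel>v\<parallel> /
    n\<^sup>1\<^sup>/\<^sup>2\<close> smaller than \<open>\<epsilon> / 2\<close>; the other half of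
    \<open>\<epsilon>\<close> is shared by the errors \<open>\<eta>\<close> of the \<open>n\<close>
    cells.\<close>
  obtain n :: nat where n: "(6 * (\<beta> - \<alpha>) * norm v / \<epsilon>)\<^sup>2 < real n"
    using reals_Archimedean2 by blast
  have n0: "n > 0" using n by (cases n) (auto simp: not_less)
  define t where "t = uniform_part \<alpha> \<beta> n"
  define h where "h = (\<beta> - \<alpha>) / real n"
  define V where "V i = cell t i v" for i
  define \<eta> where "\<eta> = \<epsilon> / (2 * real n)"
  have h: "h > 0" using \<beta> n0 by (simp add: h_def)
  have \<eta>: "\<eta> > 0" using \<epsilon> n0 by (simp add: \<eta>_def)
  have adm: "admissible n t"
    unfolding t_def using \<alpha> \<beta> n0 by (intro admissible_uniform_part) auto
  have step: "t (Suc i) - t i = h" for i by (simp add: t_def h_def uniform_part_step)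
  then have le: "t i \<le> t (Suc i)" "t i < t (Suc i)" for i using h by (smt (verit))+
  have ti: "\<alpha> \<le> t i" for i
    using \<beta> n0 by (simp add: t_def uniform_part_def)
  have V: "E (t (Suc i)) (V i) = V i" "E (t i) (V i) = 0" for i
    unfolding V_def using le by (auto intro: E_cell_upper E_cell_lower)
  have cV: "norm (c (V i) - t i *\<^sub>R V i) \<le> h * norm (V i)" for i
    by (rule spectral_integral_bound[OF c V]) (use le step[of i] in auto)
  have ev: "e v = (\<Sum>i<n. V i)" using sum_cell[OF adm] by (simp add: V_def)
  have "(\<Sum>i<n. norm (V i) * 1)\<^sup>2 \<le> (\<Sum>i<n. (norm (V i))\<^sup>2) * (\<Sum>i<n. 1\<^sup>2)"
    by (rule Cauchy_Schwarz_ineq_sum)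
  then have "(\<Sum>i<n. norm (V i))\<^sup>2 \<le> (norm (e v))\<^sup>2 * real n"
    using sum_norm_cell[OF adm, of v] by (simp add: V_def)
  also have "\<dots> \<le> (norm v)\<^sup>2 * real n"
    using projection_norm_le[OF proj_e] by (intro mult_right_mono power_mono) auto
  also have "\<dots> = (norm v * sqrt (real n))\<^sup>2" by (simp add: power_mult_distrib)
  finally have sumV: "(\<Sum>i<n. norm (V i)) \<le> norm v * sqrt (real n)"
    by (rule power2_le_imp_le) simp
  have small: "3 * h * (\<Sum>i<n. norm (V i)) < \<epsilon> / 2"
  proof -
    have "3 * h * (\<Sum>i<n. norm (V i)) \<le> 3 * h * (norm v * sqrt (real n))"
      using sumV h by (intro mult_left_mono) auto
    also have "\<dots> = 3 * (\<beta> - \<alpha>) * norm v / sqrt (real n)"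
    proof -
      define r where "r = sqrt (real n)"
      have r: "r > 0" "real n = r * r" using n0 by (auto simp: r_def)
      show ?thesis
        unfolding h_def r_def[symmetric] r(2) using r(1) by (simp add: field_simps)
    qed
    also have "\<dots> < \<epsilon> / 2"
    proof -
      have "6 * (\<beta> - \<alpha>) * norm v / \<epsilon> < sqrt (real n)"
        using n by (rule real_less_rsqrt)
      then show ?thesis using \<epsilon> n0 by (simp add: field_simps)
    qed
    finally show ?thesis .
  qed
  have "eventually (\<lambda>i. \<forall>k\<in>{..<n}. norm (D i (V k) - t k *\<^sub>R V k) \<le> 2 * h * norm (V k) + \<eta>) F"
    using loc[OF ti le(2) V \<eta>] by (intro eventually_ball_finite) (auto simp: step)
  then show "eventually (\<lambda>i. dist (D i v) (c v) < \<epsilon>) F"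
    using De
  proof eventually_elim
    fix i assume D: "\<forall>k\<in>{..<n}. norm (D i (V k) - t k *\<^sub>R V k) \<le> 2 * h * norm (V k) + \<eta>"
      and De: "\<forall>v. D i (e v) = D i v"
    have "D i v = (\<Sum>k<n. D i (V k))" using De ev by (metis blinfun.sum_right)
    moreover have "c v = (\<Sum>k<n. c (V k))" 
      using spectral_integral_e[OF c] ev by (metis blinfun.sum_right)
    ultimately have "norm (D i v - c v) \<le> (\<Sum>k<n. norm (D i (V k) - c (V k)))"
      by (simp add: norm_sum flip: sum_subtractf)
    also have "\<dots> \<le> (\<Sum>k<n. 3 * h * norm (V k) + \<eta>)"
    proof (rule sum_mono)
      fix k assume "k \<in> {..<n}"
      then have "norm (D i (V k) - t k *\<^sub>R V k) \<le> 2 * h * norm (V k) + \<eta>" using D by blast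
      then show "norm (D i (V k) - c (V k)) \<le> 3 * h * norm (V k) + \<eta>"
        using cV[of k] norm_triangle_ineq4[of "D i (V k) - t k *\<^sub>R V k" "c (V k) - t k *\<^sub>R V k"]
        by simp
    qed
    also have "\<dots> = 3 * h * (\<Sum>k<n. norm (V k)) + real n * \<eta>"
      by (simp add: sum.distrib sum_distrib_left)
    also have "\<dots> < \<epsilon>" using small n0 by (simp add: \<eta>_def)
    finally show "dist (D i v) (c v) < \<epsilon>" by (simp add: dist_norm)
  qed
qed

end

lemma null_space_subspace:
  fixes f :: "'i \<Rightarrow> ('h::real_normed_vector \<Rightarrow>\<^sub>L 'h)"
  shows "subspace {v. ((\<lambda>i. f i v) \<longlongrightarrow> 0) F}"
  by (auto simp: subspace_def blinfun.zero_right blinfun.add_right blinfun.scaleR_right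
      intro: tendsto_add_zero bounded_linear.tendsto_zero[OF bounded_linear_scaleR_right])

lemma null_space_closed:
  fixes f :: "'i \<Rightarrow> ('h::real_normed_vector \<Rightarrow>\<^sub>L 'h)"
  assumes "eventually (\<lambda>i. \<forall>v. norm (f i v) \<le> norm v) F"
  shows "closed {v. ((\<lambda>i. f i v) \<longlongrightarrow> 0) F}"
proof -
  let ?Z = "{v. ((\<lambda>i. f i v) \<longlongrightarrow> 0) F}"
  have "v \<in> ?Z" if cl: "v \<in> closure ?Z" for v
  proof (rule CollectI, rule tendstoI)
    fix \<epsilon> :: real assume \<epsilon>: "\<epsilon> > 0"
    then have "\<epsilon> / 2 > 0" by simp
    then obtain w where w: "((\<lambda>i. f i w) \<longlongrightarrow> 0) F" "dist w v < \<epsilon> / 2"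
      using cl unfolding closure_approachable by blast
    have "eventually (\<lambda>i. dist (f i w) 0 < \<epsilon> / 2) F"
      using \<epsilon> by (intro tendstoD[OF w(1)]) simp
    then show "eventually (\<lambda>i. dist (f i v) 0 < \<epsilon>) F"
      using assms
    proof eventually_elim
      fix i assume i: "dist (f i w) 0 < \<epsilon> / 2" "\<forall>v. norm (f i v) \<le> norm v"
      have "norm (f i v) \<le> norm (f i w) + norm (f i (v - w))"
        using norm_triangle_ineq[of "f i w" "f i (v - w)"] by (simp add: blinfun.diff_right)
      also have "norm (f i (v - w)) \<le> norm (v - w)" using i(2) by blast
      finally show "dist (f i v) 0 < \<epsilon>"
        using i(1) w(2) by (simp add: dist_norm norm_minus_commute)
    qed
  qed
  then show ?thesis by (metis closure_subset_eq subsetI)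
qed

section \<open>Infima in the spectral order\<close>

context vn_algebra
begin

abbreviation sf :: "('h \<Rightarrow>\<^sub>L 'h) \<Rightarrow> real \<Rightarrow> ('h \<Rightarrow>\<^sub>L 'h)" where
  "sf \<equiv> spectral_family e"

lemma sf_resolution: "x \<in> sa_part N \<Longrightarrow> resolution e (sf x)"
  by (rule resolution.intro) (rule spectral_family)

lemma spectral_le_iff:
  assumes "x \<in> sa_part N" "y \<in> sa_part N"
  shows "spectral_le e x y \<longleftrightarrow> (\<forall>t v. sf x t (sf y t v) = sf y t v)"
  using assms sf_resolution[THEN resolution.proj] by (simp add: spectral_le_def op_le_projection)

text \<open>The range of the spectral projection at \<open>t\<close> of the infimum of \<open>X\<close>. For
  fixed \<open>s\<close>, the condition on \<open>w\<close> says that \<open>v\<close> lies in the closed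
  linear span of the ranges of the \<open>sf x s\<close>, here expressed as a double orthogonal complement so
  that closedness is immediate; intersecting over \<open>s > t\<close> makes the family
  right-continuous.\<close>

definition inf_range :: "('h \<Rightarrow>\<^sub>L 'h) set \<Rightarrow> real \<Rightarrow> 'h set" where
  "inf_range X t = {v. e v = v \<and> (\<forall>s>t. \<forall>w. e w = w \<longrightarrow> (\<forall>x\<in>X. sf x s w = 0) \<longrightarrow> v \<bullet> w = 0)}"

lemma inf_range_projection:
  assumes X: "X \<subseteq> sa_part N"
  shows "\<exists>P. projection P \<and> (\<forall>v. P v = v \<longleftrightarrow> v \<in> inf_range X t)"
proof (rule ex_projection_onto)
  show "subspace (inf_range X t)"
    by (auto simp: inf_range_def subspace_def blinfun.zero_right blinfun.add_right
        blinfun.scaleR_right inner_add_left)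
  show "closed (inf_range X t)"
    unfolding inf_range_def
    by (intro closed_Collect_conj closed_Collect_all closed_Collect_imp closed_Collect_eq
        continuous_intros) auto
  fix c v assume v: "v \<in> inf_range X t"
  have "(c *\<^sub>C v) \<bullet> w = 0" if "s > t" "e w = w" "\<forall>x\<in>X. sf x s w = 0" for s w
  proof -
    have "sf x s (cnj c *\<^sub>C w) = 0" if x: "x \<in> X" for x
    proof -
      have "sf x s (cnj c *\<^sub>C w) = cnj c *\<^sub>C sf x s w"
        using N_bounded_ops[OF spectral_family(3)] X x by (intro bounded_opsD) auto
      also have "\<dots> = 0" using \<open>\<forall>x\<in>X. sf x s w = 0\<close> x scaleC_zero_right[of "cnj c"] by simp
      finally show ?thesis .
    qed
    moreover have "e (cnj c *\<^sub>C w) = cnj c *\<^sub>C w"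
      using that(2) N_bounded_ops[OF e_in_N] by (simp add: bounded_opsD)
    ultimately have "v \<bullet> (cnj c *\<^sub>C w) = 0" using v that(1) unfolding inf_range_def by blast
    then show ?thesis by (simp add: inner_scaleC_left)
  qed
  moreover have "e (c *\<^sub>C v) = c *\<^sub>C v"
    using v N_bounded_ops[OF e_in_N] by (simp add: bounded_opsD inf_range_def)
  ultimately show "c *\<^sub>C v \<in> inf_range X t" by (simp add: inf_range_def)
qed

lemma inf_range_mono: "X \<subseteq> Y \<Longrightarrow> s \<le> t \<Longrightarrow> inf_range X s \<subseteq> inf_range Y t"
  unfolding inf_range_def using le_less_trans by blast

lemma sf_in_inf_range:
  assumes X: "X \<subseteq> sa_part N" and x: "x \<in> X"
  shows "sf x t v \<in> inf_range X t"
proof -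
  interpret resolution e "sf x" using sf_resolution X x by blast
  have "sf x t v \<bullet> w = 0" if "s > t" "\<forall>x\<in>X. sf x s w = 0" for s w
  proof -
    have "sf x t w = 0" using down[of t s w] that x by (simp add: blinfun.zero_right)
    then show ?thesis using sym[of t v w] by simp
  qed
  then show ?thesis by (auto simp: inf_range_def)
qed

text \<open>A lower bound \<open>l\<close> satisfies \<open>sf x s \<le> sf l s\<close> for every
  \<open>x\<close>, so the component of \<open>v\<close> outside the range of \<open>sf l s\<close> is
  annihilated by every \<open>sf x s\<close>, hence orthogonal to \<open>v\<close> and therefore zero. Letting
  \<open>s\<close> decrease to \<open>t\<close> gives the claim.\<close>

lemma inf_range_greatest:
  assumes X: "X \<subseteq> sa_part N" and l: "l \<in> sa_part N" "\<And>x. x \<in> X \<Longrightarrow> spectral_le e l x"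
    and v: "v \<in> inf_range X t"
  shows "sf l t v = v"
proof -
  interpret resolution e "sf l" using sf_resolution l(1) by blast
  show ?thesis
  proof (rule fixed_right)
    fix s assume s: "s > t"
    define w where "w = v - sf l s v"
    have ev: "e v = v" using v by (simp add: inf_range_def)
    have "sf x s w = 0" if x: "x \<in> X" for x
    proof -
      have "sf x s (sf l s v) = sf x s v"
        using spectral_le_iff[OF l(1)] l(2)[OF x] X x sf_resolution[THEN resolution.proj]
        by (intro projection_le_commute proj) auto
      then show ?thesis by (simp add: w_def blinfun.diff_right)
    qed
    moreover have "e w = w" using ev by (simp add: w_def blinfun.diff_right)
    ultimately have "v \<bullet> w = 0" using v s unfolding inf_range_def by blast
    then have "w \<bullet> w = - (sf l s v \<bullet> w)" by (simp add: w_def inner_diff_left)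
    also have "sf l s v \<bullet> w = v \<bullet> sf l s w" by (rule sym)
    also have "sf l s w = 0" by (simp add: w_def blinfun.diff_right)
    finally show "sf l s v = v" by (simp add: w_def)
  qed
qed

text \<open>This recovers the span from the double orthogonal complement: a vector orthogonal to a closed
  subspace \<open>W\<close> that contains the ranges of the \<open>sf x \<mu>\<close> is annihilated by these
  projections. It is applied to subspaces of vectors along which a family of operators tends to zero.\<close>

lemma inf_range_subset:
  assumes X: "X \<subseteq> sa_part N" and W: "subspace W" "closed W" "\<And>v. v - e v \<in> W"
    and sfW: "\<And>x v. x \<in> X \<Longrightarrow> sf x \<mu> v \<in> W" and "t < \<mu>" and v: "v \<in> inf_range X t"
  shows "v \<in> W"
proof -
  obtain u where u: "u \<in> W" "\<And>w. w \<in> W \<Longrightarrow> (v - u) \<bullet> w = 0"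
    using closed_subspace_nearest_point[OF W(1,2)] by blast
  define z where "z = v - u"
  have "(z - e z) \<bullet> (z - e z) = z \<bullet> (z - e z) - z \<bullet> e (z - e z)"
    by (simp add: inner_diff_left e_inner)
  also have "\<dots> = 0"
    using u(2)[OF W(3), of z] e_in_N by (simp add: z_def[symmetric] blinfun.diff_right)
  finally have ez: "e z = z" by simp
  have "sf x \<mu> z = 0" if x: "x \<in> X" for x
  proof -
    interpret resolution e "sf x" using sf_resolution X x by blast
    have "sf x \<mu> z \<bullet> sf x \<mu> z = z \<bullet> sf x \<mu> z" by (simp add: sym)
    also have "\<dots> = 0" using u(2)[OF sfW[OF x]] by (simp add: z_def)
    finally show ?thesis by simp
  qed
  then have "v \<bullet> z = 0" using v ez \<open>t < \<mu>\<close> unfolding inf_range_def by blast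
  moreover have "u \<bullet> z = 0" using u(2)[OF u(1)] by (simp add: z_def inner_commute)
  ultimately have "z \<bullet> z = 0" by (simp add: z_def inner_diff_left)
  then show ?thesis using u(1) by (simp add: z_def)
qed

definition is_infimum :: "('h \<Rightarrow>\<^sub>L 'h) set \<Rightarrow> (real \<Rightarrow> ('h \<Rightarrow>\<^sub>L 'h)) \<Rightarrow> ('h \<Rightarrow>\<^sub>L 'h) \<Rightarrow> bool" where
  "is_infimum X G c \<longleftrightarrow> resolution_of_identity e G \<and> has_spectral_integral e G (\<lambda>t. t) c
     \<and> (\<forall>t v. G t v = v \<longleftrightarrow> v \<in> inf_range X t)"

text \<open>The lower bound \<open>u\<close> provides a point below which the family vanishes, and any single
  element of \<open>X\<close> a point above which it is the unit.\<close>

lemma infimum_exists: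
  assumes X: "X \<subseteq> sa_part N" "X \<noteq> {}" and u: "u \<in> sa_part N" "\<And>x. x \<in> X \<Longrightarrow> spectral_le e u x"
  shows "\<exists>G c. is_infimum X G c"
proof -
  obtain G where P: "\<And>t. projection (G t)" and G: "\<And>t v. G t v = v \<longleftrightarrow> v \<in> inf_range X t"
    using inf_range_projection[OF X(1)] by metis
  interpret u: resolution e "sf u" using sf_resolution u(1) by blast
  obtain x where x: "x \<in> X" using X(2) by blast
  interpret x: resolution e "sf x" using sf_resolution X(1) x by blast
  obtain a b' where a: "sf u a = 0" by (rule u.obtain_zero_top)
  obtain a' b where b: "sf x b = e" by (rule x.obtain_zero_top)
  have ranG: "G t v \<in> inf_range X t" for t v
    using G projection_idem[OF P] by blast
  have res: "resolution_of_identity e G"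
  proof (rule resolution_of_identityI[OF P])
    fix s t v assume "(s::real) \<le> t"
    then show "G t (G s v) = G s v"
      using ranG inf_range_mono G by blast
  next
    fix t v assume v: "\<And>s. t < s \<Longrightarrow> G s v = v"
    have "v \<bullet> w = 0" if "t < s" "e w = w" "\<forall>x\<in>X. sf x s w = 0" for s w
    proof -
      have "v \<in> inf_range X ((t + s) / 2)"
        using v[of "(t + s) / 2"] G that by simp
      moreover have "(t + s) / 2 < s" using that by simp
      ultimately show ?thesis using that unfolding inf_range_def by blast
    qed
    moreover have "e v = v" using v[of "t + 1"] G by (simp add: inf_range_def)
    ultimately show "G t v = v" using G by (simp add: inf_range_def)
  next
    fix t assume t: "t < a"
    show "G t = 0"
    proof (rule blinfun_eqI)
      fix v
      have "sf u t (G t v) = G t v"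
        by (rule inf_range_greatest[OF X(1) u ranG])
      moreover have "sf u t = 0" using u.E_0[OF a, of t] t by simp
      ultimately show "G t v = (0 :: 'h \<Rightarrow>\<^sub>L 'h) v" by simp
    qed
  next
    fix t assume t: "b \<le> t"
    show "G t = e"
    proof (rule projection_eqI[OF P projection_e])
      fix v
      show "G t v = v \<longleftrightarrow> e v = v"
      proof
        assume "e v = v"
        then have "sf x t v = v" using x.E_top[OF b t] by simp
        then show "G t v = v" using sf_in_inf_range[OF X(1) x, of t v] G by simp
      qed (use G in \<open>auto simp: inf_range_def\<close>)
    qed
  qed
  interpret resolution e G by unfold_locales (rule res)
  obtain a1 b1 where "G a1 = 0" "G b1 = e" by (rule obtain_zero_top)
  then have "\<exists>c. has_spectral_integral e G (\<lambda>t. t) c"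
    by (intro spectral_integral_exists[of "a1 - 1" "b1 + 1" _ a1 b1]) (auto intro: continuous_intros)
  then show ?thesis using res G unfolding is_infimum_def by blast
qed

end

section \<open>Inverses, powers and roots of positive invertible elements\<close>

context vn_algebra
begin

lemma norm_e_le: "norm e \<le> 1"
  by (rule norm_blinfun_bound) (use projection_norm_le[OF projection_e] in auto)

text \<open>The Neumann series \<open>1 + r + r\<^sup>2 + \<dots>\<close>, summed in norm and relative to the
  unit \<open>e\<close>.\<close>

lemma neumann_inverse:
  assumes r: "r \<in> N" "norm r < 1"
  shows "\<exists>S\<in>N. \<forall>v. S (e v - r v) = e v \<and> e (S v) - r (S v) = e v"
proof -
  define P where "P = op_power e r"
  have PN: "P k \<in> N" for k unfolding P_def by (rule op_power_in_N[OF r(1)])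
  have PS: "P (Suc k) v = r (P k v)" for k v by (simp add: P_def op_power_Suc)
  have Pr: "P k (r v) = r (P k v)" for k v
    unfolding P_def by (rule op_power_commute[OF r(1,1) refl, symmetric])
  have P0: "P 0 = e" by (simp add: P_def op_power_0)
  have "norm (P k) \<le> norm r ^ k" for k
  proof (induction k)
    case (Suc k)
    have "P (Suc k) = r o\<^sub>L P k" by (rule blinfun_eqI) (simp add: PS)
    then have "norm (P (Suc k)) \<le> norm r * norm (P k)" by (simp add: norm_blinfun_compose)
    also have "\<dots> \<le> norm r * norm r ^ k" using Suc by (intro mult_left_mono) auto
    finally show ?case by simp
  qed (simp add: P0 norm_e_le)
  moreover have "summable (\<lambda>k. norm r ^ k)" using r(2) by (intro summable_geometric) simp
  ultimately have sP: "summable P" by (metis summable_comparison_test')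
  define S where "S = suminf P"
  have lim: "(\<lambda>m. \<Sum>k<m. P k) \<longlonglongrightarrow> S"
    unfolding S_def by (rule summable_LIMSEQ[OF sP])
  have limv: "(\<lambda>m. \<Sum>k<m. P k v) \<longlonglongrightarrow> S v" for v
    using blinfun.tendsto[OF lim tendsto_const[of v]] by (simp add: blinfun.sum_left)
  have "(\<Sum>k<m. P k) \<in> N" for m
    by (rule N_sum) (rule PN)
  then have SN: "S \<in> N"
    using closed_sequentially[OF N_closed _ lim] by blast
  have left: "S (e v - r v) = e v" for v
  proof -
    have "(\<Sum>k<m. P k (e v - r v)) = e v - P m v" for m
      using sum_lessThan_telescope'[of "\<lambda>k. P k v" m] PN
      by (simp add: blinfun.diff_right Pr PS P0)
    moreover have "(\<lambda>m. P m v) \<longlonglongrightarrow> 0"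
      using blinfun.tendsto[OF summable_LIMSEQ_zero[OF sP] tendsto_const[of v]] by simp
    then have "(\<lambda>m. e v - P m v) \<longlonglongrightarrow> e v - 0"
      by (intro tendsto_diff tendsto_const)
    ultimately have "(\<lambda>m. \<Sum>k<m. P k (e v - r v)) \<longlonglongrightarrow> e v" by simp
    then show ?thesis using limv LIMSEQ_unique by blast
  qed
  have "S (r v) = r (S v)" for v
  proof -
    have "(\<lambda>m. r (\<Sum>k<m. P k v)) \<longlonglongrightarrow> r (S v)"
      using limv by (intro blinfun.tendsto[OF tendsto_const])
    then have "(\<lambda>m. \<Sum>k<m. P k (r v)) \<longlonglongrightarrow> r (S v)"
      by (simp add: blinfun.sum_right Pr)
    then show ?thesis using limv LIMSEQ_unique by blast
  qed
  then have "e (S v) - r (S v) = e v" for v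
    using left[of v] SN by (simp add: blinfun.diff_right)
  then show ?thesis using left SN by blast
qed

lemma inverse_inI:
  fixes c :: "'h \<Rightarrow>\<^sub>L 'h"
  assumes S: "S \<in> N" "\<And>v. S (c v) = e v" "\<And>v. c (S v) = e v"
  shows "inverse_in N e c = S"
  unfolding inverse_in_def
proof (rule the_equality)
  show "S \<in> N \<and> S o\<^sub>L c = e \<and> c o\<^sub>L S = e"
    using S by (auto intro: blinfun_eqI)
  fix T assume T: "T \<in> N \<and> T o\<^sub>L c = e \<and> c o\<^sub>L T = e"
  have "T v = S v" for v
  proof -
    have Tc: "T (c w) = e w" for w using T by (metis blinfun_apply_blinfun_compose)
    have "T v = T (e v)" using T by simp
    also have "\<dots> = T (c (S v))" by (simp add: S(3))
    also have "\<dots> = S v" by (simp add: Tc S(1))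
    finally show ?thesis .
  qed
  then show "T = S" by (intro blinfun_eqI)
qed

end

text \<open>A self-adjoint \<open>x\<close> for which \<open>x + \<delta>1\<close> is positive and bounded
  away from zero, the latter expressed by a point \<open>\<alpha> > -\<delta>\<close> at which the spectral
  family of \<open>x\<close> still vanishes.\<close>

locale positive_shift = vn_algebra N e
  for N :: "('h::complex_hilbert \<Rightarrow>\<^sub>L 'h) set" and e +
  fixes x :: "'h \<Rightarrow>\<^sub>L 'h" and \<delta> \<alpha> :: real
  assumes x: "x \<in> sa_part N" and \<alpha>: "spectral_family e x \<alpha> = 0" "- \<delta> < \<alpha>"
begin

sublocale E: resolution e "sf x"
  by (rule sf_resolution[OF x])

lemmas x_integral = spectral_family(2)[OF x]

lemma x_in_N: "x \<in> N" and x_sym: "sym_op x"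
  using x by (auto simp: sa_part_iff)

definition c :: "'h \<Rightarrow>\<^sub>L 'h" where
  "c = x + \<delta> *\<^sub>R e"

definition a :: "'h \<Rightarrow>\<^sub>L 'h" where
  "a = inverse_in N e (x + \<delta> *\<^sub>R e)"

lemma c_apply: "c v = x v + \<delta> *\<^sub>R e v"
  by (simp add: c_def blinfun.add_left blinfun.scaleR_left)

lemma c_in_N: "c \<in> N"
  unfolding c_def by (intro N_add N_scaleR x_in_N e_in_N)

lemma c_sym: "c v \<bullet> w = v \<bullet> c w"
  by (simp add: c_apply inner_add_left inner_add_right e_inner sym_opD[OF x_sym])

lemma c_sf: "c (sf x t v) = sf x t (c v)"
  by (simp add: c_apply blinfun.add_right blinfun.scaleR_right E.spectral_integral_commute[OF x_integral])

lemma norm_c_le: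
  assumes "sf x \<mu> w = w" "- \<delta> \<le> \<mu>"
  shows "norm (c w) \<le> (\<mu> + \<delta>) * norm w"
proof -
  have "norm (x w - (- \<delta>) *\<^sub>R w) \<le> (\<mu> + \<delta>) * norm w"
    by (rule E.spectral_integral_bound[OF x_integral assms(1) _ assms(2)])
      (use E.E_0[OF \<alpha>(1), of "- \<delta>"] \<alpha>(2) in auto)
  moreover have "e w = w" using assms(1) by (metis E.e_E)
  ultimately show ?thesis by (simp add: c_apply)
qed

lemma norm_c_ge:
  assumes "sf x \<nu> w = 0" "e w = w"
  shows "(\<nu> + \<delta>) * norm w \<le> norm (c w)"
  using E.norm_lower[OF x_integral assms, of \<delta>] assms(2) by (simp add: c_apply)

lemma c_pos: "0 \<le> c v \<bullet> v"
proof -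
  have "\<alpha> * (e v \<bullet> e v) \<le> x (e v) \<bullet> e v"
    by (rule E.form_lower[OF x_integral]) (simp_all add: \<alpha> e_in_N)
  moreover have "c v \<bullet> v = x (e v) \<bullet> e v + \<delta> * (e v \<bullet> e v)"
    using e_inner[of "x v" v] x_in_N by (simp add: c_apply inner_add_left e_inner_e)
  moreover have "0 \<le> (\<alpha> + \<delta>) * (e v \<bullet> e v)" using \<alpha>(2) by simp
  ultimately show ?thesis by (simp add: distrib_right)
qed

text \<open>The spectrum of \<open>c\<close> lies between \<open>\<alpha> + \<delta> > 0\<close> and
  \<open>\<kappa> = b + \<delta>\<close>, so \<open>1 - c/\<kappa>\<close> has norm less than \<open>1\<close>
  and the Neumann series inverts \<open>c/\<kappa>\<close>.\<close>

lemma inverse_properties: "a \<in> N \<and> (\<forall>v. a (c v) = e v) \<and> (\<forall>v. c (a v) = e v)"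
proof -
  obtain a0 b where b: "sf x b = e" "max \<alpha> 0 < b" by (rule E.obtain_zero_top)
  define \<kappa> where "\<kappa> = b + \<delta>"
  have \<kappa>: "\<kappa> > 0" "b - \<alpha> < \<kappa>" using b \<alpha> by (auto simp: \<kappa>_def)
  define r where "r = e - (1 / \<kappa>) *\<^sub>R c"
  have rv: "r v = e v - (1 / \<kappa>) *\<^sub>R c v" for v
    by (simp add: r_def blinfun.diff_left blinfun.scaleR_left)
  have rN: "r \<in> N" unfolding r_def by (intro N_diff e_in_N N_scaleR c_in_N)
  have "norm r \<le> (b - \<alpha>) / \<kappa>"
  proof (rule norm_blinfun_bound)
    fix v
    have "norm (x (e v) - b *\<^sub>R e v) \<le> (b - \<alpha>) * norm (e v)"
      by (rule E.norm_above[OF x_integral]) (use b \<alpha> e_in_N in auto)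
    also have "\<dots> \<le> (b - \<alpha>) * norm v"
      using b projection_norm_le[OF projection_e] by (intro mult_left_mono) auto
    finally have "norm (x (e v) - b *\<^sub>R e v) \<le> (b - \<alpha>) * norm v" .
    moreover have "r v = - ((1 / \<kappa>) *\<^sub>R (x (e v) - b *\<^sub>R e v))"
    proof -
      have "\<kappa> *\<^sub>R r v = - (x (e v) - b *\<^sub>R e v)"
        using \<kappa>(1) x_in_N by (simp add: rv c_apply scaleR_diff_right) (simp add: \<kappa>_def algebra_simps)
      then show ?thesis using \<kappa>(1)
        by (metis (no_types, lifting) divide_inverse mult_1 order_less_irrefl scaleR_minus_right
            scaleR_one scaleR_scaleR left_inverse)
    qed
    ultimately show "norm (r v) \<le> (b - \<alpha>) / \<kappa> * norm v"
      using \<kappa>(1) by (simp add: divide_right_mono)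
  qed (use b \<kappa> in simp)
  also have "\<dots> < 1" using \<kappa> by simp
  finally obtain S where S: "S \<in> N" "\<And>v. S (e v - r v) = e v" "\<And>v. e (S v) - r (S v) = e v"
    using neumann_inverse[OF rN] by blast
  have er: "e v - r v = (1 / \<kappa>) *\<^sub>R c v" for v by (simp add: rv)
  have cv: "c v = \<kappa> *\<^sub>R (e v - r v)" for v using \<kappa>(1) by (simp add: er)
  define T where "T = (1 / \<kappa>) *\<^sub>R S"
  have Tv: "T v = (1 / \<kappa>) *\<^sub>R S v" for v by (simp add: T_def blinfun.scaleR_left)
  have T: "T \<in> N" "T (c v) = e v" "c (T v) = e v" for v
  proof -
    show "T \<in> N" unfolding T_def using S by (simp add: N_scaleR)
    show "T (c v) = e v" using S(2)[of v] \<kappa>(1) by (simp add: Tv cv blinfun.scaleR_right)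
    show "c (T v) = e v"
      using S(3)[of v] \<kappa>(1) by (simp add: Tv blinfun.scaleR_right[of c]) (simp add: cv)
  qed
  have "a = T" unfolding a_def c_def[symmetric] by (rule inverse_inI[OF T])
  then show ?thesis using T by simp
qed

lemma a_in_N: "a \<in> N" and a_c: "a (c v) = e v" and c_a: "c (a v) = e v"
  using inverse_properties by auto

lemma a_sym: "sym_op a"
  unfolding sym_op_def
proof (intro allI)
  fix v w
  have "a v \<bullet> w = a v \<bullet> c (a w)"
    using e_inner[of "a v" w] a_in_N by (simp add: c_a)
  also have "\<dots> = c (a v) \<bullet> a w" by (rule c_sym[symmetric])
  also have "\<dots> = e v \<bullet> a w" by (simp add: c_a)
  also have "\<dots> = v \<bullet> a w" using e_inner[of v "a w"] a_in_N by simp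
  finally show "a v \<bullet> w = v \<bullet> a w" .
qed

lemma a_pos: "0 \<le> a v \<bullet> v"
proof -
  have "a v \<bullet> v = a v \<bullet> c (a v)"
    using e_inner[of "a v" v] a_in_N by (simp add: c_a)
  then show ?thesis using c_pos[of "a v"] by (simp add: inner_commute)
qed

lemma a_sf: "a (sf x t v) = sf x t (a v)"
proof -
  have "a (sf x t v) = a (sf x t (c (a v)))" by (simp add: c_a)
  also have "\<dots> = a (c (sf x t (a v)))" by (simp add: c_sf)
  also have "\<dots> = sf x t (a v)" by (simp add: a_c)
  finally show ?thesis .
qed

abbreviation apow :: "nat \<Rightarrow> ('h \<Rightarrow>\<^sub>L 'h)" where "apow \<equiv> op_power e a"
abbreviation cpow :: "nat \<Rightarrow> ('h \<Rightarrow>\<^sub>L 'h)" where "cpow \<equiv> op_power e c"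

lemma apow_in_N: "apow n \<in> N"
  by (rule op_power_in_N[OF a_in_N])

lemma apow_sym: "sym_op (apow n)"
  by (rule op_power_sym[OF a_in_N a_sym])

lemma apow_cpow: "apow n (cpow n v) = e v"
proof (induction n arbitrary: v)
  case 0
  show ?case using projection_idem[OF projection_e] by (simp add: op_power_0)
next
  case (Suc n)
  have "apow (Suc n) (cpow (Suc n) v) = apow n (a (c (cpow n v)))"
    using op_power_commute[OF a_in_N a_in_N] by (simp add: op_power_Suc)
  also have "\<dots> = e v"
    using Suc op_power_in_N[OF c_in_N] apow_in_N by (simp add: a_c)
  finally show ?case .
qed

lemma apow_pos: "0 \<le> apow n v \<bullet> v"
proof (induction n arbitrary: v rule: induct_nat_012)
  case 0
  then show ?case using e_inner_e[of v v] by (metis inner_ge_zero op_power_0)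
next
  case 1
  then show ?case using a_pos a_in_N by (simp add: op_power_Suc op_power_0)
next
  case (ge2 n)
  have "apow (Suc (Suc n)) v \<bullet> v = a (apow n (a v)) \<bullet> v"
    using op_power_commute[OF a_in_N a_in_N] by (simp add: op_power_Suc)
  also have "\<dots> = apow n (a v) \<bullet> a v" by (rule sym_opD[OF a_sym])
  finally show ?case using ge2(1) by simp
qed

lemma norm_apow_le:
  assumes "sf x \<nu> v = 0" "e v = v" "- \<delta> < \<nu>"
  shows "norm (apow n v) \<le> inverse (\<nu> + \<delta>) ^ n * norm v"
proof (induction n)
  case (Suc n)
  let ?w = "apow n v"
  have "sf x \<nu> ?w = ?w - ?w" 
    using op_power_commute[OF spectral_family(3)[OF x] a_in_N a_sf[symmetric], of \<nu> n v] assms(1)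
    by (simp add: blinfun.zero_right)
  then have "sf x \<nu> (a ?w) = 0" by (simp flip: a_sf add: blinfun.zero_right)
  moreover have "e (a ?w) = a ?w" using a_in_N by simp
  ultimately have "(\<nu> + \<delta>) * norm (a ?w) \<le> norm (c (a ?w))" by (rule norm_c_ge)
  also have "c (a ?w) = ?w" using apow_in_N by (simp add: c_a)
  finally have "norm (a ?w) \<le> inverse (\<nu> + \<delta>) * norm ?w"
    using assms(3) by (simp add: field_simps)
  also have "\<dots> \<le> inverse (\<nu> + \<delta>) * (inverse (\<nu> + \<delta>) ^ n * norm v)"
    using Suc assms(3) by (intro mult_left_mono) auto
  finally show ?case by (simp add: op_power_Suc)
qed (simp add: op_power_0 assms)

lemma norm_cpow_le:
  assumes "sf x \<mu> v = v" "- \<delta> \<le> \<mu>"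
  shows "norm (cpow n v) \<le> (\<mu> + \<delta>) ^ n * norm v"
proof (induction n)
  case 0
  show ?case using assms(1) by (metis E.e_E mult_1 op_power_0 order_refl power_0)
next
  case (Suc n)
  have "sf x \<mu> (cpow n v) = cpow n v"
    using op_power_commute[OF spectral_family(3)[OF x] c_in_N c_sf[symmetric], of \<mu> n v] assms(1)
    by simp
  then have "norm (c (cpow n v)) \<le> (\<mu> + \<delta>) * norm (cpow n v)"
    using assms(2) by (rule norm_c_le)
  also have "\<dots> \<le> (\<mu> + \<delta>) * ((\<mu> + \<delta>) ^ n * norm v)"
    using Suc assms(2) by (intro mult_left_mono) auto
  finally show ?case by (simp add: op_power_Suc)
qed

text \<open>Since \<open>v = c\<^sup>-\<^sup>n (c\<^sup>n v)\<close>, the Cauchy-Schwarz inequality for the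
  positive form of \<open>c\<^sup>-\<^sup>n\<close> applies to the pair \<open>w\<close>, \<open>c\<^sup>n
  v\<close>. The second factor is the form of \<open>c\<^sup>n\<close> at \<open>v\<close>, which is
  controlled because \<open>c \<le> \<mu> + \<delta>\<close> on the range of \<open>sf x
  \<mu>\<close>.\<close>

lemma inner_apow_estimate:
  assumes v: "sf x \<mu> v = v" "- \<delta> \<le> \<mu>"
  shows "(w \<bullet> v)\<^sup>2 \<le> (apow n w \<bullet> w) * ((\<mu> + \<delta>) ^ n * (v \<bullet> v))"
proof -
  have ev: "e v = v" using v(1) by (metis E.e_E)
  have "w \<bullet> v = apow n w \<bullet> cpow n v"
    using sym_opD[OF apow_sym, of n w "cpow n v"] by (simp add: apow_cpow ev)
  then have "(w \<bullet> v)\<^sup>2 \<le> (apow n w \<bullet> w) * (apow n (cpow n v) \<bullet> cpow n v)"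
    using positive_cauchy_schwarz[OF apow_sym apow_pos, of n w "cpow n v"] by simp
  also have "\<dots> \<le> (apow n w \<bullet> w) * ((\<mu> + \<delta>) ^ n * (v \<bullet> v))"
  proof (rule mult_left_mono[OF _ apow_pos])
    have "apow n (cpow n v) \<bullet> cpow n v \<le> norm v * norm (cpow n v)"
      using norm_cauchy_schwarz[of v "cpow n v"] by (simp add: apow_cpow ev)
    also have "\<dots> \<le> norm v * ((\<mu> + \<delta>) ^ n * norm v)"
      by (intro mult_left_mono norm_cpow_le v) simp
    finally show "apow n (cpow n v) \<bullet> cpow n v \<le> (\<mu> + \<delta>) ^ n * (v \<bullet> v)"
      by (simp add: power2_norm_eq_inner[symmetric] power2_eq_square mult_ac)
  qed
  finally show ?thesis .
qed

end

lemma inverse_power_powr: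
  assumes "p > 0" "n > 0"
  shows "(inverse p ^ n) powr (- 1 / real n) = p"
proof -
  have "(inverse p ^ n) powr (- 1 / real n) = (inverse p powr real n) powr (- 1 / real n)"
    using assms by (simp add: powr_realpow)
  also have "\<dots> = inverse p powr (- 1)"
    using assms by (simp add: powr_powr)
  also have "\<dots> = p" using assms by (simp add: powr_minus)
  finally show ?thesis .
qed

context vn_algebra
begin

lemma fun_calc_root:
  assumes B: "B \<in> sa_part N" and \<beta>: "sf B \<beta> = 0" "\<beta> > 0" 
  shows "has_spectral_integral e (sf B) (\<lambda>t. t powr (- 1 / real n))
    (fun_calc e (\<lambda>t. t powr (- 1 / real n)) B)"
proof -
  interpret resolution e "sf B" by (rule sf_resolution[OF B])
  obtain a b where b: "sf B b = e" "\<beta> < b" by (rule obtain_zero_top)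
  have "continuous_on {\<beta> / 2..b + 1} (\<lambda>t. t powr (- 1 / real n))"
    using \<beta>(2) by (intro continuous_intros) auto
  then obtain T where T: "has_spectral_integral e (sf B) (\<lambda>t. t powr (- 1 / real n)) T"
    using spectral_integral_exists[OF _ \<beta>(1) b(1), of "\<beta> / 2" "b + 1" "\<lambda>t. t powr (- 1 / real n)"] \<beta>(2)
    by auto
  then have "fun_calc e (\<lambda>t. t powr (- 1 / real n)) B = T"
    by (rule fun_calc_eqI[OF spectral_family(1,2)[OF B]])
  then show ?thesis using T by simp
qed

lemma spectral_integral_in_N:
  assumes B: "B \<in> sa_part N" and T: "has_spectral_integral e (sf B) f T"
  shows "T \<in> N"
proof -
  interpret resolution e "sf B" by (rule sf_resolution[OF B])
  show ?thesis
    by (rule spectral_integral_closed[OF T N_closed])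
      (auto simp: riemann_def cell_def intro!: N_sum N_scaleR N_diff spectral_family(3)[OF B])
qed

text \<open>The function \<open>t \<mapsto> t\<^sup>-\<^sup>1\<^sup>/\<^sup>n\<close> maps the interval from
  \<open>q\<^sup>-\<^sup>n\<close> to \<open>p\<^sup>-\<^sup>n\<close> onto the one from \<open>p\<close> to
  \<open>q\<close>. So the root is close to a scalar on the range of a difference of spectral projections of
  \<open>B\<close> itself.\<close>

lemma fun_calc_root_near:
  assumes B: "B \<in> sa_part N" and \<beta>: "sf B \<beta> = 0" "\<beta> > 0" and n: "n > 0"
    and pq: "0 < p" "p \<le> s" "s \<le> q"
    and w: "sf B (inverse p ^ n) w = w" "sf B (inverse q ^ n) w = 0"
  shows "norm (fun_calc e (\<lambda>t. t powr (- 1 / real n)) B w - s *\<^sub>R w) \<le> (q - p) * norm w"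
proof -
  interpret resolution e "sf B" by (rule sf_resolution[OF B])
  show ?thesis
  proof (rule spectral_integral_bound[OF fun_calc_root[OF B \<beta>] w])
    show "inverse q ^ n \<le> inverse p ^ n"
      using pq by (intro power_mono le_imp_inverse_le) auto
    fix r assume r: "inverse q ^ n \<le> r" "r \<le> inverse p ^ n"
    have q0: "q > 0" using pq by linarith
    then have r0: "r > 0" using r(1) by (meson less_le_trans positive_imp_inverse_positive zero_less_power)
    have "r powr (- 1 / real n) \<le> (inverse q ^ n) powr (- 1 / real n)"
      using r q0 by (intro powr_mono2') auto
    moreover have "(inverse p ^ n) powr (- 1 / real n) \<le> r powr (- 1 / real n)"
      using r r0 by (intro powr_mono2') auto
    ultimately have "p \<le> r powr (- 1 / real n)" "r powr (- 1 / real n) \<le> q"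
      using inverse_power_powr[OF _ n] pq(1) q0 by auto
    then show "\<bar>r powr (- 1 / real n) - s\<bar> \<le> q - p" using pq by linarith
  qed
qed

lemma fun_calc_root_norm_le:
  assumes B: "B \<in> sa_part N" and L: "L > 0" "sf B (inverse L ^ n) = 0" and n: "n > 0"
  shows "norm (fun_calc e (\<lambda>t. t powr (- 1 / real n)) B v) \<le> L * norm v"
proof -
  interpret resolution e "sf B" by (rule sf_resolution[OF B])
  let ?T = "fun_calc e (\<lambda>t. t powr (- 1 / real n)) B"
  have T: "has_spectral_integral e (sf B) (\<lambda>t. t powr (- 1 / real n)) ?T"
    using L by (intro fun_calc_root[OF B L(2)]) simp
  obtain a b where b: "sf B b = e" "inverse L ^ n < b" by (rule obtain_zero_top)
  have "norm (?T (e v) - 0 *\<^sub>R e v) \<le> L * norm (e v)"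
  proof (rule spectral_integral_bound[OF T])
    show "sf B b (e v) = e v" using b by (metis E_e)
    show "sf B (inverse L ^ n) (e v) = 0" using L by simp
    show "inverse L ^ n \<le> b" using b by simp
    fix r assume r: "inverse L ^ n \<le> r"
    have "r powr (- 1 / real n) \<le> (inverse L ^ n) powr (- 1 / real n)"
      using r L by (intro powr_mono2') auto
    then show "\<bar>r powr (- 1 / real n) - 0\<bar> \<le> L"
      using inverse_power_powr[OF L(1) n] by simp
  qed
  also have "\<dots> \<le> L * norm v"
    using L projection_norm_le[OF projection_e] by (intro mult_left_mono) auto
  finally show ?thesis using spectral_integral_e[OF T, of v] by simp
qed

end

section \<open>Strong limits of power means and of finite infima\<close>

context vn_algebra
begin

definition power_sum :: "real \<Rightarrow> ('h \<Rightarrow>\<^sub>L 'h) set \<Rightarrow> nat \<Rightarrow> ('h \<Rightarrow>\<^sub>L 'h)" where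
  "power_sum \<delta> F n = (\<Sum>x\<in>F. op_power e (inverse_in N e (x + \<delta> *\<^sub>R e)) n)"

context
  fixes F :: "('h \<Rightarrow>\<^sub>L 'h) set" and \<delta> \<alpha> :: real
  assumes F: "finite F" "F \<noteq> {}" "F \<subseteq> sa_part N"
    and \<alpha>: "\<And>x. x \<in> F \<Longrightarrow> sf x \<alpha> = 0" "- \<delta> < \<alpha>"
begin

lemma positive_shift_member: "x \<in> F \<Longrightarrow> positive_shift N e x \<delta> \<alpha>"
  using F \<alpha> by (intro positive_shift.intro positive_shift_axioms.intro vn_algebra_axioms) auto

abbreviation A :: "('h \<Rightarrow>\<^sub>L 'h) \<Rightarrow> nat \<Rightarrow> ('h \<Rightarrow>\<^sub>L 'h)" where
  "A x n \<equiv> op_power e (inverse_in N e (x + \<delta> *\<^sub>R e)) n"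

abbreviation B :: "nat \<Rightarrow> ('h \<Rightarrow>\<^sub>L 'h)" where
  "B n \<equiv> power_sum \<delta> F n"

abbreviation pmean :: "nat \<Rightarrow> ('h \<Rightarrow>\<^sub>L 'h)" where
  "pmean n \<equiv> fun_calc e (\<lambda>t. t powr (- 1 / real n)) (B n)"

lemma power_sum_apply: "B n v = (\<Sum>x\<in>F. A x n v)"
  by (simp add: power_sum_def blinfun.sum_left)

lemma power_sum_sa: "B n \<in> sa_part N"
proof -
  have "A x n \<in> N \<and> sym_op (A x n)"
    if "x \<in> F" for x
  proof -
    interpret positive_shift N e x \<delta> \<alpha> by (rule positive_shift_member[OF that])
    show ?thesis using apow_in_N[of n] apow_sym[of n] by (simp add: a_def)
  qed
  then show ?thesis
    unfolding sa_part_iff sym_op_def power_sum_apply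
    by (auto simp: power_sum_def inner_sum_left inner_sum_right intro!: N_sum sum.cong)
qed

text \<open>The form of the power sum dominates that of each summand, so \<open>inner_apow_estimate\<close>
  applies with the form of \<open>B\<close> at \<open>y\<close>, which is at most \<open>\<theta>\<close> on
  the range of the spectral projection at \<open>\<theta>\<close>.\<close>

lemma power_sum_estimate:
  assumes xF: "x \<in> F" and v: "sf x \<mu> v = v" "- \<delta> \<le> \<mu>"
    and y: "sf (B n) \<theta> y = y"
  shows "(y \<bullet> v)\<^sup>2 \<le> \<theta> * (y \<bullet> y) * ((\<mu> + \<delta>) ^ n * (v \<bullet> v))"
proof -
  interpret S: resolution e "sf (B n)" by (rule sf_resolution[OF power_sum_sa])
  have pos: "0 \<le> A z n y \<bullet> y" if "z \<in> F" for z
  proof -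
    interpret positive_shift N e z \<delta> \<alpha> by (rule positive_shift_member[OF that])
    show ?thesis using apow_pos[of n y] by (simp add: a_def)
  qed
  interpret positive_shift N e x \<delta> \<alpha> by (rule positive_shift_member[OF xF])
  have "A x n y \<bullet> y \<le> (\<Sum>z\<in>F. A z n y \<bullet> y)"
    using F(1) xF pos by (intro member_le_sum) auto
  also have "\<dots> = B n y \<bullet> y" by (simp add: power_sum_apply inner_sum_left)
  also have "\<dots> \<le> \<theta> * (y \<bullet> y)"
    by (rule S.form_upper[OF spectral_family(2)[OF power_sum_sa] y])
  finally have "apow n y \<bullet> y \<le> \<theta> * (y \<bullet> y)" by (simp add: a_def)
  then have "(apow n y \<bullet> y) * ((\<mu> + \<delta>) ^ n * (v \<bullet> v)) \<le> \<theta> * (y \<bullet> y) * ((\<mu> + \<delta>) ^ n * (v \<bullet> v))"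
    using v(2) by (intro mult_right_mono) auto
  then show ?thesis using inner_apow_estimate[OF v, of y n] by linarith
qed

lemma power_sum_norm_le:
  assumes v: "\<And>x. x \<in> F \<Longrightarrow> sf x s v = 0" "e v = v" "- \<delta> < s"
  shows "norm (B n v) \<le> real (card F) * (inverse (s + \<delta>) ^ n * norm v)"
  unfolding power_sum_apply
proof (rule order_trans[OF norm_sum sum_bounded_above[where K = "inverse (s + \<delta>) ^ n * norm v", simplified]])
  fix x assume xF: "x \<in> F"
  interpret positive_shift N e x \<delta> \<alpha> by (rule positive_shift_member[OF xF])
  show "norm (A x n v) \<le> inverse (s + \<delta>) ^ n * norm v"
    using norm_apow_le[OF v(1)[OF xF] v(2,3), of n] by (simp add: a_def)
qed

text \<open>For one member \<open>x\<close> with \<open>c(x) \<le> b + \<delta> < L\<close>, the power sum is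
  at least \<open>c(x)\<^sup>-\<^sup>n\<close>, which exceeds \<open>L\<^sup>-\<^sup>n\<close> for positive
  \<open>n\<close>. Hence the roots are bounded by \<open>L\<close> for all \<open>n\<close>
  simultaneously.\<close>

lemma power_sum_bounded_below:
  "\<exists>L>0. \<forall>n>0. sf (B n) (inverse L ^ n) = 0"
proof -
  obtain x where xF: "x \<in> F" using F(2) by blast
  interpret positive_shift N e x \<delta> \<alpha> by (rule positive_shift_member[OF xF])
  obtain a0 b where b: "sf x b = e" "\<alpha> < b" by (rule E.obtain_zero_top)
  define L where "L = b + \<delta> + 1"
  have L: "L > 0" "0 < b + \<delta>" "b + \<delta> < L" using b \<alpha>(2) by (auto simp: L_def)
  have "sf (B n) (inverse L ^ n) = 0" if n: "n > 0" for n
  proof (rule blinfun_eqI)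
    fix v
    interpret S: resolution e "sf (B n)" by (rule sf_resolution[OF power_sum_sa])
    define y where "y = sf (B n) (inverse L ^ n) v"
    have y: "sf (B n) (inverse L ^ n) y = y" by (simp add: y_def)
    have "sf x b y = y" using b by (simp add: y_def)
    then have "(y \<bullet> y)\<^sup>2 \<le> inverse L ^ n * (y \<bullet> y) * ((b + \<delta>) ^ n * (y \<bullet> y))"
      using b \<alpha>(2) by (intro power_sum_estimate[OF xF _ _ y]) auto
    also have "\<dots> = ((b + \<delta>) / L) ^ n * (y \<bullet> y)\<^sup>2"
      by (simp add: power2_eq_square divide_inverse power_mult_distrib mult_ac)
    finally have "(1 - ((b + \<delta>) / L) ^ n) * (y \<bullet> y)\<^sup>2 \<le> 0" by (simp add: left_diff_distrib)
    moreover have "((b + \<delta>) / L) ^ n < 1"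
      using L n by (intro power_less_one_iff[THEN iffD2]) auto
    ultimately have "(y \<bullet> y)\<^sup>2 \<le> 0" by (simp add: mult_le_0_iff)
    then show "sf (B n) (inverse L ^ n) v = (0 :: 'h \<Rightarrow>\<^sub>L 'h) v"
      by (simp add: y_def)
  qed
  then show ?thesis using L by blast
qed

text \<open>On \<open>v\<close> the power sum has size at most of the order \<open>(s +
  \<delta>)\<^sup>-\<^sup>n\<close>, while it is at least \<open>(p + \<delta>)\<^sup>-\<^sup>n\<close> on the
  complement of its spectral projection at \<open>(p + \<delta>)\<^sup>-\<^sup>n\<close>. So the component
  there decays like \<open>((p + \<delta>)/(s + \<delta>))\<^sup>n\<close>.\<close>

lemma power_sum_complement_tendsto:
  assumes v: "\<And>x. x \<in> F \<Longrightarrow> sf x s v = 0" "e v = v" and p: "- \<delta> < p" "p < s"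
  shows "(\<lambda>n. v - sf (B n) (inverse (p + \<delta>) ^ n) v) \<longlonglongrightarrow> 0"
proof (rule Lim_null_comparison)
  define r where "r = (p + \<delta>) / (s + \<delta>)"
  have r: "0 \<le> r" "r < 1" using p by (auto simp: r_def)
  show "(\<lambda>n. r ^ n * (real (card F) * norm v)) \<longlonglongrightarrow> 0"
    using LIMSEQ_power_zero[of r] r tendsto_mult_left_zero by fastforce
  show "\<forall>\<^sub>F n in sequentially. norm (v - sf (B n) (inverse (p + \<delta>) ^ n) v)
      \<le> r ^ n * (real (card F) * norm v)"
  proof (rule always_eventually, rule allI)
    fix n
    let ?\<theta> = "inverse (p + \<delta>) ^ n"
    interpret S: resolution e "sf (B n)" by (rule sf_resolution[OF power_sum_sa])
    note int = spectral_family(2)[OF power_sum_sa, of n]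
    define y where "y = v - sf (B n) ?\<theta> v"
    have y: "sf (B n) ?\<theta> y = 0" "e y = y" using v(2) by (simp_all add: y_def blinfun.diff_right)
    have "?\<theta> * norm y \<le> norm (B n y)" using S.norm_lower[OF int y, of 0] by simp
    also have "B n y = B n v - sf (B n) ?\<theta> (B n v)"
      by (simp add: y_def blinfun.diff_right S.spectral_integral_commute[OF int])
    also have "norm \<dots> \<le> norm (B n v)"
      using projection_pythagoras[OF S.proj, of "B n v" ?\<theta>]
      by (intro power2_le_imp_le[OF _ norm_ge_zero]) simp
    also have "\<dots> \<le> real (card F) * (inverse (s + \<delta>) ^ n * norm v)"
      using p by (intro power_sum_norm_le v) auto
    finally have "(p + \<delta>) ^ n * (?\<theta> * norm y) \<le> (p + \<delta>) ^ n * (real (card F) * (inverse (s + \<delta>) ^ n * norm v))"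
      using p by (intro mult_left_mono) auto
    moreover have "(p + \<delta>) ^ n * (?\<theta> * norm y) = norm y"
      using p by (simp flip: mult.assoc power_mult_distrib)
    moreover have "(p + \<delta>) ^ n * (real (card F) * (inverse (s + \<delta>) ^ n * norm v))
        = r ^ n * (real (card F) * norm v)"
      by (simp add: r_def divide_inverse power_mult_distrib mult_ac)
    ultimately have "norm y \<le> r ^ n * (real (card F) * norm v)" by (simp only:)
    then show "norm (v - sf (B n) ?\<theta> v) \<le> r ^ n * (real (card F) * norm v)"
      by (simp only: y_def)
  qed
qed

text \<open>The vectors along which these projections tend to zero form a closed subspace, so by
  \<open>inf_range_subset\<close> it is enough to treat \<open>v\<close> in the range of one \<open>sf x
  \<mu>\<close> with \<open>t < \<mu> < q\<close>. For such \<open>v\<close>,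
  \<open>power_sum_estimate\<close> with \<open>y\<close> the projection of \<open>v\<close> bounds the
  squared norm of \<open>y\<close> by a multiple of \<open>((\<mu> + \<delta>)/(q +
  \<delta>))\<^sup>n\<close>.\<close>

lemma power_sum_tendsto_zero:
  assumes v: "v \<in> inf_range F t" and q: "t < q" "- \<delta> < q"
  shows "(\<lambda>n. sf (B n) (inverse (q + \<delta>) ^ n) v) \<longlonglongrightarrow> 0"
proof -
  define W where "W = {v. (\<lambda>n. sf (B n) (inverse (q + \<delta>) ^ n) v) \<longlonglongrightarrow> 0}"
  define \<mu> where "\<mu> = (max t (- \<delta>) + q) / 2"
  have \<mu>: "t < \<mu>" "- \<delta> \<le> \<mu>" "\<mu> < q" using q by (auto simp: \<mu>_def max_def field_simps)
  have res: "resolution e (sf (B n))" for n by (rule sf_resolution[OF power_sum_sa])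
  have "v \<in> W"
  proof (rule inf_range_subset[OF F(3) _ _ _ _ \<mu>(1) v])
    show "subspace W" unfolding W_def by (rule null_space_subspace)
    show "closed W" unfolding W_def
      using projection_norm_le[OF resolution.proj[OF res]] by (intro null_space_closed always_eventually) blast
    show "v - e v \<in> W" for v
      by (simp add: W_def blinfun.diff_right resolution.E_e[OF res])
    fix x v assume xF: "x \<in> F"
    interpret positive_shift N e x \<delta> \<alpha> by (rule positive_shift_member[OF xF])
    define v' where "v' = sf x \<mu> v"
    have v': "sf x \<mu> v' = v'" by (simp add: v'_def)
    define r where "r = (\<mu> + \<delta>) / (q + \<delta>)"
    have r: "0 \<le> r" "r < 1" using \<mu> by (auto simp: r_def)
    have "(\<lambda>n. sf (B n) (inverse (q + \<delta>) ^ n) v') \<longlonglongrightarrow> 0"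
    proof (rule Lim_null_comparison)
      show "(\<lambda>n. sqrt (r ^ n * (v' \<bullet> v'))) \<longlonglongrightarrow> 0"
      proof -
        have "(\<lambda>n. r ^ n * (v' \<bullet> v')) \<longlonglongrightarrow> 0"
          using LIMSEQ_power_zero[of r] r tendsto_mult_left_zero by fastforce
        then have "(\<lambda>n. sqrt (r ^ n * (v' \<bullet> v'))) \<longlonglongrightarrow> sqrt 0"
          by (rule tendsto_real_sqrt)
        then show ?thesis by simp
      qed
      show "\<forall>\<^sub>F n in sequentially. norm (sf (B n) (inverse (q + \<delta>) ^ n) v')
          \<le> sqrt (r ^ n * (v' \<bullet> v'))"
      proof (rule always_eventually, rule allI)
        fix n
        interpret S: resolution e "sf (B n)" by (rule res)
        define y where "y = sf (B n) (inverse (q + \<delta>) ^ n) v'"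
        have y: "sf (B n) (inverse (q + \<delta>) ^ n) y = y" by (simp add: y_def)
        have "y \<bullet> v' = y \<bullet> y"
          unfolding y_def using projection_inner[OF S.proj] by metis
        then have "(y \<bullet> y)\<^sup>2 \<le> inverse (q + \<delta>) ^ n * (y \<bullet> y) * ((\<mu> + \<delta>) ^ n * (v' \<bullet> v'))"
          using power_sum_estimate[OF xF v' \<mu>(2) y] by simp
        also have "\<dots> = (y \<bullet> y) * (r ^ n * (v' \<bullet> v'))"
          by (simp add: r_def divide_inverse power_mult_distrib mult_ac)
        finally have "y \<bullet> y \<le> r ^ n * (v' \<bullet> v')"
        proof (cases "y = 0")
          case False
          assume "(y \<bullet> y)\<^sup>2 \<le> (y \<bullet> y) * (r ^ n * (v' \<bullet> v'))"
          then show ?thesis using False by (simp add: power2_eq_square)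
        qed (use r in simp)
        then show "norm (sf (B n) (inverse (q + \<delta>) ^ n) v') \<le> sqrt (r ^ n * (v' \<bullet> v'))"
          by (simp add: norm_eq_sqrt_inner flip: y_def)
      qed
    qed
    then show "sf x \<mu> v \<in> W"
      by (simp add: W_def v'_def)
  qed
  then show ?thesis by (simp add: W_def)
qed

lemma root_bounded:
  "\<exists>L>0. \<forall>n>0. sf (B n) (inverse L ^ n) = 0 \<and> pmean n \<in> N \<and> (\<forall>v. norm (pmean n v) \<le> L * norm v)"
proof -
  obtain L where L: "L > 0" "\<And>n. n > 0 \<Longrightarrow> sf (B n) (inverse L ^ n) = 0"
    using power_sum_bounded_below by blast
  have "pmean n \<in> N" if "n > 0" for n
    by (rule spectral_integral_in_N[OF power_sum_sa fun_calc_root[OF power_sum_sa L(2)[OF that]]])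
      (use L(1) in simp)
  then show ?thesis
    using L fun_calc_root_norm_le[OF power_sum_sa L(1) L(2)] by blast
qed

text \<open>The criterion is applied to the roots shifted by \<open>-\<delta>\<close>. Given \<open>v\<close>
  in the range of \<open>G t - G s\<close>, the interval is widened slightly to \<open>p < s < t < q\<close>;
  by \<open>power_sum_complement_tendsto\<close> and \<open>power_sum_tendsto_zero\<close>, \<open>v\<close>
  is asymptotically equal to its component \<open>w n\<close> where the power sum lies between \<open>(q +
  \<delta>)\<^sup>-\<^sup>n\<close> and \<open>(p + \<delta>)\<^sup>-\<^sup>n\<close>, and there the root is
  within \<open>q - p\<close> of \<open>s + \<delta>\<close>.\<close>

lemma root_tendsto_infimum:
  assumes inf: "is_infimum F G c" and G\<alpha>: "G \<alpha> = 0"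
  shows "(\<lambda>n. pmean n v) \<longlonglongrightarrow> c v + \<delta> *\<^sub>R e v"
proof -
  have resG: "resolution_of_identity e G" and c: "has_spectral_integral e G (\<lambda>t. t) c"
    and ranG: "\<And>t v. G t v = v \<longleftrightarrow> v \<in> inf_range F t"
    using inf by (auto simp: is_infimum_def)
  interpret G: resolution e G by unfold_locales (rule resG)
  define T where "T n = pmean n" for n
  obtain L where L: "L > 0" "\<And>n. n > 0 \<Longrightarrow> sf (B n) (inverse L ^ n) = 0"
    and TN: "\<And>n. n > 0 \<Longrightarrow> T n \<in> N" and Tle: "\<And>n v. n > 0 \<Longrightarrow> norm (T n v) \<le> L * norm v"
    using root_bounded unfolding T_def by blast
  define D where "D n = T n - \<delta> *\<^sub>R e" for n
  have Dv: "D n v = T n v - \<delta> *\<^sub>R e v" for n v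
    by (simp add: D_def blinfun.diff_left blinfun.scaleR_left)
  have "(\<lambda>n. D n v) \<longlonglongrightarrow> c v"
  proof (rule G.strong_convergence_criterion[OF c G\<alpha>])
    show "\<forall>\<^sub>F n in sequentially. \<forall>v. D n (e v) = D n v"
      using eventually_gt_at_top[of 0] by eventually_elim (simp add: Dv TN e_in_N)
    fix s t v and \<eta> :: real
    assume st: "\<alpha> \<le> s" "s < t" and v: "G t v = v" "G s v = 0" and \<eta>: "\<eta> > 0"
    have ev: "e v = v" using v(1) by (metis G.e_E)
    have vx: "sf x s v = 0" if xF: "x \<in> F" for x
    proof -
      interpret positive_shift N e x \<delta> \<alpha> by (rule positive_shift_member[OF xF])
      have "sf x s (G s v) = sf x s v"
        using sf_in_inf_range[OF F(3) xF] ranG by (intro projection_le_commute E.proj G.proj) blast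
      then show ?thesis using v(2) by (simp add: blinfun.zero_right)
    qed
    \<comment> \<open>Small enough for \<open>q - p \<le> 2 (t - s)\<close>, and for \<open>p +
      \<delta>\<close> to stay positive even when \<open>s = \<alpha>\<close>.\<close>
    define z where "z = min ((t - s) / 2) ((\<alpha> + \<delta>) / 2)"
    define p where "p = s - z"
    define q where "q = t + z"
    have z: "z > 0" "z \<le> (t - s) / 2" "z \<le> (\<alpha> + \<delta>) / 2"
      using st \<alpha>(2) min.cobounded1 min.cobounded2 by (simp add: z_def, unfold z_def, blast+)
    have pq: "- \<delta> < p" "p < s" "t < q" "- \<delta> < q" "q - p \<le> 2 * (t - s)"
      using z st \<alpha>(2) by (auto simp: p_def q_def)
    have s0: "s + \<delta> > 0" using st \<alpha>(2) by simp
    define H where "H n = sf (B n)" for n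
    have lim: "(\<lambda>n. (v - H n (inverse (p + \<delta>) ^ n) v) + H n (inverse (q + \<delta>) ^ n) v) \<longlonglongrightarrow> 0 + 0"
      unfolding H_def using v(1) ranG pq vx ev
      by (intro tendsto_add power_sum_complement_tendsto[of s] power_sum_tendsto_zero[of _ t]) auto
    define w where "w n = H n (inverse (p + \<delta>) ^ n) v - H n (inverse (q + \<delta>) ^ n) v" for n
    have "(\<lambda>n. v - w n) \<longlonglongrightarrow> 0"
      using lim by (simp add: w_def algebra_simps)
    then have "(\<lambda>n. (L + (s + \<delta>)) * norm (v - w n)) \<longlonglongrightarrow> (L + (s + \<delta>)) * norm (0 :: 'h)"
      by (intro tendsto_mult tendsto_const tendsto_norm)
    then have "\<forall>\<^sub>F n in sequentially. (L + (s + \<delta>)) * norm (v - w n) < \<eta>"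
      using \<eta> by (intro order_tendstoD) auto
    then show "\<forall>\<^sub>F n in sequentially. norm (D n v - s *\<^sub>R v) \<le> 2 * (t - s) * norm v + \<eta>"
      using eventually_gt_at_top[of 0]
    proof eventually_elim
      fix n :: nat assume small: "(L + (s + \<delta>)) * norm (v - w n) < \<eta>" and n: "0 < n"
      interpret H: resolution e "H n" unfolding H_def by (rule sf_resolution[OF power_sum_sa])
      have le: "inverse (q + \<delta>) ^ n \<le> inverse (p + \<delta>) ^ n"
        using pq st by (intro power_mono le_imp_inverse_le) auto
      have w1: "H n (inverse (p + \<delta>) ^ n) (w n) = w n" "H n (inverse (q + \<delta>) ^ n) (w n) = 0"
        using le by (simp_all add: w_def blinfun.diff_right H.up H.down)
      have "norm (T n (w n) - (s + \<delta>) *\<^sub>R w n) \<le> ((q + \<delta>) - (p + \<delta>)) * norm (w n)"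
        unfolding T_def
        by (rule fun_calc_root_near[OF power_sum_sa L(2)[OF n] _ n])
          (use w1 pq st L(1) in \<open>auto simp: H_def\<close>)
      also have "\<dots> \<le> 2 * (t - s) * norm (w n)"
        using pq by (intro mult_right_mono) auto
      also have "\<dots> \<le> 2 * (t - s) * norm v"
      proof (intro mult_left_mono)
        have "(norm (w n))\<^sup>2 \<le> (norm (H n (inverse (p + \<delta>) ^ n) v))\<^sup>2"
          using H.increment_norm[OF le, of v] by (simp add: w_def)
        then show "norm (w n) \<le> norm v"
          using H.norm_le[of "inverse (p + \<delta>) ^ n" v] by (meson order_trans power2_le_imp_le norm_ge_zero)
      qed (use st in simp)
      finally have 1: "norm (T n (w n) - (s + \<delta>) *\<^sub>R w n) \<le> 2 * (t - s) * norm v" .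
      have "norm (T n (v - w n) - (s + \<delta>) *\<^sub>R (v - w n)) \<le> L * norm (v - w n) + (s + \<delta>) * norm (v - w n)"
        using norm_triangle_ineq4[of "T n (v - w n)" "(s + \<delta>) *\<^sub>R (v - w n)"] Tle[OF n, of "v - w n"] s0
        by simp
      then have 2: "norm (T n (v - w n) - (s + \<delta>) *\<^sub>R (v - w n)) \<le> \<eta>"
        using small by (simp add: distrib_right)
      have "D n v - s *\<^sub>R v = (T n (w n) - (s + \<delta>) *\<^sub>R w n) + (T n (v - w n) - (s + \<delta>) *\<^sub>R (v - w n))"
        by (simp add: Dv ev blinfun.diff_right algebra_simps)
      then show "norm (D n v - s *\<^sub>R v) \<le> 2 * (t - s) * norm v + \<eta>"
        using 1 2 norm_triangle_ineq[of "T n (w n) - (s + \<delta>) *\<^sub>R w n" "T n (v - w n) - (s + \<delta>) *\<^sub>R (v - w n)"]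
        by simp
    qed
  qed
  then have "(\<lambda>n. D n v + \<delta> *\<^sub>R e v) \<longlonglongrightarrow> c v + \<delta> *\<^sub>R e v"
    by (intro tendsto_add tendsto_const)
  then show ?thesis by (simp add: Dv T_def)
qed

lemma root_eventually_in_N: "\<forall>\<^sub>F n in sequentially. pmean n \<in> N"
  using root_bounded by (intro eventually_sequentiallyI[of 1]) auto

end

text \<open>The spectral projections of the infimum of \<open>F\<close> lie below those of the infimum of
  \<open>M\<close>, so \<open>GF F s\<close> annihilates every \<open>v\<close> with \<open>G s v = 0\<close>.
  Conversely, \<open>GF F q v\<close> tends to \<open>v\<close> for \<open>v\<close> in the range of \<open>G
  t\<close> and \<open>q > t\<close>: this holds eventually with equality in the range of a single \<open>sf x
  \<mu>\<close>, namely once \<open>x\<close> belongs to \<open>F\<close>, and extends by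
  \<open>inf_range_subset\<close>.\<close>

lemma infima_tendsto_infimum:
  assumes M: "M \<subseteq> sa_part N" "M \<noteq> {}" and inf: "is_infimum M G c" and G\<alpha>: "G \<alpha> = 0"
    and infF: "\<And>F. finite F \<Longrightarrow> F \<noteq> {} \<Longrightarrow> F \<subseteq> M \<Longrightarrow> is_infimum F (GF F) (cF F)"
  shows "((\<lambda>F. cF F v) \<longlongrightarrow> c v) (finite_subsets_at_top M)"
proof -
  have resG: "resolution_of_identity e G" and c: "has_spectral_integral e G (\<lambda>t. t) c"
    and ranG: "\<And>t v. G t v = v \<longleftrightarrow> v \<in> inf_range M t"
    using inf by (auto simp: is_infimum_def)
  interpret G: resolution e G by unfold_locales (rule resG)
  obtain x0 where x0: "x0 \<in> M" using M(2) by blast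
  interpret x0: resolution e "sf x0" using sf_resolution M(1) x0 by blast
  obtain a0 b where b: "sf x0 b = e" "\<alpha> < b" by (rule x0.obtain_zero_top)
  have large: "\<forall>\<^sub>F F in finite_subsets_at_top M. finite F \<and> x \<in> F \<and> F \<subseteq> M" if "x \<in> M" for x
    using that unfolding eventually_finite_subsets_at_top by (intro exI[of _ "{x}"]) auto
  have res: "resolution e (GF F)" and cF: "has_spectral_integral e (GF F) (\<lambda>t. t) (cF F)"
    and ranF: "GF F t v = v \<longleftrightarrow> v \<in> inf_range F t"
    if "finite F" "x \<in> F" "F \<subseteq> M" for F x t v
    using infF[of F] that by (auto simp: is_infimum_def resolution_def)
  define C where "C = max \<bar>\<alpha>\<bar> \<bar>b\<bar>"
  have sub: "G t (GF F t v) = GF F t v" if F: "finite F" "x \<in> F" "F \<subseteq> M" for F x t v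
  proof -
    interpret F: resolution e "GF F" by (rule res[OF F])
    have "GF F t v \<in> inf_range F t" using ranF[OF F, of t "GF F t v"] by simp
    then show ?thesis using ranG inf_range_mono[OF F(3) order_refl] by blast
  qed
  have bound: "norm (cF F v) \<le> C * norm v" if F: "finite F" "x0 \<in> F" "F \<subseteq> M" for F v
  proof -
    interpret F: resolution e "GF F" by (rule res[OF F])
    have top: "GF F b (e v) = e v"
      using sf_in_inf_range[of F x0 b "e v"] ranF[OF F, of b "e v"] F M(1) b projection_idem[OF projection_e]
      by auto
    have zero: "GF F \<alpha> (e v) = 0"
      using sub[OF F, of \<alpha> "e v"] G\<alpha> by simp
    have "norm (cF F (e v) - 0 *\<^sub>R e v) \<le> C * norm (e v)"
      by (rule F.spectral_integral_bound[OF cF[OF F] top zero]) (use b in \<open>auto simp: C_def\<close>)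
    also have "\<dots> \<le> C * norm v"
      using projection_norm_le[OF projection_e] by (intro mult_left_mono) (auto simp: C_def)
    finally show ?thesis by (simp add: F.spectral_integral_e[OF cF[OF F]])
  qed
  show ?thesis
  proof (rule G.strong_convergence_criterion[OF c G\<alpha>])
    show "\<forall>\<^sub>F F in finite_subsets_at_top M. \<forall>v. cF F (e v) = cF F v"
      using large[OF x0] 
      by eventually_elim (use resolution.spectral_integral_e res cF in blast)
    fix s t v and \<eta> :: real
    assume st: "\<alpha> \<le> s" "s < t" and v: "G t v = v" "G s v = 0" and \<eta>: "\<eta> > 0"
    have ev: "e v = v" using v(1) by (metis G.e_E)
    define q where "q = (s + t) / 2 + (t - s)"
    define \<mu> where "\<mu> = (t + q) / 2"
    have q: "t < \<mu>" "\<mu> < q" "q - s \<le> 2 * (t - s)" "s < q" using st by (auto simp: q_def \<mu>_def field_simps)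
    define W where "W = {v. ((\<lambda>F. (e - GF F q) v) \<longlongrightarrow> 0) (finite_subsets_at_top M)}"
    have "v \<in> W"
    proof (rule inf_range_subset[OF M(1) _ _ _ _ q(1)])
      show "v \<in> inf_range M t" using v(1) ranG by simp
      show "subspace W" unfolding W_def by (rule null_space_subspace)
      show "closed W" unfolding W_def
      proof (rule null_space_closed)
        show "\<forall>\<^sub>F F in finite_subsets_at_top M. \<forall>v. norm ((e - GF F q) v) \<le> norm v"
          using large[OF x0]
        proof eventually_elim
          fix F assume F: "finite F \<and> x0 \<in> F \<and> F \<subseteq> M"
          interpret F: resolution e "GF F" using res F by blast
          show "\<forall>v. norm ((e - GF F q) v) \<le> norm v"
          proof
            fix v
            have "(norm (e v - GF F q (e v)))\<^sup>2 \<le> (norm (e v))\<^sup>2"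
              using projection_pythagoras[OF F.proj, of "e v" q] by simp
            then have "norm (e v - GF F q (e v)) \<le> norm (e v)" by (rule power2_le_imp_le) simp
            then show "norm ((e - GF F q) v) \<le> norm v"
              using projection_norm_le[OF projection_e, of v] by (simp add: blinfun.diff_left)
          qed
        qed
      qed
      show "v - e v \<in> W" for v
      proof -
        have "\<forall>\<^sub>F F in finite_subsets_at_top M. (e - GF F q) (v - e v) = 0"
          using large[OF x0]
        proof eventually_elim
          fix F assume F: "finite F \<and> x0 \<in> F \<and> F \<subseteq> M"
          interpret F: resolution e "GF F" using res F by blast
          show "(e - GF F q) (v - e v) = 0"
            by (simp add: blinfun.diff_left blinfun.diff_right e_in_N)
        qed
        then show ?thesis unfolding W_def by (simp add: tendsto_eventually)
      qed
      fix x v assume x: "x \<in> M"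
      have "\<forall>\<^sub>F F in finite_subsets_at_top M. (e - GF F q) (sf x \<mu> v) = 0"
        using large[OF x]
      proof eventually_elim
        fix F assume F: "finite F \<and> x \<in> F \<and> F \<subseteq> M"
        interpret x: resolution e "sf x" using sf_resolution M(1) x by blast
        have "sf x \<mu> v \<in> inf_range F q"
          using sf_in_inf_range[of F x \<mu> v] F M(1) inf_range_mono[OF order_refl[of F], of \<mu> q] q by auto
        then have "GF F q (sf x \<mu> v) = sf x \<mu> v" using ranF F by blast
        then show "(e - GF F q) (sf x \<mu> v) = 0" by (simp add: blinfun.diff_left)
      qed
      then show "sf x \<mu> v \<in> W" unfolding W_def by (simp add: tendsto_eventually)
    qed
    then have "((\<lambda>F. (C + \<bar>s\<bar>) * norm ((e - GF F q) v)) \<longlongrightarrow> (C + \<bar>s\<bar>) * norm (0 :: 'h)) (finite_subsets_at_top M)"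
      unfolding W_def by (intro tendsto_mult tendsto_const tendsto_norm) simp
    then have "\<forall>\<^sub>F F in finite_subsets_at_top M. (C + \<bar>s\<bar>) * norm ((e - GF F q) v) < \<eta>"
      using \<eta> by (intro order_tendstoD) auto
    then show "\<forall>\<^sub>F F in finite_subsets_at_top M. norm (cF F v - s *\<^sub>R v) \<le> 2 * (t - s) * norm v + \<eta>"
      using large[OF x0]
    proof eventually_elim
      fix F assume small: "(C + \<bar>s\<bar>) * norm ((e - GF F q) v) < \<eta>" and "finite F \<and> x0 \<in> F \<and> F \<subseteq> M"
      then have F: "finite F" "x0 \<in> F" "F \<subseteq> M" by auto
      interpret F: resolution e "GF F" by (rule res[OF F])
      define w where "w = GF F q v"
      have "GF F s v = GF F s (G s v)"
        using projection_le_commute[OF F.proj G.proj sub[OF F]] by simp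
      then have "GF F s v = 0" using v(2) by (simp add: blinfun.zero_right)
      then have w: "GF F q w = w" "GF F s w = 0"
        using F.down[of s q v] q by (simp_all add: w_def)
      have "norm (cF F w - s *\<^sub>R w) \<le> (q - s) * norm w"
        by (rule F.spectral_integral_bound[OF cF[OF F] w]) (use q in auto)
      also have "\<dots> \<le> 2 * (t - s) * norm v"
        using q st F.norm_le[of q v] by (intro mult_mono) (auto simp: w_def)
      finally have 1: "norm (cF F w - s *\<^sub>R w) \<le> 2 * (t - s) * norm v" .
      have vw: "(e - GF F q) v = v - w" by (simp add: w_def blinfun.diff_left ev)
      have "norm (cF F (v - w) - s *\<^sub>R (v - w)) \<le> C * norm (v - w) + \<bar>s\<bar> * norm (v - w)"
        using norm_triangle_ineq4[of "cF F (v - w)" "s *\<^sub>R (v - w)"] bound[OF F, of "v - w"] by simp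
      then have 2: "norm (cF F (v - w) - s *\<^sub>R (v - w)) \<le> \<eta>"
        using small by (simp add: vw distrib_right)
      have "cF F v - s *\<^sub>R v = (cF F w - s *\<^sub>R w) + (cF F (v - w) - s *\<^sub>R (v - w))"
        by (simp add: blinfun.diff_right algebra_simps)
      then show "norm (cF F v - s *\<^sub>R v) \<le> 2 * (t - s) * norm v + \<eta>"
        using 1 2 norm_triangle_ineq[of "cF F w - s *\<^sub>R w" "cF F (v - w) - s *\<^sub>R (v - w)"] by simp
    qed
  qed
qed

text \<open>Positivity makes the spectral family vanish below \<open>-\<delta>\<close>. On the range of the
  projection at \<open>-\<delta> + \<tau>\<close> the operator \<open>u + \<delta>1\<close> is then of size at
  most \<open>2\<tau>\<close>. For small \<open>\<tau>\<close> this contradicts the lower bound given by the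
  inverse \<open>S\<close>, unless the range is zero.\<close>

lemma positive_invertible_gap:
  assumes u: "u \<in> sa_part N" and pos: "positive_op (u + \<delta> *\<^sub>R e)" and inv: "invertible_in N e (u + \<delta> *\<^sub>R e)"
  shows "\<exists>\<alpha>>-\<delta>. sf u \<alpha> = 0"
proof -
  interpret resolution e "sf u" by (rule sf_resolution[OF u])
  let ?c = "u + \<delta> *\<^sub>R e"
  have cv: "?c v = u v + \<delta> *\<^sub>R e v" for v by (simp add: blinfun.add_left blinfun.scaleR_left)
  obtain S where S: "S o\<^sub>L ?c = e" using inv by (auto simp: invertible_in_def)
  have Sc: "norm (e v) \<le> norm S * norm (?c v)" for v
    using S norm_blinfun[of S "?c v"] by (metis blinfun_apply_blinfun_compose)
  have below: "sf u p = 0" if p: "p < - \<delta>" for p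
  proof (rule blinfun_eqI)
    fix v
    let ?w = "sf u p v"
    have "u ?w \<bullet> ?w \<le> p * (?w \<bullet> ?w)"
      by (rule form_upper[OF spectral_family(2)[OF u]]) simp
    moreover have "0 \<le> ?c ?w \<bullet> ?w" by (rule positive_op_inner[OF pos])
    ultimately have "0 \<le> (p + \<delta>) * (?w \<bullet> ?w)" by (simp add: cv inner_add_left distrib_right)
    then have "?w \<bullet> ?w \<le> 0" using p by (simp add: zero_le_mult_iff)
    then have "?w = 0" by (meson inner_gt_zero_iff not_le)
    then show "?w = (0 :: 'h \<Rightarrow>\<^sub>L 'h) v" by simp
  qed
  define \<tau> where "\<tau> = 1 / (3 * (norm S + 1))"
  have "0 < norm S + 1" by (simp add: add_nonneg_pos)
  then have \<tau>: "\<tau> > 0" "norm S * (3 * \<tau>) < 1"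
    by (simp_all add: \<tau>_def divide_less_eq)
  have "sf u (- \<delta> + \<tau>) = 0"
  proof (rule blinfun_eqI)
    fix v
    define w where "w = sf u (- \<delta> + \<tau>) v"
    have w: "sf u (- \<delta> + \<tau>) w = w" "e w = w" by (simp_all add: w_def)
    have "norm (u w - (- \<delta>) *\<^sub>R w) \<le> 2 * \<tau> * norm w"
      \<comment> \<open>The lower end must be a zero of the spectral family, which is known only strictly
        below \<open>-\<delta>\<close>.\<close>
      by (rule spectral_integral_bound[OF spectral_family(2)[OF u] w(1), of "- \<delta> - \<tau>"])
        (use \<tau> below in auto)
    then have "norm (?c w) \<le> 2 * \<tau> * norm w" by (simp add: cv w)
    then have "norm S * norm (?c w) \<le> norm S * (2 * \<tau> * norm w)" by (intro mult_left_mono) auto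
    also have "\<dots> \<le> norm S * (3 * \<tau>) * norm w" using \<tau> by (simp add: mult_left_mono mult_right_mono)
    finally have "norm w \<le> norm S * (3 * \<tau>) * norm w" using Sc[of w] w(2) by simp
    then have "(1 - norm S * (3 * \<tau>)) * norm w \<le> 0" by (simp add: left_diff_distrib)
    then have "norm w \<le> 0" using \<tau>(2) by (simp add: mult_le_0_iff)
    then show "sf u (- \<delta> + \<tau>) v = (0 :: 'h \<Rightarrow>\<^sub>L 'h) v" by (simp add: w_def)
  qed
  then show ?thesis using \<tau>(1) by (intro exI[of _ "- \<delta> + \<tau>"]) simp
qed

text \<open>Antisymmetry of the spectral order, needed to identify the chosen infimum, holds because an
  operator is the integral of its spectral family.\<close>

lemma is_infimum_greatest:
  assumes M: "M \<subseteq> sa_part N" and inf: "is_infimum M G c" and cN: "c \<in> N"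
  shows "greatest (spectral_poset N e) c (Lower (spectral_poset N e) M)"
    and "\<Sqinter>\<^bsub>spectral_poset N e\<^esub> M = c"
proof -
  have resG: "resolution_of_identity e G" and c: "has_spectral_integral e G (\<lambda>t. t) c"
    and ranG: "\<And>t v. G t v = v \<longleftrightarrow> v \<in> inf_range M t"
    using inf by (auto simp: is_infimum_def)
  interpret G: resolution e G by unfold_locales (rule resG)
  have csa: "c \<in> sa_part N" using cN G.spectral_integral_sym[OF c] by (simp add: sa_part_iff)
  have sfc: "sf c = G" by (rule spectral_family_eqI[OF resG c])
  have lower: "spectral_le e c x" if x: "x \<in> M" for x
  proof -
    have "G t (sf x t v) = sf x t v" for t v
      using sf_in_inf_range[OF M x] ranG by blast
    then show ?thesis using M x by (subst spectral_le_iff[OF csa]) (auto simp: sfc)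
  qed
  have greatest: "spectral_le e l c" if l: "l \<in> sa_part N" "\<And>x. x \<in> M \<Longrightarrow> spectral_le e l x" for l
  proof -
    have "G t v \<in> inf_range M t" for t v
      using ranG[of t "G t v"] by simp
    then have "sf l t (G t v) = G t v" for t v
      using inf_range_greatest[OF M l] by blast
    then show ?thesis by (simp add: spectral_le_iff[OF l(1) csa] sfc)
  qed
  have L: "Lower (spectral_poset N e) M = {l \<in> sa_part N. \<forall>x\<in>M. spectral_le e l x}"
    using M by (auto simp: Lower_def spectral_poset_def)
  have great: "greatest (spectral_poset N e) y (Lower (spectral_poset N e) M) \<longleftrightarrow>
      y \<in> sa_part N \<and> (\<forall>x\<in>M. spectral_le e y x) \<and>
      (\<forall>l\<in>sa_part N. (\<forall>x\<in>M. spectral_le e l x) \<longrightarrow> spectral_le e l y)" for y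
    unfolding greatest_def L by (auto simp: spectral_poset_def)
  show g: "greatest (spectral_poset N e) c (Lower (spectral_poset N e) M)"
    unfolding great using csa lower greatest by blast
  have "y = c" if y: "greatest (spectral_poset N e) y (Lower (spectral_poset N e) M)" for y
  proof -
    have ysa: "y \<in> sa_part N" and le: "spectral_le e y c" "spectral_le e c y"
      using y g unfolding great by auto
    interpret y: resolution e "sf y" by (rule sf_resolution[OF ysa])
    have "sf y t = sf c t" for t
    proof (rule projection_eqI[OF y.proj])
      show "projection (sf c t)" by (simp add: sfc G.proj)
      show "sf y t v = v \<longleftrightarrow> sf c t v = v" for v
        using le unfolding spectral_le_iff[OF ysa csa] spectral_le_iff[OF csa ysa] by metis
    qed
    then have "sf y = G" using sfc by auto
    then show ?thesis
      using G.spectral_integral_unique[OF _ c] spectral_family(2)[OF ysa] by simp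
  qed
  then show "\<Sqinter>\<^bsub>spectral_poset N e\<^esub> M = c"
    unfolding inf_def using g by (intro some_equality)
qed

end

section \<open>The infimum as an iterated limit of power means\<close>

theorem corollary2p7:
  fixes N M :: "('h::complex_hilbert \<Rightarrow>\<^sub>L 'h) set"
    and e u :: "'h \<Rightarrow>\<^sub>L 'h"
    and \<delta> :: real
  assumes "von_neumann_algebra N"
    and "is_unit_of e N"
    and "M \<subseteq> sa_part N" and "M \<noteq> {}"
    and "u \<in> Lower (spectral_poset N e) M"
    and "positive_op (u + \<delta> *\<^sub>R e)" and "invertible_in N e (u + \<delta> *\<^sub>R e)"
  shows "\<exists>L R.
      (\<forall>F. finite F \<and> F \<noteq> {} \<and> F \<subseteq> M \<longrightarrow>
         limitin strong_operator_topology
           (\<lambda>n. fun_calc e (\<lambda>t. t powr (- 1 / real n))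
                  (\<Sum>x\<in>F. op_power e (inverse_in N e (x + \<delta> *\<^sub>R e)) n))
           (L F) sequentially)
      \<and> limitin strong_operator_topology L R (finite_subsets_at_top M)
      \<and> greatest (spectral_poset N e) (\<Sqinter>\<^bsub>spectral_poset N e\<^esub> M) (Lower (spectral_poset N e) M)
      \<and> \<Sqinter>\<^bsub>spectral_poset N e\<^esub> M = - (\<delta> *\<^sub>R e) + R"
proof -
  interpret vn_algebra N e by unfold_locales (rule assms)+
  note M = assms(3,4)
  have u: "u \<in> sa_part N" "\<And>x. x \<in> M \<Longrightarrow> spectral_le e u x"
    using assms(5) M(1) by (auto simp: Lower_def spectral_poset_def)
  obtain \<alpha> where \<alpha>: "- \<delta> < \<alpha>" "sf u \<alpha> = 0"
    using positive_invertible_gap[OF u(1) assms(6,7)] by blast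
  have "\<exists>G c. is_infimum F G c" if "F \<noteq> {}" "F \<subseteq> M" for F
    using that M u by (intro infimum_exists[OF _ _ u(1)]) auto
  then obtain G c where inf: "\<And>F. F \<noteq> {} \<Longrightarrow> F \<subseteq> M \<Longrightarrow> is_infimum F (G F) (c F)"
    by metis
  have zero: "G F \<alpha> = 0" if F: "F \<noteq> {}" "F \<subseteq> M" for F
  proof (rule blinfun_eqI)
    fix v
    interpret G: resolution e "G F"
      using inf[OF F] by (simp add: is_infimum_def resolution_def)
    have "G F \<alpha> v \<in> inf_range F \<alpha> \<longleftrightarrow> G F \<alpha> (G F \<alpha> v) = G F \<alpha> v"
      using inf[OF F] unfolding is_infimum_def by blast
    then have "G F \<alpha> v \<in> inf_range F \<alpha>" by simp
    then have "sf u \<alpha> (G F \<alpha> v) = G F \<alpha> v"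
      using F M u by (intro inf_range_greatest[OF _ u(1)]) auto
    then show "G F \<alpha> v = (0 :: 'h \<Rightarrow>\<^sub>L 'h) v" by (simp add: \<alpha>)
  qed
  have zero_x: "sf x \<alpha> = 0" if x: "x \<in> M" for x
  proof (rule blinfun_eqI)
    fix v
    have "sf u \<alpha> (sf x \<alpha> v) = sf x \<alpha> v"
      using u(2)[OF x] spectral_le_iff[OF u(1)] x M by blast
    then show "sf x \<alpha> v = (0 :: 'h \<Rightarrow>\<^sub>L 'h) v" by (simp add: \<alpha>)
  qed
  define L where "L F = c F + \<delta> *\<^sub>R e" for F
  have Lv: "L F v = c F v + \<delta> *\<^sub>R e v" for F v
    by (simp add: L_def blinfun.add_left blinfun.scaleR_left)
  have inner: "(\<lambda>n. fun_calc e (\<lambda>t. t powr (- 1 / real n)) (power_sum \<delta> F n) v) \<longlonglongrightarrow> L F v"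
    if F: "finite F" "F \<noteq> {}" "F \<subseteq> M" for F v
    unfolding Lv
    by (rule root_tendsto_infimum[OF F(1,2) _ _ \<alpha>(1) inf[OF F(2,3)] zero[OF F(2,3)]])
      (use F M zero_x in auto)
  have LN: "L F \<in> N" if F: "finite F" "F \<noteq> {}" "F \<subseteq> M" for F
    by (rule N_strong_limit[OF inner[OF F] root_eventually_in_N[OF F(1,2) _ _ \<alpha>(1)]])
      (use F M zero_x in auto)
  have cN: "c F \<in> N" if F: "finite F" "F \<noteq> {}" "F \<subseteq> M" for F
    using N_diff[OF LN[OF F] N_scaleR[OF e_in_N, of \<delta>]] by (simp add: L_def)
  have outer: "((\<lambda>F. c F v) \<longlongrightarrow> c M v) (finite_subsets_at_top M)" for v
    by (rule infima_tendsto_infimum[OF M inf[OF M(2) order_refl] zero[OF M(2) order_refl]])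
      (use inf in auto)
  obtain x0 where x0: "x0 \<in> M" using M by blast
  have "\<forall>\<^sub>F F in finite_subsets_at_top M. c F \<in> N"
    unfolding eventually_finite_subsets_at_top using x0 cN by (intro exI[of _ "{x0}"]) auto
  then have cM: "c M \<in> N"
    using N_strong_limit[OF outer] by simp
  have R: "((\<lambda>F. L F v) \<longlongrightarrow> L M v) (finite_subsets_at_top M)" for v
    unfolding Lv by (intro tendsto_add tendsto_const outer)
  note g = is_infimum_greatest[OF M(1) inf[OF M(2) order_refl] cM]
  show ?thesis
  proof (intro exI[of _ L] exI[of _ "L M"] conjI allI impI)
    show "limitin strong_operator_topology
        (\<lambda>n. fun_calc e (\<lambda>t. t powr (- 1 / real n)) (\<Sum>x\<in>F. op_power e (inverse_in N e (x + \<delta> *\<^sub>R e)) n))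
        (L F) sequentially" if "finite F \<and> F \<noteq> {} \<and> F \<subseteq> M" for F
      using inner[of F] that by (simp add: limitin_strong_operator_topology power_sum_def)
    show "limitin strong_operator_topology L (L M) (finite_subsets_at_top M)"
      using R by (simp add: limitin_strong_operator_topology)
    show "greatest (spectral_poset N e) (\<Sqinter>\<^bsub>spectral_poset N e\<^esub> M) (Lower (spectral_poset N e) M)"
      using g by simp
    show "\<Sqinter>\<^bsub>spectral_poset N e\<^esub> M = - (\<delta> *\<^sub>R e) + L M"
      using g(2) by (simp add: L_def)
  qed
qed

end
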